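(* Let $p\in\mathbb{R}$. (a) Suppose $d=2$. Then for every $f\in C_c^\infty(\mathbb{R}\times(0,\infty))$ and every $(x,y)\in\mathbb{R}\times(0,\infty)$, $$f(x,y)=\frac{y^p}{2\pi}\int_0^{\pi/2}\frac{(\partial_uH_uR^{(p)}f)(x+y\tan\theta,\theta)+(\partial_uH_uR^{(p)}f)(x-y\tan\theta,\theta)}{(\cos\theta)^{1+p}}\,d\theta,$$ $$f(x,y)=\frac{1}{2\pi}\int_{\mathbb{R}}\bigl(|u-x|^2+y^2\bigr)^{\frac{p-1}{2}}\,(\partial_uH_uR^{(p)}f)\Bigl(u,\arctan\Bigl(\frac{|u-x|}{y}\Bigr)\Bigr)\,du .$$ (b) Suppose $d=3$. Then for every $f\in C_c^\infty(\mathbb{R}^2\times(0,\infty))$ and every $(x,y)\in\mathbb{R}^2\times(0,\infty)$, $$f(x,y)=-\frac{y^p}{4\pi^2}\int_0^{\pi/2}\frac{1}{(\cos\theta)^{1+p}}\int_{S^1}(\Delta_uR^{(p)}f)\bigl(x+y\tan(\theta)\,n,\theta\bigr)\,dn\,d\theta,$$ $$f(x,y)=-\frac{1}{4\pi^2}\int_{\mathbb{R}^2}\frac{\bigl(|u-x|^2+y^2\bigr)^{\frac{p-1}{2}}}{|u-x|}\,(\Delta_uR^{(p)}f)\Bigl(u,\arctan\Bigl(\frac{|u-x|}{y}\Bigr)\Bigr)\,du .$$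
   Context: Points of $\mathbb{R}^d$ are written $(x,y)$ with $x\in\mathbb{R}^{d-1}$, $y\in\mathbb{R}$. $C_c^\infty(\mathbb{R}^{d-1}\times(0,\infty))$ is the space of real-valued $C^\infty$ functions on $\mathbb{R}^d$ with compact support contained in $\mathbb{R}^{d-1}\times(0,\infty)$. $S^{d-2}$ is the unit sphere in $\mathbb{R}^{d-1}$ and $dn$ its surface measure (for $d=2$, $S^0=\{-1,1\}$ with counting measure). Conical Radon transform: for $p\in\mathbb{R}$, $u\in\mathbb{R}^{d-1}$, $\theta\in(0,\pi/2)$, $$(R^{(p)}f)(u,\theta)=\int_0^\infty\frac{1}{s^p}\int_{S^{d-2}}f\bigl(u+s\sin(\theta)\,n,\ s\cos(\theta)\bigr)\,(s\sin\theta)^{d-2}\,dn\,ds .$$ For $d=2$, $\partial_u$ and $H_u$ denote the derivative and the Hilbert transform with respect to the first argument $u\in\mathbb{R}$ (for fixed $\theta$), where the Hilbert transform is normalized by $(F H_u g)(k)=-i\,\mathrm{sign}(k)\,(Fg)(k)$ with $(Fg)(k)=\int_{\mathbb{R}}e^{-iku}g(u)\,du$. For $d=3$, $\Delta_u$ denotes the Laplacian with respect to the first argument $u\in\mathbb{R}^2$. *)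

theory Defs
  imports "HOL-Analysis.Analysis"
begin

text \<open>\<open>C\<^sup>k\<close> on the whole space, via continuity of the iterated directional derivatives.\<close>

fun times_differentiable :: "nat \<Rightarrow> ('v::euclidean_space \<Rightarrow> real) \<Rightarrow> bool" where
  "times_differentiable 0 f \<longleftrightarrow> continuous_on UNIV f"
| "times_differentiable (Suc k) f \<longleftrightarrow>
     (\<forall>z. f differentiable (at z)) \<and>
     (\<forall>v. times_differentiable k (\<lambda>z. frechet_derivative f (at z) v))"

text \<open>
  Points \<open>(x, y)\<close> of \<open>d\<close>-dimensional space are pairs in \<open>'a \<times> real\<close> with \<open>'a\<close> Euclidean of
  dimension \<open>d - 1\<close>.
\<close>

definition test_function :: "('a::euclidean_space \<times> real \<Rightarrow> real) \<Rightarrow> bool" where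
  "test_function f \<longleftrightarrow>
     (\<forall>k. times_differentiable k f) \<and>
     compact (closure {z. f z \<noteq> 0}) \<and>
     closure {z. f z \<noteq> 0} \<subseteq> UNIV \<times> {0<..}"

text \<open>
  The surface measure of the unit sphere of \<open>'a\<close>, as a Borel measure on \<open>'a\<close> concentrated on the
  sphere: the measure of \<open>A\<close> is \<open>DIM('a)\<close> times the volume of the cone
  \<open>{r *\<^sub>R n | r n. 0 < r \<and> r \<le> 1 \<and> n \<in> A \<and> norm n = 1}\<close>.  For \<open>'a = real\<close> this is the
  counting measure on \<open>{- 1, 1}\<close>.
\<close>

definition sphere_measure :: "'a::euclidean_space measure" where
  "sphere_measure =
     distr (density lborel (\<lambda>z. of_nat DIM('a) * indicator (cball 0 1) z)) borel sgn"

lemma lebesgue_integral_sphere_measure_real: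
  fixes g :: "real \<Rightarrow> real"
  assumes [measurable]: "g \<in> borel_measurable borel"
  shows "(LINT n|sphere_measure. g n) = g (- 1) + g 1"
proof -
  have eq: "(of_nat DIM(real) * indicator (cball 0 1) z :: ennreal) = ennreal (indicator {-1..1} z)" for z :: real
    by (auto simp: indicator_def dist_real_def)
  have "(LINT n|sphere_measure. g n) = (LINT z|lborel. indicator {-1..1} z * g (sgn z))"
    unfolding sphere_measure_def eq by (simp add: integral_distr integral_density)
  also have "\<dots> = (LINT z|lborel. indicator {-1..<0} (z::real) * g (- 1) + indicator {0<..1} z * g 1)"
  proof (rule integral_cong_AE)
    show "AE z in lborel. indicator {-1..1} z * g (sgn z) = indicator {-1..<0} z * g (- 1) + indicator {0<..1} z * g 1"
      using AE_lborel_singleton[of 0] by eventually_elim (auto simp: indicator_def sgn_if)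
  qed measurable
  also have "\<dots> = g (- 1) + g 1"
    by (subst Bochner_Integration.integral_add) auto
  finally show ?thesis .
qed

definition conical_radon ::
    "real \<Rightarrow> ('a::euclidean_space \<times> real \<Rightarrow> real) \<Rightarrow> 'a \<Rightarrow> real \<Rightarrow> real" where
  "conical_radon p f u \<theta> =
     (LBINT s:{0<..}. 1 / s powr p *
        (LINT n|sphere_measure.
           f (u + (s * sin \<theta>) *\<^sub>R n, s * cos \<theta>) * (s * sin \<theta>) ^ (DIM('a) - 1)))"

definition fourier :: "(real \<Rightarrow> complex) \<Rightarrow> real \<Rightarrow> complex" where
  "fourier g k = (LBINT u. exp (- \<i> * of_real (k * u)) * g u)"

text \<open>
  The Hilbert transform is the Fourier multiplier with symbol \<open>- \<i> * sgn k\<close>, i.e. the inverse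
  Fourier transform of \<open>\<lambda>k. - \<i> * sgn k * fourier g k\<close>.  The integral converges absolutely as
  soon as \<open>fourier g\<close> is integrable, in particular for smooth \<open>g\<close> with compact support.
\<close>

definition hilbert :: "(real \<Rightarrow> complex) \<Rightarrow> real \<Rightarrow> complex" where
  "hilbert g u =
     1 / (2 * of_real pi) *
     (LBINT k. exp (\<i> * of_real (k * u)) * (- \<i> * of_real (sgn k) * fourier g k))"

definition d_hilbert_radon ::
    "real \<Rightarrow> (real \<times> real \<Rightarrow> real) \<Rightarrow> real \<Rightarrow> real \<Rightarrow> complex" where
  "d_hilbert_radon p f u \<theta> =
     vector_derivative (hilbert (\<lambda>v. of_real (conical_radon p f v \<theta>))) (at u)"

definition laplacian :: "('a::euclidean_space \<Rightarrow> real) \<Rightarrow> 'a \<Rightarrow> real" where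
  "laplacian g u = (\<Sum>b\<in>Basis. (deriv ^^ 2) (\<lambda>t. g (u + t *\<^sub>R b)) 0)"

definition laplacian_radon ::
    "real \<Rightarrow> ('a::euclidean_space \<times> real \<Rightarrow> real) \<Rightarrow> 'a \<Rightarrow> real \<Rightarrow> real" where
  "laplacian_radon p f u \<theta> = laplacian (\<lambda>v. conical_radon p f v \<theta>) u"

end

theory Submission
  imports Defs "HOL-Probability.Probability" "HOL-Real_Asymp.Real_Asymp"
begin

text \<open>
  Put \<open>F(x, t) = t\<^sup>-\<^sup>p f(x, t)\<close>, which is again a test function, and \<open>\<tau> = tan \<theta>\<close>.  In the variable
  \<open>t = s cos \<theta>\<close>, and with \<open>w\<close> standing for \<open>t n\<close>, polar coordinates turn the conical transform into
  \<open>(cos \<theta>)\<^sup>p\<^sup>-\<^sup>1 \<tau>\<^sup>d\<^sup>-\<^sup>2\<close> times the integral of \<open>F (u + \<tau> w, |w|)\<close> over all \<open>w\<close> in the horizontal space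
  (\<open>conical_radon_eq_cone_integral\<close>).  The powers of \<open>cos \<theta>\<close> and of \<open>|u - x|\<^sup>2 + y\<^sup>2\<close> in the
  formulas cancel against this factor, so that \<open>p\<close> disappears, and the two formulas in each
  dimension are the same statement in the coordinates \<open>\<tau> = tan \<theta>\<close> and \<open>u\<close>.

  In dimension two the cone integral is a sum of two line integrals, over the lines of slopes
  \<open>\<tau>\<close> and \<open>- \<tau>\<close>.  By the projection-slice theorem its Fourier transform in \<open>u\<close> consists of the values of
  the Fourier transform of \<open>F\<close> at \<open>(k, \<plusminus> k \<tau>)\<close>, and \<open>\<partial>\<^sub>u H\<^sub>u\<close> multiplies them by \<open>|k|\<close>.  This is the
  Jacobian of \<open>(k, \<tau>) \<mapsto> (k, k \<tau>)\<close>.  So the integral over \<open>\<tau>\<close> along \<open>u = x + y \<tau>\<close> is the Fourier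
  inversion integral of \<open>F\<close> in the plane, evaluated at \<open>(x, y)\<close> and at \<open>(x, - y)\<close>, and \<open>F\<close>
  vanishes at the second point (\<open>filtered_line_integral_ray_integral\<close>, \<open>inversion_dim2\<close>).

  In dimension three everything happens in real space.  Let \<open>\<Delta>\<close> be the Laplacian in the
  horizontal variable and \<open>h u\<close> the cone integral of \<open>\<Delta> F\<close> with apex \<open>x + y u\<close> and slope \<open>|u|\<close>.  Both
  formulas say that \<open>h\<close> is integrable with integral \<open>- 4 \<pi>\<^sup>2 F(x, y)\<close>.
  \<^item> Integrability needs decay in the slope.  After the substitution \<open>v = u + \<tau> w\<close> the height is
    \<open>|v - u| / \<tau>\<close>, so a horizontal derivative may be exchanged for a vertical one, which gains
    a factor \<open>1 / \<tau>\<close> (\<open>cone_integral_dir_deriv_decay\<close>).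
  \<^item> For the value, identify the horizontal plane with the complex numbers.  A translation and a
    rotation give \<open>h u = \<integral> \<Delta> F (x + u c, |c - y|) dc\<close>, and \<open>v = u c\<close> turns the integral of \<open>h\<close>
    into that of \<open>\<Delta> F (x + v, |c - y|) / |c|\<^sup>2\<close> over \<open>c\<close> and \<open>v\<close>.  This is not absolutely
    convergent: the integral over \<open>v\<close> vanishes for each \<open>c \<noteq> 0\<close>, and the answer is concentrated
    at \<open>c = 0\<close>.  The factor \<open>1 / (1 + \<epsilon>\<^sup>2 |u|\<^sup>2)\<close> replaces \<open>|c|\<^sup>2\<close> by \<open>|c|\<^sup>2 + \<epsilon>\<^sup>2 |v|\<^sup>2\<close>.
    Integration by parts in \<open>v\<close> and the scaling \<open>c = \<epsilon> d\<close> give the integral of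
    \<open>2 (v \<cdot> \<nabla>) F (x + v, |\<epsilon> d - y|) / (|d|\<^sup>2 + |v|\<^sup>2)\<^sup>2\<close>, which converges absolutely, uniformly in
    \<open>\<epsilon>\<close>.  In the limit only the height \<open>y\<close> is left.  The integral over \<open>d\<close> is \<open>2 \<pi> / |v|\<^sup>2\<close>, and in
    polar coordinates \<open>(v \<cdot> \<nabla>) F / |v|\<^sup>2\<close> integrates to \<open>- 2 \<pi> F(x, y)\<close> by the fundamental
    theorem of calculus (\<open>cone_laplacian_integral\<close>).
\<close>

section \<open>Test functions\<close>

definition dir_deriv :: "'v::euclidean_space \<Rightarrow> ('v \<Rightarrow> real) \<Rightarrow> 'v \<Rightarrow> real" where
  "dir_deriv v F z = frechet_derivative F (at z) v"

lemma times_differentiable_continuous: "times_differentiable k f \<Longrightarrow> continuous_on UNIV f"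
  by (cases k) (auto simp: continuous_on_eq_continuous_at differentiable_imp_continuous_within)

lemma times_differentiable_add:
  "times_differentiable k f \<Longrightarrow> times_differentiable k g \<Longrightarrow> times_differentiable k (\<lambda>z. f z + g z)"
proof (induction k arbitrary: f g)
  case (Suc k)
  have "frechet_derivative (\<lambda>z. f z + g z) (at z) v = frechet_derivative f (at z) v + frechet_derivative g (at z) v" for z v
  proof -
    have "(f has_derivative frechet_derivative f (at z)) (at z)"
      "(g has_derivative frechet_derivative g (at z)) (at z)"
      using Suc.prems unfolding times_differentiable.simps frechet_derivative_works by blast+
    from fun_cong[OF frechet_derivative_at[OF has_derivative_add[OF this]], of v] show ?thesis by simp
  qed
  then show ?case using Suc by (auto intro!: derivative_intros)
qed (auto intro: continuous_intros)

lemma times_differentiable_cmult: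
  "times_differentiable k f \<Longrightarrow> times_differentiable k (\<lambda>z. c * f z)"
proof (induction k arbitrary: f)
  case (Suc k)
  have "frechet_derivative (\<lambda>z. c * f z) (at z) v = c * frechet_derivative f (at z) v" for z v
  proof -
    have "(f has_derivative frechet_derivative f (at z)) (at z)"
      using Suc.prems frechet_derivative_works by auto
    from fun_cong[OF frechet_derivative_at[OF has_derivative_mult_right[OF this, of c]], of v]
    show ?thesis by simp
  qed
  then show ?case using Suc by (auto intro!: derivative_intros)
qed (auto intro: continuous_intros)

lemma test_function_has_derivative:
  assumes "test_function F"
  shows "(F has_derivative (\<lambda>v. dir_deriv v F z)) (at z)"
proof -
  have "times_differentiable (Suc 0) F" using assms by (auto simp: test_function_def)
  then have "F differentiable at z" by (metis times_differentiable.simps(2))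
  then show ?thesis by (simp add: frechet_derivative_works dir_deriv_def[abs_def])
qed

lemma test_function_continuous: "test_function F \<Longrightarrow> continuous_on UNIV F"
  using times_differentiable_continuous by (auto simp: test_function_def)

lemma test_function_vanishes_nonpos: "test_function F \<Longrightarrow> snd z \<le> 0 \<Longrightarrow> F z = 0"
  using closure_subset[of "{z. F z \<noteq> 0}"] by (force simp: test_function_def)

text \<open>
  The support is compact inside the open half space, so its heights stay away from 0.  One radius
  serves as a bound for the support and for the values.
\<close>

lemma test_function_bounds:
  fixes F :: "'a::euclidean_space \<times> real \<Rightarrow> real"
  assumes "test_function F"
  obtains R a where "0 < R" "0 < a" "\<And>x t. F (x, t) \<noteq> 0 \<Longrightarrow> norm x \<le> R \<and> a \<le> t \<and> t \<le> R"
    "\<And>z. \<bar>F z\<bar> \<le> R"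
proof -
  define K where "K = closure {z. F z \<noteq> 0}"
  have K: "compact K" "K \<subseteq> UNIV \<times> {0<..}" and in_K: "F z \<noteq> 0 \<Longrightarrow> z \<in> K" for z
    using assms closure_subset[of "{z. F z \<noteq> 0}"] by (auto simp: test_function_def K_def)
  obtain B where B: "B > 0" "\<And>z. z \<in> K \<Longrightarrow> norm z \<le> B"
    using compact_imp_bounded[OF K(1)] bounded_pos by metis
  have "bounded (F ` K)"
    using compact_continuous_image[OF continuous_on_subset[OF test_function_continuous[OF assms]] K(1)]
    by (auto intro: compact_imp_bounded)
  then obtain C where C: "C > 0" "\<And>z. z \<in> K \<Longrightarrow> \<bar>F z\<bar> \<le> C"
    unfolding bounded_pos by (auto simp: image_iff)
  have "\<exists>a>0. \<forall>z\<in>K. a \<le> snd z"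
  proof (cases "K = {}")
    case False
    from continuous_attains_inf[OF K(1) False continuous_on_snd[OF continuous_on_id]]
    obtain w where "w \<in> K" "\<forall>z\<in>K. snd w \<le> snd z"
      by blast
    then show ?thesis using K(2) by (intro exI[of _ "snd w"]) auto
  qed (auto intro: exI[of _ 1])
  then obtain a where a: "a > 0" "\<And>z. z \<in> K \<Longrightarrow> a \<le> snd z" by auto
  show thesis
  proof (rule that[of "B + C" a])
    fix x t assume "F (x, t) \<noteq> 0"
    then have "(x, t) \<in> K" by (rule in_K)
    with B(2)[of "(x,t)"] a(2)[of "(x,t)"] C(1) norm_fst_le[of x t] norm_snd_le[of t x]
    show "norm x \<le> B + C \<and> a \<le> t \<and> t \<le> B + C" by auto
  next
    fix z show "\<bar>F z\<bar> \<le> B + C"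
      using C(2)[of z] C(1) in_K[of z] B(1) by (cases "F z = 0") simp_all
  qed (use B C a in auto)
qed

lemma test_function_support_mono:
  assumes "test_function F" and td: "\<And>k. times_differentiable k G"
    and sub: "\<And>z. z \<notin> closure {z. F z \<noteq> 0} \<Longrightarrow> G z = 0"
  shows "test_function G"
proof -
  have "closure {z. G z \<noteq> 0} \<subseteq> closure {z. F z \<noteq> 0}"
    by (rule closure_minimal) (use sub in auto)
  then show ?thesis
    using assms(1) td by (auto simp: test_function_def simp: compact_eq_bounded_closed intro: bounded_subset)
qed

lemma test_function_add:
  assumes F: "test_function F" and G: "test_function G"
  shows "test_function (\<lambda>z. F z + G z)"
proof -
  have sub: "closure {z. F z + G z \<noteq> 0} \<subseteq> closure {z. F z \<noteq> 0} \<union> closure {z. G z \<noteq> 0}"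
  proof (rule closure_minimal)
    have "z \<in> closure {z. F z \<noteq> 0} \<union> closure {z. G z \<noteq> 0}" if "F z + G z \<noteq> 0" for z
      using that closure_subset[of "{z. F z \<noteq> 0}"] closure_subset[of "{z. G z \<noteq> 0}"]
      by (cases "F z = 0") auto
    then show "{z. F z + G z \<noteq> 0} \<subseteq> closure {z. F z \<noteq> 0} \<union> closure {z. G z \<noteq> 0}" by blast
  qed auto
  moreover have "compact (closure {z. F z \<noteq> 0} \<union> closure {z. G z \<noteq> 0})"
    using F G by (auto simp: test_function_def)
  ultimately have "compact (closure {z. F z + G z \<noteq> 0})"
    by (meson bounded_subset closed_closure compact_eq_bounded_closed)
  with sub F G show ?thesis
    unfolding test_function_def by (blast intro: times_differentiable_add)
qed

lemma test_function_dir_deriv: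
  assumes "test_function F"
  shows "test_function (dir_deriv v F)"
proof (rule test_function_support_mono[OF assms])
  fix k show "times_differentiable k (dir_deriv v F)"
    using assms unfolding test_function_def dir_deriv_def[abs_def] by (metis times_differentiable.simps(2))
next
  fix z assume "z \<notin> closure {z. F z \<noteq> 0}"
  then have z: "z \<in> - closure {z. F z \<noteq> 0}" by simp
  have d: "(F has_derivative (\<lambda>v. 0)) (at z)"
    by (rule has_derivative_transform_within_open[OF has_derivative_const[of 0] _ z])
       (use closure_subset[of "{z. F z \<noteq> 0}"] in auto)
  show "dir_deriv v F z = 0"
    using fun_cong[OF frechet_derivative_at[OF d], of v] by (simp add: dir_deriv_def)
qed

text \<open>
  The derivative of such a product is a combination of products of the same kind, with the exponents
  \<open>q\<close> and \<open>q - 1\<close>, so all orders of differentiability follow by one induction.  Near a point of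
  height at most 0 the product is identically 0, whatever the value of \<open>powr\<close> is there.
\<close>

lemma test_function_power_weight:
  fixes F :: "'a::euclidean_space \<times> real \<Rightarrow> real"
  assumes "test_function F"
  shows "test_function (\<lambda>z. snd z powr q * F z)"
proof (rule test_function_support_mono[OF assms])
  show "times_differentiable k (\<lambda>z. snd z powr q * F z)" for k
    using assms
  proof (induction k arbitrary: q F)
    have D: "((\<lambda>z. snd z powr q * F z) has_derivative
        (\<lambda>v. snd z powr q * dir_deriv v F z + q * snd v * (snd z powr (q - 1) * F z))) (at z)"
      if F: "test_function F" for q and F :: "'a \<times> real \<Rightarrow> real" and z
    proof (cases "snd z > 0")
      case True
      have "((\<lambda>s. s powr q) has_derivative (*) (q * snd z powr (q - 1))) (at (snd z))"
        using has_real_derivative_powr[OF True, of q] by (simp add: has_field_derivative_def)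
      from has_derivative_compose[OF has_derivative_snd[OF has_derivative_ident] this]
      have "((\<lambda>z. snd z powr q) has_derivative (\<lambda>v. q * snd z powr (q - 1) * snd v)) (at z)"
        by simp
      from has_derivative_mult[OF this test_function_has_derivative[OF F]]
      show ?thesis by (rule has_derivative_eq_rhs) (simp add: fun_eq_iff)
    next
      case False
      let ?C = "closure {z. F z \<noteq> 0}"
      have z: "z \<notin> ?C" using F False by (auto simp: test_function_def)
      have "((\<lambda>z. snd z powr q * F z) has_derivative (\<lambda>v. 0)) (at z)"
        by (rule has_derivative_transform_within_open[OF has_derivative_const[of 0], of "- ?C"])
           (use z closure_subset[of "{z. F z \<noteq> 0}"] in auto)
      moreover have "dir_deriv v F z = 0" "F z = 0" for v
        using test_function_vanishes_nonpos[OF test_function_dir_deriv[OF F]]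
          test_function_vanishes_nonpos[OF F] False by auto
      ultimately show ?thesis by simp
    qed
    {
      case 0
      show ?case using D[OF 0]
        by (auto simp: continuous_on_eq_continuous_at intro: has_derivative_continuous)
    next
      case (Suc k)
      have "frechet_derivative (\<lambda>z. snd z powr q * F z) (at z) v
          = snd z powr q * dir_deriv v F z + q * snd v * (snd z powr (q - 1) * F z)" for z v
        using fun_cong[OF frechet_derivative_at[OF D[OF Suc.prems]], where x = v] by simp
      moreover have "(\<lambda>z. snd z powr q * F z) differentiable (at z)" for z
        using D[OF Suc.prems] unfolding differentiable_def by blast
      ultimately show ?case
        by (simp add: times_differentiable_add times_differentiable_cmult Suc test_function_dir_deriv)
    }
  qed
qed (use closure_subset[of "{z. F z \<noteq> 0}"] in auto)

lemma test_function_measurable: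
  fixes F :: "'a::euclidean_space \<times> real \<Rightarrow> real"
  shows "test_function F \<Longrightarrow> F \<in> borel_measurable borel"
  by (intro borel_measurable_continuous_onI test_function_continuous)

text \<open>
  The same fact for the product \<open>\<sigma>\<close>-algebra, which is the form that measurability of functions
  built with pairs refers to.
\<close>

lemma test_function_borel_pair:
  fixes F :: "'a::euclidean_space \<times> real \<Rightarrow> real"
  shows "test_function F \<Longrightarrow> F \<in> borel_measurable (borel \<Otimes>\<^sub>M borel)"
  by (simp add: borel_prod test_function_measurable)

section \<open>Differentiation under the integral sign and translation invariance\<close>

lemma has_vector_derivative_iff_quotient:
  fixes f :: "real \<Rightarrow> 'b::real_normed_vector"
  shows "(f has_vector_derivative D) (at x) \<longleftrightarrow> ((\<lambda>s. (f s - f x) /\<^sub>R (s - x)) \<longlongrightarrow> D) (at x)"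
proof -
  have "(f has_vector_derivative D) (at x) \<longleftrightarrow> ((\<lambda>s. norm (f s - f x - (s - x) *\<^sub>R D) / norm (s - x)) \<longlongrightarrow> 0) (at x)"
    by (simp add: has_vector_derivative_def has_derivative_iff_norm bounded_linear_scaleR_left)
  also have "\<dots> \<longleftrightarrow> ((\<lambda>s. norm ((f s - f x) /\<^sub>R (s - x) - D)) \<longlongrightarrow> 0) (at x)"
  proof (rule tendsto_cong)
    have "norm (f s - f x - (s - x) *\<^sub>R D) / norm (s - x) = norm ((f s - f x) /\<^sub>R (s - x) - D)" if "s \<noteq> x" for s
    proof -
      have "(f s - f x) /\<^sub>R (s - x) - D = (f s - f x - (s - x) *\<^sub>R D) /\<^sub>R (s - x)"
        using that by (simp add: scaleR_right_diff_distrib)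
      then show ?thesis by (simp add: divide_inverse mult.commute)
    qed
    then show "\<forall>\<^sub>F s in at x. norm (f s - f x - (s - x) *\<^sub>R D) / norm (s - x) = norm ((f s - f x) /\<^sub>R (s - x) - D)"
      by (auto simp: eventually_at_filter)
  qed
  also have "\<dots> \<longleftrightarrow> ((\<lambda>s. (f s - f x) /\<^sub>R (s - x)) \<longlongrightarrow> D) (at x)"
    by (simp add: tendsto_norm_zero_iff LIM_zero_iff)
  finally show ?thesis .
qed

text \<open>
  By the mean value theorem the dominating function of the derivatives also dominates the difference
  quotients, so dominated convergence applies to them.
\<close>

lemma has_vector_derivative_integral_dominated:
  fixes f :: "real \<Rightarrow> 'a \<Rightarrow> 'b::{banach, second_countable_topology}"
  assumes "0 < \<delta>"
    and int: "\<And>s. \<bar>s - s0\<bar> < \<delta> \<Longrightarrow> integrable M (f s)"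
    and deriv: "\<And>s z. \<bar>s - s0\<bar> < \<delta> \<Longrightarrow> ((\<lambda>s. f s z) has_vector_derivative f' s z) (at s)"
    and w: "integrable M w" "\<And>s z. \<bar>s - s0\<bar> < \<delta> \<Longrightarrow> norm (f' s z) \<le> w z"
  shows "((\<lambda>s. LINT z|M. f s z) has_vector_derivative (LINT z|M. f' s0 z)) (at s0)"
proof -
  have quot: "(\<lambda>i. (f (X i) z - f s0 z) /\<^sub>R (X i - s0)) \<longlonglongrightarrow> f' s0 z"
    if X: "\<And>i. X i \<noteq> s0" "X \<longlonglongrightarrow> s0" for X z
  proof -
    have "((\<lambda>s. f s z) has_vector_derivative f' s0 z) (at s0)"
      by (rule deriv) (use \<open>0 < \<delta>\<close> in simp)
    then have 1: "((\<lambda>s. (f s z - f s0 z) /\<^sub>R (s - s0)) \<longlongrightarrow> f' s0 z) (at s0)"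
      by (simp only: has_vector_derivative_iff_quotient)
    have 2: "filterlim X (at s0) sequentially"
      using X by (simp add: filterlim_at)
    show ?thesis by (fact filterlim_compose[OF 1 2])
  qed
  have bnd: "norm ((f s z - f s0 z) /\<^sub>R (s - s0)) \<le> w z" if "\<bar>s - s0\<bar> < \<delta>" "s \<noteq> s0" for s z
  proof -
    have "norm (f s z - f s0 z) \<le> w z * norm (s - s0)"
    proof (rule differentiable_bound[of "closed_segment s0 s" "\<lambda>s. f s z" "\<lambda>s h. h *\<^sub>R f' s z" "w z"])
      fix r assume "r \<in> closed_segment s0 s"
      then have r: "\<bar>r - s0\<bar> < \<delta>" using that segment_bound(1)[of r s0 s] by auto
      show "((\<lambda>s. f s z) has_derivative (\<lambda>h. h *\<^sub>R f' r z)) (at r within closed_segment s0 s)"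
        using deriv[OF r, of z] by (auto simp: has_vector_derivative_def intro: has_derivative_at_withinI)
      have "norm (h *\<^sub>R f' r z) \<le> w z * norm h" for h
        using mult_right_mono[OF w(2)[OF r, of z], of "\<bar>h\<bar>"] by (simp add: mult.commute)
      then show "onorm (\<lambda>h. h *\<^sub>R f' r z) \<le> w z" by (rule onorm_le)
    qed auto
    then show ?thesis using that by (simp add: divide_le_eq flip: divide_inverse_commute)
  qed
  \<comment> \<open>The difference quotients along a fixed sequence show that the derivative is measurable.\<close>
  define X0 where "X0 i = s0 + \<delta> / 2 / real (Suc i)" for i
  have ms: "f s \<in> borel_measurable M" if "\<bar>s - s0\<bar> < \<delta>" for s
    using int[OF that] by auto
  have ms0: "f s0 \<in> borel_measurable M"
    by (rule ms) (use \<open>0 < \<delta>\<close> in simp)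
  have m': "f' s0 \<in> borel_measurable M"
  proof (rule borel_measurable_LIMSEQ_metric)
    have "(\<lambda>i. \<delta> / 2 / real (Suc i)) \<longlonglongrightarrow> 0"
      by (rule LIMSEQ_Suc[OF lim_const_over_n])
    from tendsto_add[OF tendsto_const[of s0] this] have "X0 \<longlonglongrightarrow> s0"
      by (simp add: X0_def[abs_def])
    then show "(\<lambda>i. (f (X0 i) z - f s0 z) /\<^sub>R (X0 i - s0)) \<longlonglongrightarrow> f' s0 z" for z
      by (intro quot[of X0]) (use \<open>0 < \<delta>\<close> in \<open>auto simp: X0_def\<close>)
    have X0: "\<bar>X0 i - s0\<bar> < \<delta>" for i
    proof -
      have "\<delta> / 2 / real (Suc i) \<le> \<delta> / 2 / 1" "0 < \<delta> / 2 / real (Suc i)"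
        using \<open>0 < \<delta>\<close> by (intro divide_left_mono divide_pos_pos; simp)+
      moreover have "X0 i - s0 = \<delta> / 2 / real (Suc i)" by (simp add: X0_def)
      ultimately show ?thesis using \<open>0 < \<delta>\<close> by linarith
    qed
    show "(\<lambda>z. (f (X0 i) z - f s0 z) /\<^sub>R (X0 i - s0)) \<in> borel_measurable M" for i
    proof -
      have [measurable]: "f (X0 i) \<in> borel_measurable M" "f s0 \<in> borel_measurable M"
        using ms[OF X0] ms0 by auto
      show ?thesis by measurable
    qed
  qed
  have "((\<lambda>s. ((LINT z|M. f s z) - (LINT z|M. f s0 z)) /\<^sub>R (s - s0)) \<longlongrightarrow> (LINT z|M. f' s0 z)) (at s0)"
    unfolding tendsto_at_iff_sequentially
  proof (intro allI impI)
    fix X :: "nat \<Rightarrow> real" assume X: "\<forall>i. X i \<in> UNIV - {s0}" "X \<longlonglongrightarrow> s0"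
    obtain N where N: "\<And>i. i \<ge> N \<Longrightarrow> \<bar>X i - s0\<bar> < \<delta>"
      using LIMSEQ_D[OF X(2) \<open>0 < \<delta>\<close>] unfolding real_norm_def by blast
    have N': "\<bar>X (i + N) - s0\<bar> < \<delta>" for i by (rule N) auto
    have "(\<lambda>i. LINT z|M. (f (X (i + N)) z - f s0 z) /\<^sub>R (X (i + N) - s0)) \<longlonglongrightarrow> (LINT z|M. f' s0 z)"
    proof (rule integral_dominated_convergence[OF m' _ w(1)])
      show "(\<lambda>z. (f (X (i + N)) z - f s0 z) /\<^sub>R (X (i + N) - s0)) \<in> borel_measurable M" for i
      proof -
        have [measurable]: "f (X (i + N)) \<in> borel_measurable M" "f s0 \<in> borel_measurable M"
          using ms[OF N'] ms0 by auto
        show ?thesis by measurable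
      qed
      show "AE z in M. (\<lambda>i. (f (X (i + N)) z - f s0 z) /\<^sub>R (X (i + N) - s0)) \<longlonglongrightarrow> f' s0 z"
      proof -
        have "(\<lambda>i. X (i + N)) \<longlonglongrightarrow> s0" by (rule LIMSEQ_ignore_initial_segment[OF X(2)])
        moreover have "X (i + N) \<noteq> s0" for i using X(1) by auto
        ultimately show ?thesis using quot[of "\<lambda>i. X (i + N)"] by auto
      qed
      show "AE z in M. norm ((f (X (i + N)) z - f s0 z) /\<^sub>R (X (i + N) - s0)) \<le> w z" for i
      proof (rule AE_I2)
        fix z
        have "X (i + N) \<noteq> s0" using X(1) by auto
        then show "norm ((f (X (i + N)) z - f s0 z) /\<^sub>R (X (i + N) - s0)) \<le> w z" by (rule bnd[OF N'])
      qed
    qed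
    also have "(\<lambda>i. LINT z|M. (f (X (i + N)) z - f s0 z) /\<^sub>R (X (i + N) - s0)) =
        (\<lambda>i. ((LINT z|M. f (X (i + N)) z) - (LINT z|M. f s0 z)) /\<^sub>R (X (i + N) - s0))"
    proof
      fix i
      have "integrable M (f s0)" by (rule int) (use \<open>0 < \<delta>\<close> in simp)
      then show "(LINT z|M. (f (X (i + N)) z - f s0 z) /\<^sub>R (X (i + N) - s0)) =
          ((LINT z|M. f (X (i + N)) z) - (LINT z|M. f s0 z)) /\<^sub>R (X (i + N) - s0)"
        using int[OF N', of i] by simp
    qed
    finally show "((\<lambda>s. ((LINT z|M. f s z) - (LINT z|M. f s0 z)) /\<^sub>R (s - s0)) \<circ> X) \<longlonglongrightarrow> (LINT z|M. f' s0 z)"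
      unfolding o_def by (rule LIMSEQ_offset[where k = N])
  qed
  then show "((\<lambda>s. LINT z|M. f s z) has_vector_derivative (LINT z|M. f' s0 z)) (at s0)"
    by (simp add: has_vector_derivative_iff_quotient)
qed

lemma integrable_bounded_support:
  fixes f :: "'a::euclidean_space \<Rightarrow> 'b::{banach, second_countable_topology}"
  assumes "f \<in> borel_measurable borel" "\<And>z. norm (f z) \<le> C" "\<And>z. R < norm z \<Longrightarrow> f z = 0"
  shows "integrable lborel f"
proof (rule Bochner_Integration.integrable_bound)
  have "emeasure lborel (cball 0 R :: 'a set) < \<infinity>"
    by (rule emeasure_bounded_finite) simp
  then show "integrable lborel (\<lambda>z::'a. C * indicator (cball 0 R) z)"
    by (intro integrable_mult_right integrable_real_indicator) auto
  show "f \<in> borel_measurable lborel" using assms(1) by simp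
  have "0 \<le> C" using order_trans[OF norm_ge_zero assms(2)] .
  have "norm (f z) \<le> norm (C * indicator (cball 0 R) z)" for z
    using assms(2)[of z] assms(3)[of z] \<open>0 \<le> C\<close> by (cases "norm z \<le> R") (auto simp: indicator_def)
  then show "AE z in lborel. norm (f z) \<le> norm (C * indicator (cball 0 R) z)" by simp
qed

lemma ball_majorant_integrable:
  "integrable lborel (\<lambda>x :: 'a::euclidean_space. if norm x \<le> R then C else 0 :: real)"
  by (rule integrable_bounded_support[of _ "\<bar>C\<bar>" R]) auto

lemma integral_lborel_translate:
  fixes f :: "'a::euclidean_space \<Rightarrow> 'b::{banach, second_countable_topology}"
  assumes [measurable]: "f \<in> borel_measurable borel"
  shows "(LINT z|lborel. f (z + c)) = (LINT z|lborel. f z)"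
proof -
  have "(LINT z|lborel. f z) = (LINT z|distr lborel borel ((+) c). f z)"
    by (simp add: lborel_distr_plus)
  also have "\<dots> = (LINT z|lborel. f (c + z))" by (rule integral_distr) auto
  finally show ?thesis by (simp add: add.commute)
qed

lemma integrable_lborel_translate:
  fixes f :: "'a::euclidean_space \<Rightarrow> 'b::{banach, second_countable_topology}"
  assumes "integrable lborel f"
  shows "integrable lborel (\<lambda>z. f (z + c))"
proof -
  have [measurable]: "f \<in> borel_measurable borel" using borel_measurable_integrable[OF assms] by simp
  have "integrable (distr lborel borel ((+) c)) f" using assms by (simp add: lborel_distr_plus)
  then have "integrable lborel (\<lambda>z. f (c + z))" by (subst (asm) integrable_distr_eq) auto
  then show ?thesis by (simp add: add.commute)
qed

text \<open>
  The integral of \<open>K (z + s b)\<close> does not depend on \<open>s\<close>, so its derivative in \<open>s\<close> is 0.  Applied to a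
  product, this is integration by parts in the direction \<open>b\<close>.
\<close>

lemma integral_directional_derivative_eq_0:
  fixes K :: "'a::euclidean_space \<Rightarrow> 'b::{banach, second_countable_topology}"
  assumes deriv: "\<And>z. ((\<lambda>s. K (z + s *\<^sub>R b)) has_vector_derivative K' z) (at 0)"
    and K: "integrable lborel K"
    and bnd: "\<And>z. norm (K' z) \<le> C" and supp: "\<And>z. R < norm z \<Longrightarrow> K' z = 0"
  shows "(LINT z|lborel. K' z) = 0"
proof -
  define w where "w z = (if norm z \<le> R + norm b then C else 0)" for z :: 'a
  have "0 \<le> C" using order_trans[OF norm_ge_zero bnd] .
  have D: "((\<lambda>s. K (z + s *\<^sub>R b)) has_vector_derivative K' (z + s0 *\<^sub>R b)) (at s0)" for s0 z
  proof -
    have "((\<lambda>s. K (z + s0 *\<^sub>R b + s *\<^sub>R b)) has_vector_derivative K' (z + s0 *\<^sub>R b)) (at (s0 - s0))"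
      using deriv[of "z + s0 *\<^sub>R b"] by simp
    then have "((\<lambda>s. K (z + s0 *\<^sub>R b + s *\<^sub>R b)) \<circ> (\<lambda>s. s - s0) has_vector_derivative 1 *\<^sub>R K' (z + s0 *\<^sub>R b)) (at s0)"
      by (intro vector_diff_chain_at) (auto intro!: derivative_eq_intros)
    then show ?thesis by (simp add: o_def algebra_simps)
  qed
  have int: "integrable lborel (\<lambda>z. K (z + s *\<^sub>R b))" for s
    by (rule integrable_lborel_translate[OF K])
  have w: "integrable lborel w" unfolding w_def by (rule ball_majorant_integrable)
  \<comment> \<open>A shift by \<open>s b\<close> with \<open>|s| < 1\<close> moves the support by at most the length of \<open>b\<close>.\<close>
  have wb: "norm (K' (z + s *\<^sub>R b)) \<le> w z" if "\<bar>s - 0\<bar> < 1" for s z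
  proof (cases "norm z \<le> R + norm b")
    case True
    then show ?thesis using bnd by (simp add: w_def)
  next
    case False
    have "norm (s *\<^sub>R b) \<le> norm b" using that by (simp add: mult_left_le_one_le)
    then have "R < norm (z + s *\<^sub>R b)"
      using False norm_diff_ineq[of z "s *\<^sub>R b"] by simp
    then show ?thesis using supp \<open>0 \<le> C\<close> by (simp add: w_def)
  qed
  have one: "0 < (1::real)" by simp
  note L = has_vector_derivative_integral_dominated[where f = "\<lambda>s z. K (z + s *\<^sub>R b)" and f' = "\<lambda>s z. K' (z + s *\<^sub>R b)"
      and w = w and ?s0.0 = 0, OF one int D w wb]
  have "(LINT z|lborel. K (z + s *\<^sub>R b)) = (LINT z|lborel. K z)" for s
    by (rule integral_lborel_translate) (use K in auto)
  with L have "((\<lambda>s::real. LINT z|lborel. K z) has_vector_derivative (LINT z|lborel. K' z)) (at 0)"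
    by simp
  from vector_derivative_unique_at[OF this has_vector_derivative_const]
  show "(LINT z|lborel. K' z) = 0" .
qed

lemma isCont_integral_dominated:
  fixes f :: "'c::metric_space \<Rightarrow> 'a \<Rightarrow> 'b::{banach, second_countable_topology}"
  assumes cont: "\<And>z. isCont (\<lambda>s. f s z) s0"
    and meas: "\<And>s. f s \<in> borel_measurable M"
    and w: "integrable M w" "\<And>s z. norm (f s z) \<le> w z"
  shows "isCont (\<lambda>s. LINT z|M. f s z) s0"
  unfolding continuous_at_sequentially o_def
proof (intro allI impI)
  fix X :: "nat \<Rightarrow> 'c" assume X: "X \<longlonglongrightarrow> s0"
  show "(\<lambda>n. LINT z|M. f (X n) z) \<longlonglongrightarrow> (LINT z|M. f s0 z)"
  proof (rule integral_dominated_convergence[OF meas meas w(1)])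
    show "AE z in M. (\<lambda>n. f (X n) z) \<longlonglongrightarrow> f s0 z"
      using cont X by (auto simp: continuous_at_sequentially o_def)
  qed (use w(2) in auto)
qed

lemma test_function_integrable:
  fixes F :: "'a::euclidean_space \<times> real \<Rightarrow> real"
  assumes "test_function F"
  shows "integrable lborel F"
proof -
  obtain R a where R: "0 < R" "\<And>x t. F (x, t) \<noteq> 0 \<Longrightarrow> norm x \<le> R \<and> a \<le> t \<and> t \<le> R" "\<And>z. \<bar>F z\<bar> \<le> R" "0 < a"
    using test_function_bounds[OF assms] by metis
  show ?thesis
  proof (rule integrable_bounded_support[of _ R "R + R"])
    fix z :: "'a \<times> real" assume z: "R + R < norm z"
    have "F (x, t) = 0" if "R + R < norm (x, t)" for x t
      using R(2)[of x t] norm_Pair_le[of x t] that \<open>0 < a\<close> by force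
    then show "F z = 0" using z by (cases z) auto
  qed (use R(3) test_function_measurable[OF assms] in auto)
qed

section \<open>Polar coordinates\<close>

lemma cball_borel[measurable]: "cball c r \<in> sets (borel :: 'a::euclidean_space measure)"
  by simp

lemma nn_integral_lborel_scale:
  fixes h :: "'a::euclidean_space \<Rightarrow> ennreal"
  assumes [measurable]: "h \<in> borel_measurable borel" and "c \<noteq> 0"
  shows "(\<integral>\<^sup>+z. h z \<partial>lborel) = ennreal (\<bar>c\<bar> ^ DIM('a)) * (\<integral>\<^sup>+z. h (c *\<^sub>R z) \<partial>lborel)"
  by (subst lborel_affine[OF \<open>c \<noteq> 0\<close>, of 0])
     (simp add: nn_integral_density nn_integral_distr nn_integral_cmult ennreal_power)

text \<open>
  Change of variables for a map with constant Jacobian \<open>c\<close>, from the corresponding identity of measures.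
\<close>

lemma
  fixes h :: "'a::euclidean_space \<Rightarrow> 'b::{banach, second_countable_topology}"
  assumes T[measurable]: "T \<in> borel_measurable borel" and "0 < c"
    and eq: "(lborel :: 'a measure) = density (distr lborel borel T) (\<lambda>_. ennreal c)"
  shows integral_lborel_jacobian: "h \<in> borel_measurable borel \<Longrightarrow>
      (LINT z|lborel. h (T z)) = (1 / c) *\<^sub>R (LINT z|lborel. h z)"
    and integrable_lborel_jacobian: "integrable lborel h \<Longrightarrow> integrable lborel (\<lambda>z. h (T z))"
proof -
  {
    assume [measurable]: "h \<in> borel_measurable borel"
    have "(LINT z|lborel. h z) = (LINT z|distr lborel borel T. c *\<^sub>R h z)"
      by (subst eq, rule integral_density) (use \<open>0 < c\<close> in auto)
    also have "\<dots> = (LINT z|lborel. c *\<^sub>R h (T z))"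
      by (rule integral_distr) auto
    finally show "(LINT z|lborel. h (T z)) = (1 / c) *\<^sub>R (LINT z|lborel. h z)"
      using \<open>0 < c\<close> by simp
  next
    assume h: "integrable lborel h"
    then have [measurable]: "h \<in> borel_measurable borel" using borel_measurable_integrable[OF h] by simp
    have "integrable (density (distr lborel borel T) (\<lambda>_. ennreal c)) h"
      using h eq by simp
    then have "integrable (distr lborel borel T) (\<lambda>z. c *\<^sub>R h z)"
      by (subst (asm) integrable_density) (use \<open>0 < c\<close> in auto)
    then have "integrable lborel (\<lambda>z. c *\<^sub>R h (T z))"
      by (subst (asm) integrable_distr_eq) auto
    from integrable_scaleR_right[OF this, of "1 / c"]
    show "integrable lborel (\<lambda>z. h (T z))" using \<open>0 < c\<close> by simp
  }
qed

lemma
  fixes h :: "'a::euclidean_space \<Rightarrow> 'b::{banach, second_countable_topology}"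
  assumes "c \<noteq> 0"
  shows integral_lborel_scale: "h \<in> borel_measurable borel \<Longrightarrow>
      (LINT z|lborel. h (c *\<^sub>R z)) = (1 / \<bar>c\<bar> ^ DIM('a)) *\<^sub>R (LINT z|lborel. h z)"
    and integrable_lborel_scale: "integrable lborel h \<Longrightarrow> integrable lborel (\<lambda>z. h (c *\<^sub>R z))"
proof -
  have eq: "(lborel :: 'a measure) = density (distr lborel borel (\<lambda>x. c *\<^sub>R x)) (\<lambda>_. ennreal (\<bar>c\<bar> ^ DIM('a)))"
    using lborel_affine[OF \<open>c \<noteq> 0\<close>, of 0] by (simp add: ennreal_power)
  have c: "0 < \<bar>c\<bar> ^ DIM('a)" using \<open>c \<noteq> 0\<close> by simp
  have m: "(\<lambda>x::'a. c *\<^sub>R x) \<in> borel_measurable borel" by measurable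
  show "h \<in> borel_measurable borel \<Longrightarrow>
      (LINT z|lborel. h (c *\<^sub>R z)) = (1 / \<bar>c\<bar> ^ DIM('a)) *\<^sub>R (LINT z|lborel. h z)"
    by (rule integral_lborel_jacobian[OF m c eq])
  show "integrable lborel h \<Longrightarrow> integrable lborel (\<lambda>z. h (c *\<^sub>R z))"
    by (rule integrable_lborel_jacobian[OF m c eq])
qed

lemma sets_sphere_measure[simp, measurable_cong]: "sets (sphere_measure :: 'a::euclidean_space measure) = sets borel"
  and space_sphere_measure[simp]: "space (sphere_measure :: 'a::euclidean_space measure) = UNIV"
  by (simp_all add: sphere_measure_def)

lemma nn_integral_sphere_measure:
  fixes g :: "'a::euclidean_space \<Rightarrow> ennreal"
  assumes [measurable]: "g \<in> borel_measurable borel"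
  shows "(\<integral>\<^sup>+n. g n \<partial>sphere_measure) = (\<integral>\<^sup>+z. of_nat DIM('a) * indicator (cball 0 1) z * g (sgn z) \<partial>lborel)"
  unfolding sphere_measure_def by (simp add: nn_integral_distr nn_integral_density)

lemma emeasure_sphere_measure:
  "emeasure (sphere_measure :: 'a::euclidean_space measure) UNIV = ennreal (of_nat DIM('a) * unit_ball_vol (of_nat DIM('a)))"
proof -
  have "emeasure (sphere_measure :: 'a measure) UNIV = (\<integral>\<^sup>+n. 1 \<partial>(sphere_measure :: 'a measure))" by simp
  also have "\<dots> = (\<integral>\<^sup>+z. of_nat DIM('a) * indicator (cball 0 1) (z :: 'a) \<partial>lborel)"
    by (subst nn_integral_sphere_measure) auto
  also have "\<dots> = of_nat DIM('a) * emeasure lborel (cball 0 1 :: 'a set)"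
    by (subst nn_integral_cmult) auto
  also have "\<dots> = ennreal (of_nat DIM('a) * unit_ball_vol (of_nat DIM('a)))"
    by (subst emeasure_cball) (auto simp: ennreal_mult ennreal_of_nat_eq_real_of_nat)
  finally show ?thesis .
qed

interpretation sphere: finite_measure "sphere_measure :: 'a::euclidean_space measure"
  by standard (simp add: emeasure_sphere_measure)

interpretation lborel_sphere: pair_sigma_finite "lborel :: real measure" "sphere_measure :: 'a::euclidean_space measure"
  by standard

lemma AE_sphere_measure_norm: "AE n in (sphere_measure :: 'a::euclidean_space measure). norm n = 1"
  unfolding sphere_measure_def
proof (subst AE_distr_iff)
  have "AE z in lborel. z \<noteq> (0::'a)" using AE_lborel_singleton[of "0::'a"] by simp
  then show "AE z in density lborel (\<lambda>z::'a. of_nat DIM('a) * indicator (cball 0 1) z). norm (sgn z) = 1"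
    by (subst AE_density) (auto simp: norm_sgn)
qed auto

text \<open>
  The radial density \<open>r\<^sup>d\<^sup>-\<^sup>1\<close> of Lebesgue measure in dimension \<open>d\<close>, extended by 0 so that radii can range over
  the whole line.
\<close>

definition polar_density :: "'a::euclidean_space itself \<Rightarrow> real \<Rightarrow> real" where
  "polar_density _ r = (if 0 < r then r ^ (DIM('a) - 1) else 0)"

lemma polar_density_nonneg[simp]: "0 \<le> polar_density a r"
  by (simp add: polar_density_def)

lemma polar_density_measurable[measurable]: "polar_density a \<in> borel_measurable borel"
  unfolding polar_density_def[abs_def] by measurable

text \<open>
  The surface measure is the image of \<open>d\<close> times Lebesgue measure on the unit ball under \<open>z \<mapsto> z / |z|\<close>.
  On the ray through a point \<open>z\<close> of the ball substitute \<open>|z| r\<close> for \<open>r\<close>, so that \<open>r sgn z\<close> becomes \<open>r z\<close>.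
  Exchange the integrals and substitute \<open>z / r\<close> for \<open>z\<close>: what remains of the \<open>r\<close>-integral for a given \<open>z\<close> is
  \<open>d |z|\<^sup>d\<close> times the integral of \<open>r\<^sup>-\<^sup>d\<^sup>-\<^sup>1\<close> over \<open>r \<ge> |z|\<close>, which is 1.
\<close>

lemma nn_integral_polar:
  fixes h :: "'a::euclidean_space \<Rightarrow> ennreal"
  assumes [measurable]: "h \<in> borel_measurable borel"
  shows "(\<integral>\<^sup>+z. h z \<partial>lborel) =
    (\<integral>\<^sup>+r. \<integral>\<^sup>+n. ennreal (polar_density TYPE('a) r) * h (r *\<^sub>R n) \<partial>sphere_measure \<partial>lborel)"
proof -
  let ?d = "DIM('a)"
  let ?J = "\<lambda>r. ennreal (polar_density TYPE('a) r)"
  define B where "B z = (of_nat ?d * indicator (cball 0 1) z :: ennreal)" for z :: 'a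
  have [measurable]: "B \<in> borel_measurable borel" unfolding B_def by measurable
  have pow: "a * a ^ (?d - 1) = a ^ ?d" for a :: real
    using DIM_positive[where 'a='a] by (cases "?d") auto
  have ray: "(\<integral>\<^sup>+r. ?J r * h (r *\<^sub>R sgn z) \<partial>lborel) = (\<integral>\<^sup>+r. ennreal (norm z ^ ?d) * (?J r * h (r *\<^sub>R z)) \<partial>lborel)"
    if "z \<noteq> 0" for z
  proof -
    have "(\<integral>\<^sup>+r. ?J r * h (r *\<^sub>R sgn z) \<partial>lborel) =
        ennreal (norm z) * (\<integral>\<^sup>+r. ?J (norm z * r) * h ((norm z * r) *\<^sub>R sgn z) \<partial>lborel)"
      using that by (subst nn_integral_real_affine[where c="norm z" and t=0]) auto
    also have "\<dots> = (\<integral>\<^sup>+r. ennreal (norm z) * (?J (norm z * r) * h ((norm z * r) *\<^sub>R sgn z)) \<partial>lborel)"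
      by (subst nn_integral_cmult) auto
    also have "\<dots> = (\<integral>\<^sup>+r. ennreal (norm z ^ ?d) * (?J r * h (r *\<^sub>R z)) \<partial>lborel)"
    proof (rule nn_integral_cong)
      fix r :: real
      have "(norm z * r) *\<^sub>R sgn z = r *\<^sub>R z" using that by (simp add: sgn_div_norm)
      moreover have "norm z * polar_density TYPE('a) (norm z * r) = norm z ^ ?d * polar_density TYPE('a) r"
        using that by (simp add: polar_density_def zero_less_mult_iff power_mult_distrib flip: pow mult.assoc)
      then have "ennreal (norm z) * ?J (norm z * r) = ennreal (norm z ^ ?d) * ?J r"
        by (simp flip: ennreal_mult)
      ultimately show "ennreal (norm z) * (?J (norm z * r) * h ((norm z * r) *\<^sub>R sgn z)) =
          ennreal (norm z ^ ?d) * (?J r * h (r *\<^sub>R z))"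
        by (simp flip: mult.assoc)
    qed
    finally show ?thesis .
  qed
  have radial: "(\<integral>\<^sup>+r. ?J r * (of_nat ?d * (indicator {norm z..} r * ennreal (norm z ^ ?d / r ^ (2 * ?d)))) \<partial>lborel) = 1"
    if "z \<noteq> 0" for z :: 'a
  proof -
    define a where "a = norm z"
    have "a > 0" using that by (simp add: a_def)
    have "(\<integral>\<^sup>+r. ?J r * (of_nat ?d * (indicator {a..} r * ennreal (a ^ ?d / r ^ (2 * ?d)))) \<partial>lborel) =
        (\<integral>\<^sup>+r. ennreal (of_nat ?d * a ^ ?d * r ^ (?d - 1) / r ^ (2 * ?d)) * indicator {a..} r \<partial>lborel)"
    proof (rule nn_integral_cong)
      fix r :: real
      show "?J r * (of_nat ?d * (indicator {a..} r * ennreal (a ^ ?d / r ^ (2 * ?d)))) =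
          ennreal (of_nat ?d * a ^ ?d * r ^ (?d - 1) / r ^ (2 * ?d)) * indicator {a..} r"
        using \<open>a > 0\<close>
        by (auto simp: indicator_def polar_density_def ennreal_of_nat_eq_real_of_nat mult_ac simp flip: ennreal_mult)
    qed
    also have "\<dots> = ennreal (0 - (- (a ^ ?d / a ^ ?d)))"
    proof (rule nn_integral_FTC_atLeast[where F = "\<lambda>r. - (a ^ ?d / r ^ ?d)"])
      fix r assume "a \<le> r"
      with \<open>a > 0\<close> have "r > 0" by simp
      show "((\<lambda>r. - (a ^ ?d / r ^ ?d)) has_real_derivative of_nat ?d * a ^ ?d * r ^ (?d - 1) / r ^ (2 * ?d)) (at r)"
        using \<open>r > 0\<close> by (auto intro!: derivative_eq_intros simp: power_mult power2_eq_square mult_2 power_add)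
      show "0 \<le> of_nat ?d * a ^ ?d * r ^ (?d - 1) / r ^ (2 * ?d)" using \<open>a > 0\<close> \<open>r > 0\<close> by simp
    next
      have "((\<lambda>r. a ^ ?d / r ^ ?d) \<longlongrightarrow> 0) at_top"
        by (rule tendsto_divide_0[OF tendsto_const filterlim_at_top_imp_at_infinity[OF
              filterlim_pow_at_top[OF DIM_positive filterlim_ident]]])
      from tendsto_minus[OF this] show "((\<lambda>r. - (a ^ ?d / r ^ ?d)) \<longlongrightarrow> 0) at_top" by simp
    qed measurable
    also have "\<dots> = 1" using \<open>a > 0\<close> by simp
    finally show ?thesis by (simp add: a_def)
  qed
  have scale: "(\<integral>\<^sup>+z. B z * (ennreal (norm z ^ ?d) * (?J r * h (r *\<^sub>R z))) \<partial>lborel) =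
      (\<integral>\<^sup>+z. h z * (?J r * (of_nat ?d * (indicator {norm z..} r * ennreal (norm z ^ ?d / r ^ (2 * ?d))))) \<partial>lborel)" for r
  proof (cases "r > 0")
    case False
    then show ?thesis by (simp add: polar_density_def)
  next
    case True
    define k where "k w = h w * (?J r * (of_nat ?d * (indicator {norm w..} r * ennreal (norm w ^ ?d / r ^ (2 * ?d)))))" for w
    have [measurable]: "k \<in> borel_measurable borel"
      unfolding k_def atLeast_def indicator_def by measurable
    have "(\<integral>\<^sup>+z. k z \<partial>lborel) = (\<integral>\<^sup>+z. ennreal (\<bar>r\<bar> ^ ?d) * k (r *\<^sub>R z) \<partial>lborel)"
      using True by (subst nn_integral_lborel_scale[of k r]) (auto simp: nn_integral_cmult)
    also have "\<dots> = (\<integral>\<^sup>+z. B z * (ennreal (norm z ^ ?d) * (?J r * h (r *\<^sub>R z))) \<partial>lborel)"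
    proof (rule nn_integral_cong)
      fix z :: 'a
      have *: "indicator {norm (r *\<^sub>R z)..} r = (indicator (cball 0 1) z :: ennreal)"
        "ennreal (\<bar>r\<bar> ^ ?d) * ennreal (norm (r *\<^sub>R z) ^ ?d / r ^ (2 * ?d)) = ennreal (norm z ^ ?d)"
        using True by (auto simp: indicator_def power_mult_distrib mult_2 power_add simp flip: ennreal_mult)
      show "ennreal (\<bar>r\<bar> ^ ?d) * k (r *\<^sub>R z) = B z * (ennreal (norm z ^ ?d) * (?J r * h (r *\<^sub>R z)))"
      proof -
        have "ennreal (\<bar>r\<bar> ^ ?d) * k (r *\<^sub>R z) = of_nat ?d * indicator {norm (r *\<^sub>R z)..} r *
            ((ennreal (\<bar>r\<bar> ^ ?d) * ennreal (norm (r *\<^sub>R z) ^ ?d / r ^ (2 * ?d))) * (?J r * h (r *\<^sub>R z)))"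
          unfolding k_def by (simp only: mult_ac)
        with * show ?thesis unfolding B_def by simp
      qed
    qed
    finally show ?thesis by (simp add: k_def)
  qed
  have "(\<integral>\<^sup>+r. \<integral>\<^sup>+n. ?J r * h (r *\<^sub>R n) \<partial>sphere_measure \<partial>lborel) =
      (\<integral>\<^sup>+r. \<integral>\<^sup>+z. B z * (?J r * h (r *\<^sub>R sgn z)) \<partial>lborel \<partial>lborel)"
    by (subst nn_integral_sphere_measure) (auto simp: B_def)
  also have "\<dots> = (\<integral>\<^sup>+z. \<integral>\<^sup>+r. B z * (?J r * h (r *\<^sub>R sgn z)) \<partial>lborel \<partial>lborel)"
    by (rule lborel_pair.Fubini'[symmetric]) measurable
  also have "\<dots> = (\<integral>\<^sup>+z. \<integral>\<^sup>+r. B z * (ennreal (norm z ^ ?d) * (?J r * h (r *\<^sub>R z))) \<partial>lborel \<partial>lborel)"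
  proof (rule nn_integral_cong_AE)
    have "AE z in lborel. z \<noteq> (0::'a)" using AE_lborel_singleton[of "0::'a"] by simp
    then show "AE z in lborel. (\<integral>\<^sup>+r. B z * (?J r * h (r *\<^sub>R sgn z)) \<partial>lborel) =
        (\<integral>\<^sup>+r. B z * (ennreal (norm z ^ ?d) * (?J r * h (r *\<^sub>R z))) \<partial>lborel)"
    proof eventually_elim
      case (elim z)
      show ?case using ray[OF elim] by (subst (1 2) nn_integral_cmult) auto
    qed
  qed
  also have "\<dots> = (\<integral>\<^sup>+r. \<integral>\<^sup>+z. B z * (ennreal (norm z ^ ?d) * (?J r * h (r *\<^sub>R z))) \<partial>lborel \<partial>lborel)"
    by (rule lborel_pair.Fubini') measurable
  also have "\<dots> = (\<integral>\<^sup>+r. \<integral>\<^sup>+z. h z * (?J r * (of_nat ?d * (indicator {norm z..} r * ennreal (norm z ^ ?d / r ^ (2 * ?d))))) \<partial>lborel \<partial>lborel)"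
    by (simp only: scale)
  also have "\<dots> = (\<integral>\<^sup>+z. \<integral>\<^sup>+r. h z * (?J r * (of_nat ?d * (indicator {norm z..} r * ennreal (norm z ^ ?d / r ^ (2 * ?d))))) \<partial>lborel \<partial>lborel)"
    by (rule lborel_pair.Fubini'[symmetric]) (unfold atLeast_def indicator_def, measurable)
  also have "\<dots> = (\<integral>\<^sup>+z. h z \<partial>lborel)"
  proof (rule nn_integral_cong_AE)
    have "AE z in lborel. z \<noteq> (0::'a)" using AE_lborel_singleton[of "0::'a"] by simp
    then show "AE z in lborel. (\<integral>\<^sup>+r. h z * (?J r * (of_nat ?d * (indicator {norm z..} r * ennreal (norm z ^ ?d / r ^ (2 * ?d))))) \<partial>lborel) = h z"
    proof eventually_elim
      case (elim z)
      show ?case using radial[OF elim] by (subst nn_integral_cmult) auto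
    qed
  qed
  finally show ?thesis ..
qed

text \<open>
  Polar coordinates as an identity of measures give the formula for signed and vector-valued
  integrands, including the transfer of integrability in both directions.
\<close>

lemma lborel_polar:
  "(lborel :: 'a::euclidean_space measure) =
    distr (density (lborel \<Otimes>\<^sub>M sphere_measure) (\<lambda>(r, n). ennreal (polar_density TYPE('a) r))) borel (\<lambda>(r, n). r *\<^sub>R n)"
proof (rule measure_eqI)
  fix A :: "'a set" assume "A \<in> sets lborel"
  then have [measurable]: "A \<in> sets borel" by simp
  have "emeasure lborel A = (\<integral>\<^sup>+z. indicator A z \<partial>lborel)" by simp
  also have "\<dots> = (\<integral>\<^sup>+r. \<integral>\<^sup>+n. ennreal (polar_density TYPE('a) r) * indicator A (r *\<^sub>R n) \<partial>sphere_measure \<partial>lborel)"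
    by (rule nn_integral_polar) measurable
  also have "\<dots> = (\<integral>\<^sup>+z. ennreal (polar_density TYPE('a) (fst z)) * indicator A (fst z *\<^sub>R snd z) \<partial>(lborel \<Otimes>\<^sub>M sphere_measure))"
    by (subst sphere.nn_integral_fst[symmetric]) auto
  also have "\<dots> = (\<integral>\<^sup>+z. indicator A z \<partial>distr (density (lborel \<Otimes>\<^sub>M sphere_measure)
      (\<lambda>(r, n). ennreal (polar_density TYPE('a) r))) borel (\<lambda>(r, n). r *\<^sub>R n))"
    by (subst nn_integral_distr) (measurable, simp add: nn_integral_density split_beta')
  finally show "emeasure lborel A = emeasure (distr (density (lborel \<Otimes>\<^sub>M sphere_measure)
      (\<lambda>(r, n). ennreal (polar_density TYPE('a) r))) borel (\<lambda>(r, n). r *\<^sub>R n)) A"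
    by simp
qed simp

lemma
  fixes h :: "'a::euclidean_space \<Rightarrow> 'b::{banach, second_countable_topology}"
  assumes [measurable]: "h \<in> borel_measurable borel"
  shows integrable_polar_iff: "integrable lborel h \<longleftrightarrow>
      integrable (lborel \<Otimes>\<^sub>M sphere_measure) (\<lambda>(r, n). polar_density TYPE('a) r *\<^sub>R h (r *\<^sub>R n))" (is ?A)
    and integral_polar: "integrable lborel h \<Longrightarrow> (LINT z|lborel. h z) =
      (LINT r|lborel. polar_density TYPE('a) r *\<^sub>R (LINT n|sphere_measure. h (r *\<^sub>R n)))" (is "_ \<Longrightarrow> ?B")
proof -
  show A: ?A
    by (subst lborel_polar) (simp add: integrable_distr_eq integrable_density split_beta')
  assume h: "integrable lborel h"
  have "(LINT z|lborel. h z) = (LINT z|(lborel \<Otimes>\<^sub>M sphere_measure). polar_density TYPE('a) (fst z) *\<^sub>R h (fst z *\<^sub>R snd z))"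
    by (subst lborel_polar) (simp add: integral_distr integral_density split_beta')
  also have "\<dots> = (LINT r|lborel. LINT n|sphere_measure. polar_density TYPE('a) r *\<^sub>R h (r *\<^sub>R n))"
    using lborel_sphere.integral_fst'[of "\<lambda>z. polar_density TYPE('a) (fst z) *\<^sub>R h (fst z *\<^sub>R snd z)"] h A
    by (simp add: split_beta')
  finally show ?B by simp
qed

section \<open>The conical transform as a cone integral\<close>

lemma test_function_cone_integrable:
  fixes F :: "'a::euclidean_space \<times> real \<Rightarrow> real"
  assumes "test_function F" and "0 < b"
  shows "integrable lborel (\<lambda>w. F (u + a *\<^sub>R w, b * norm w))"
proof -
  obtain R e where R: "0 < R" "0 < e" "\<And>x t. F (x, t) \<noteq> 0 \<Longrightarrow> norm x \<le> R \<and> e \<le> t \<and> t \<le> R" "\<And>z. \<bar>F z\<bar> \<le> R"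
    using test_function_bounds[OF assms(1)] by metis
  show ?thesis
  proof (rule integrable_bounded_support[of _ R "R / b"])
    show "(\<lambda>w. F (u + a *\<^sub>R w, b * norm w)) \<in> borel_measurable borel"
      by (intro borel_measurable_continuous_onI continuous_intros
          continuous_on_compose2[OF test_function_continuous[OF assms(1)]]) auto
    fix w :: 'a assume "R / b < norm w"
    then have "R < b * norm w" using assms(2) by (simp add: field_simps)
    then show "F (u + a *\<^sub>R w, b * norm w) = 0" using R(3) by force
  qed (use R(4) in simp)
qed

definition power_weight :: "real \<Rightarrow> ('a::euclidean_space \<times> real \<Rightarrow> real) \<Rightarrow> 'a \<times> real \<Rightarrow> real" where
  "power_weight p f z = snd z powr (- p) * f z"

lemma test_function_weighted: "test_function f \<Longrightarrow> test_function (power_weight p f)"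
  unfolding power_weight_def[abs_def] by (rule test_function_power_weight)

text \<open>
  The integral of \<open>F\<close> over the cone with apex \<open>u\<close> and slope \<open>\<tau>\<close>, parametrised by \<open>w\<close>: the point over \<open>w\<close> has
  height \<open>|w|\<close> and horizontal position \<open>u + \<tau> w\<close>.
\<close>

definition cone_integral :: "('a::euclidean_space \<times> real \<Rightarrow> real) \<Rightarrow> 'a \<Rightarrow> real \<Rightarrow> real" where
  "cone_integral F u \<tau> = (LINT w|lborel. F (u + \<tau> *\<^sub>R w, norm w))"

text \<open>
  Polar coordinates with \<open>w = s n\<close> give an integral of \<open>f (u + w sin \<theta>, |w| cos \<theta>)\<close> with weight \<open>|w|\<^sup>-\<^sup>p\<close>.
  Scaling \<open>w\<close> by \<open>1 / cos \<theta>\<close> makes \<open>|w|\<close> the height, and then the weight depends on the point of the cone only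
  and can be absorbed into the function.
\<close>

lemma conical_radon_eq_cone_integral:
  fixes f :: "'a::euclidean_space \<times> real \<Rightarrow> real"
  assumes f: "test_function f" and \<theta>: "0 < \<theta>" "\<theta> < pi / 2"
  shows "conical_radon p f u \<theta> = cos \<theta> powr (p - 1) * tan \<theta> ^ (DIM('a) - 1) *
    cone_integral (power_weight p f) u (tan \<theta>)"
proof -
  define F where "F = power_weight p f"
  let ?d = "DIM('a)"
  have c: "0 < cos \<theta>" and s: "0 < sin \<theta>"
    using \<theta> cos_gt_zero[of \<theta>] sin_gt_zero[of \<theta>] by auto
  have F: "test_function F" unfolding F_def by (rule test_function_weighted[OF f])
  have [measurable]: "f \<in> borel_measurable (borel \<Otimes>\<^sub>M borel)" "F \<in> borel_measurable (borel \<Otimes>\<^sub>M borel)"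
    using f F by (auto intro: test_function_borel_pair)
  define h where "h w = cos \<theta> powr p * F (u + sin \<theta> *\<^sub>R w, cos \<theta> * norm w)" for w
  have h: "integrable lborel h"
    unfolding h_def by (intro integrable_mult_right test_function_cone_integrable F c)
  have hm[measurable]: "h \<in> borel_measurable borel" using borel_measurable_integrable[OF h] by simp
  have "sin \<theta> ^ (?d - 1) * (LINT w|lborel. h w) =
      (LINT r|lborel. sin \<theta> ^ (?d - 1) * (polar_density TYPE('a) r *\<^sub>R (LINT n|sphere_measure. h (r *\<^sub>R n))))"
    by (simp add: integral_polar[OF hm h])
  also have "\<dots> = (LINT r|lborel. indicator {0<..} r *\<^sub>R (1 / r powr p *
        (LINT n|sphere_measure. f (u + (r * sin \<theta>) *\<^sub>R n, r * cos \<theta>) * (r * sin \<theta>) ^ (?d - 1))))"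
  proof (rule Bochner_Integration.integral_cong[OF refl])
    fix r :: real
    show "sin \<theta> ^ (?d - 1) * (polar_density TYPE('a) r *\<^sub>R (LINT n|sphere_measure. h (r *\<^sub>R n))) =
        indicator {0<..} r *\<^sub>R (1 / r powr p *
        (LINT n|sphere_measure. f (u + (r * sin \<theta>) *\<^sub>R n, r * cos \<theta>) * (r * sin \<theta>) ^ (?d - 1)))"
    proof (cases "r > 0")
      case True
      have "(LINT n|sphere_measure. h (r *\<^sub>R n)) =
          (LINT n|sphere_measure. 1 / r powr p * f (u + (r * sin \<theta>) *\<^sub>R n, r * cos \<theta>))"
      proof (rule integral_cong_AE)
        show "AE n in sphere_measure. h (r *\<^sub>R n) = 1 / r powr p * f (u + (r * sin \<theta>) *\<^sub>R n, r * cos \<theta>)"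
          using AE_sphere_measure_norm
        proof eventually_elim
          case (elim n)
          have "cos \<theta> powr p * (cos \<theta> * r) powr (- p) = 1 / r powr p"
            using True c by (simp add: powr_mult powr_minus field_simps)
          then show ?case using True elim
            by (simp add: h_def F_def power_weight_def mult_ac flip: mult.assoc)
        qed
      qed measurable
      then show ?thesis using True by (simp add: polar_density_def power_mult_distrib)
    qed (simp add: polar_density_def)
  qed
  also have "\<dots> = conical_radon p f u \<theta>"
    by (simp add: conical_radon_def set_lebesgue_integral_def)
  finally have 1: "conical_radon p f u \<theta> = sin \<theta> ^ (?d - 1) * (LINT w|lborel. h w)" ..
  have "(LINT w|lborel. h w) = cos \<theta> powr p * (LINT w|lborel. F (u + tan \<theta> *\<^sub>R (cos \<theta> *\<^sub>R w), norm (cos \<theta> *\<^sub>R w)))"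
    using c by (simp add: h_def tan_def)
  also have "\<dots> = cos \<theta> powr p * ((1 / cos \<theta> ^ ?d) * (LINT w|lborel. F (u + tan \<theta> *\<^sub>R w, norm w)))"
    using c by (subst integral_lborel_scale[where c = "cos \<theta>"]) auto
  finally have 2: "(LINT w|lborel. h w) = cos \<theta> powr p * (1 / cos \<theta> ^ ?d) * (LINT w|lborel. F (u + tan \<theta> *\<^sub>R w, norm w))"
    by simp
  have "sin \<theta> ^ (?d - 1) * (cos \<theta> powr p * (1 / cos \<theta> ^ ?d)) = cos \<theta> powr (p - 1) * tan \<theta> ^ (?d - 1)"
  proof -
    obtain m where m: "?d = Suc m" using DIM_positive[where 'a='a] by (cases ?d) auto
    have "cos \<theta> powr (p - 1) = cos \<theta> powr p / cos \<theta>" using c by (simp add: powr_diff)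
    then show ?thesis unfolding m tan_def power_divide using c by simp
  qed
  then show ?thesis unfolding 1 2 F_def cone_integral_def by (simp only: mult.assoc[symmetric])
qed

lemma has_bochner_integral_tan_substitution:
  fixes g :: "real \<Rightarrow> 'b::euclidean_space"
  assumes g: "has_bochner_integral lborel (\<lambda>t. indicator {0<..} t *\<^sub>R g t) V"
    and [measurable]: "g \<in> borel_measurable borel"
  shows "has_bochner_integral lborel (\<lambda>\<theta>. indicator {0<..<pi / 2} \<theta> *\<^sub>R ((1 / (cos \<theta>)\<^sup>2) *\<^sub>R g (tan \<theta>))) V"
proof -
  let ?S = "{0<..<pi / 2}"
  have img: "tan ` ?S = {0<..}"
  proof (intro equalityI subsetI)
    fix t :: real assume "t \<in> {0<..}"
    then show "t \<in> tan ` ?S"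
      using arctan_ubound[of t] by (intro image_eqI[of _ _ "arctan t"]) (auto simp: tan_arctan)
  qed (auto simp: tan_gt_zero)
  have inj: "inj_on tan ?S"
    by (rule inj_on_inverseI[where g = arctan]) (auto simp: arctan_tan)
  have deriv: "(tan has_real_derivative inverse ((cos \<theta>)\<^sup>2)) (at \<theta> within ?S)" if "\<theta> \<in> ?S" for \<theta>
    using that cos_gt_zero[of \<theta>] by (intro DERIV_subset[OF DERIV_tan]) auto
  have meas: "(\<lambda>t. indicator {0<..} t *\<^sub>R g t) \<in> borel_measurable lborel"
    "(\<lambda>\<theta>. indicator ?S \<theta> *\<^sub>R (\<bar>inverse ((cos \<theta>)\<^sup>2)\<bar> *\<^sub>R g (tan \<theta>))) \<in> borel_measurable lborel"
    unfolding tan_def by measurable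
  have gi: "set_integrable lebesgue {0<..} g"
    using g integrable_completion[OF meas(1)] by (simp add: set_integrable_def has_bochner_integral_iff)
  have gV: "integral {0<..} g = V"
    using g integral_completion[OF meas(1)] set_lebesgue_integral_eq_integral(2)[OF gi]
    by (simp add: set_lebesgue_integral_def has_bochner_integral_iff)
  have "(\<lambda>\<theta>. \<bar>inverse ((cos \<theta>)\<^sup>2)\<bar> *\<^sub>R g (tan \<theta>)) absolutely_integrable_on ?S \<and>
      integral ?S (\<lambda>\<theta>. \<bar>inverse ((cos \<theta>)\<^sup>2)\<bar> *\<^sub>R g (tan \<theta>)) = V"
    by (subst has_absolute_integral_change_of_variables_real[OF _ deriv inj]) (use gi gV img in auto)
  then have 1: "set_integrable lebesgue ?S (\<lambda>\<theta>. \<bar>inverse ((cos \<theta>)\<^sup>2)\<bar> *\<^sub>R g (tan \<theta>))"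
    and 2: "integral ?S (\<lambda>\<theta>. \<bar>inverse ((cos \<theta>)\<^sup>2)\<bar> *\<^sub>R g (tan \<theta>)) = V" by auto
  have "has_bochner_integral lborel (\<lambda>\<theta>. indicator ?S \<theta> *\<^sub>R (\<bar>inverse ((cos \<theta>)\<^sup>2)\<bar> *\<^sub>R g (tan \<theta>))) V"
    using 1 2 integrable_completion[OF meas(2)] integral_completion[OF meas(2)] set_lebesgue_integral_eq_integral(2)[OF 1]
    by (simp add: set_lebesgue_integral_def set_integrable_def has_bochner_integral_iff)
  moreover have "\<bar>inverse ((cos \<theta>)\<^sup>2)\<bar> = 1 / (cos \<theta>)\<^sup>2" for \<theta> :: real
    by (simp add: inverse_eq_divide)
  ultimately show ?thesis by (simp only:)
qed

text \<open>
  This is the cancellation between the weight in the formulas over \<open>u\<close> and the power of \<open>cos \<theta>\<close> in front of the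
  cone integral, at \<open>|u - x| = y \<tau>\<close>.
\<close>

lemma powr_cos_arctan:
  assumes "0 < y" "0 \<le> \<tau>"
  shows "((y * \<tau>)\<^sup>2 + y\<^sup>2) powr ((p - 1) / 2) * cos (arctan \<tau>) powr (p - 1) = y powr (p - 1)"
proof -
  have pos: "0 < 1 + \<tau>\<^sup>2" by (simp add: add_pos_nonneg)
  have "(y\<^sup>2) powr q = y powr (2 * q)" for q
    using assms by (simp add: powr_powr flip: powr_numeral)
  moreover have "2 * ((p - 1) / 2) = p - 1" by (simp add: field_simps)
  ultimately have y2: "(y\<^sup>2) powr ((p - 1) / 2) = y powr (p - 1)" by (simp only:)
  have "((y * \<tau>)\<^sup>2 + y\<^sup>2) powr ((p - 1) / 2) = (y\<^sup>2 * (1 + \<tau>\<^sup>2)) powr ((p - 1) / 2)"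
    by (simp add: algebra_simps)
  also have "\<dots> = y powr (p - 1) * (1 + \<tau>\<^sup>2) powr ((p - 1) / 2)"
    using assms pos by (simp add: powr_mult y2)
  finally have 1: "((y * \<tau>)\<^sup>2 + y\<^sup>2) powr ((p - 1) / 2) = y powr (p - 1) * (1 + \<tau>\<^sup>2) powr ((p - 1) / 2)" .
  have "cos (arctan \<tau>) = (1 + \<tau>\<^sup>2) powr (- (1 / 2))"
    using pos by (simp add: cos_arctan powr_minus_divide powr_half_sqrt)
  then have "cos (arctan \<tau>) powr (p - 1) = (1 + \<tau>\<^sup>2) powr (- ((p - 1) / 2))"
    by (simp add: powr_powr)
  then show ?thesis using pos unfolding 1 by (simp add: powr_minus)
qed

section \<open>Fourier inversion\<close>

lemma integrable_inverse_1_plus_square_UNIV: "integrable lborel (\<lambda>x::real. 1 / (1 + x\<^sup>2))"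
  using integrable_inverse_1_plus_square by (simp add: set_integrable_def einterval_def divide_inverse)

lemma integral_inverse_1_plus_square_UNIV: "(LINT x|lborel. 1 / (1 + x\<^sup>2)) = pi"
  using LBINT_inverse_1_plus_square
  by (simp add: interval_lebesgue_integral_def set_lebesgue_integral_def einterval_def divide_inverse)

lemma borel_measurable_cis[measurable]: "cis \<in> borel_measurable borel"
  by (intro borel_measurable_continuous_onI continuous_intros)

lemma fourier_eq_cis: "fourier g k = (LINT u|lborel. cis (- (k * u)) * g u)"
  by (simp add: fourier_def cis_conv_exp)

text \<open>
  The characteristic function of the standard normal distribution, without normalisation.
\<close>

lemma gaussian_fourier:
  "integrable lborel (\<lambda>k::real. cis (k * t) * of_real (exp (- k\<^sup>2 / 2)))"
  "(LINT k|lborel. cis (k * t) * of_real (exp (- k\<^sup>2 / 2))) = of_real (sqrt (2 * pi) * exp (- t\<^sup>2 / 2))"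
proof -
  have eq: "cis (k * t) * of_real (exp (- k\<^sup>2 / 2)) = sqrt (2 * pi) * (std_normal_density k *\<^sub>R cis (k * t))" for k :: real
    by (simp add: std_normal_density_def scaleR_conv_of_real field_simps)
  have int: "integrable lborel (\<lambda>k. std_normal_density k *\<^sub>R cis (k * t))"
    by (rule Bochner_Integration.integrable_bound[OF integrable_normal_density[where \<mu> = 0 and \<sigma> = 1]])
       (auto simp: normal_density_nonneg)
  show "integrable lborel (\<lambda>k::real. cis (k * t) * of_real (exp (- k\<^sup>2 / 2)))"
    unfolding eq by (intro integrable_mult_right int)
  have "complex_of_real (exp (- (t^2) / 2)) = char std_normal_distribution t"
    by (simp add: char_std_normal_distribution)
  also have "\<dots> = (LINT k|lborel. std_normal_density k *\<^sub>R cis (k * t))"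
    unfolding char_def by (subst integral_density) (auto simp: cis_conv_exp mult_ac normal_density_nonneg)
  finally show "(LINT k|lborel. cis (k * t) * of_real (exp (- k\<^sup>2 / 2))) = of_real (sqrt (2 * pi) * exp (- t\<^sup>2 / 2))"
    unfolding eq integral_mult_right_zero of_real_mult by simp
qed

text \<open>
  Damp the inversion integral by the Gaussian \<open>exp (- (k / N)\<^sup>2 / 2)\<close>.  Fubini then gives the average of \<open>g\<close>
  near \<open>x\<close> with a Gaussian weight of width \<open>1 / N\<close>.  Both sides converge for \<open>N \<longlonglongrightarrow> \<infinity>\<close>, the left one because the
  Fourier transform is integrable and the right one because \<open>g\<close> is bounded and continuous at \<open>x\<close>.
\<close>

theorem fourier_inversion:
  fixes g :: "real \<Rightarrow> complex"
  assumes cont: "continuous_on UNIV g" and int: "integrable lborel g" and bnd: "\<And>u. norm (g u) \<le> C"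
    and int_hat: "integrable lborel (fourier g)"
  shows "(LINT k|lborel. cis (k * x) * fourier g k) = 2 * pi * g x"
proof -
  have [measurable]: "g \<in> borel_measurable borel" by (rule borel_measurable_continuous_onI[OF cont])
  have [measurable]: "fourier g \<in> borel_measurable borel" using borel_measurable_integrable[OF int_hat] by simp
  define e where "e n k = complex_of_real (exp (- (k / real (Suc n))\<^sup>2 / 2))" for n k
  have [measurable]: "e n \<in> borel_measurable borel" for n unfolding e_def by measurable
  define S where "S n = (LINT k|lborel. cis (k * x) * fourier g k * e n k)" for n
  have e_le: "norm (e n k) \<le> 1" for n k by (simp add: e_def)
  have inv0: "(\<lambda>n. a / real (Suc n)) \<longlonglongrightarrow> 0" for a
    by (rule LIMSEQ_Suc[OF lim_const_over_n])
  have "S \<longlonglongrightarrow> (LINT k|lborel. cis (k * x) * fourier g k)"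
    unfolding S_def
  proof (rule integral_dominated_convergence[OF _ _ integrable_norm[OF int_hat]])
    show "AE k in lborel. (\<lambda>n. cis (k * x) * fourier g k * e n k) \<longlonglongrightarrow> cis (k * x) * fourier g k"
    proof (rule AE_I2)
      fix k
      have "(\<lambda>n. exp (- (k / real (Suc n))\<^sup>2 / 2)) \<longlonglongrightarrow> exp (- 0\<^sup>2 / 2)"
        by (intro tendsto_intros inv0) auto
      then have "(\<lambda>n. e n k) \<longlonglongrightarrow> of_real 1" unfolding e_def by (intro tendsto_of_real) simp
      from tendsto_mult[OF tendsto_const[of "cis (k * x) * fourier g k"] this]
      show "(\<lambda>n. cis (k * x) * fourier g k * e n k) \<longlonglongrightarrow> cis (k * x) * fourier g k" by simp
    qed
    show "AE k in lborel. norm (cis (k * x) * fourier g k * e n k) \<le> norm (fourier g k)" for n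
      using e_le by (intro AE_I2) (simp add: norm_mult mult_left_le)
  qed auto
  moreover have "S \<longlonglongrightarrow> 2 * pi * g x"
  proof -
    have S: "S n = sqrt (2 * pi) * (LINT s|lborel. g (x - s / real (Suc n)) * of_real (exp (- s\<^sup>2 / 2)))" for n
    proof -
      define N where "N = real (Suc n)"
      have "N > 0" by (simp add: N_def)
      have e_N: "e n k = exp (- (k / N)\<^sup>2 / 2)" for k by (simp only: e_def N_def)
      \<comment> \<open>The Fourier transform of the damping factor is again a Gaussian, of the inverse width.\<close>
      have hat: "(LINT k|lborel. cis (k * t) * e n k) = of_real (N * (sqrt (2 * pi) * exp (- (N * t)\<^sup>2 / 2)))" for t
      proof -
        have "(LINT k|lborel. cis (k * t) * e n k) = N *\<^sub>R (LINT k|lborel. cis (k * (N * t)) * of_real (exp (- k\<^sup>2 / 2)))"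
          using \<open>N > 0\<close> by (subst lborel_integral_real_affine[of N _ 0]) (auto simp: e_N mult_ac)
        then show ?thesis unfolding gaussian_fourier(2) by (simp add: scaleR_conv_of_real)
      qed
      have e_int: "integrable lborel (e n)"
      proof -
        have "integrable lborel (\<lambda>k::real. complex_of_real (exp (- k\<^sup>2 / 2)))"
          using gaussian_fourier(1)[of 0] by simp
        from lborel_integrable_real_affine[OF this, of "1 / N" 0] \<open>N > 0\<close>
        have "integrable lborel (\<lambda>k. e n k)" by (simp add: e_N)
        then show ?thesis by simp
      qed
      have pint: "integrable (lborel \<Otimes>\<^sub>M lborel) (\<lambda>(k, u). cis (k * (x - u)) * e n k * g u)"
      proof (rule lborel_pair.Fubini_integrable)
        show "(\<lambda>(k, u). cis (k * (x - u)) * e n k * g u) \<in> borel_measurable (lborel \<Otimes>\<^sub>M lborel)"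
          by measurable
        show "integrable lborel (\<lambda>k. LINT u|lborel. norm (case (k, u) of (k, u) \<Rightarrow> cis (k * (x - u)) * e n k * g u))"
          using integrable_norm[OF e_int] by (simp add: norm_mult)
        show "AE k in lborel. integrable lborel (\<lambda>u. case (k, u) of (k, u) \<Rightarrow> cis (k * (x - u)) * e n k * g u)"
        proof (rule AE_I2)
          fix k
          have "integrable lborel (\<lambda>u. cis (k * (x - u)) * e n k * g u)"
            by (rule Bochner_Integration.integrable_bound[OF int])
               (use e_le in \<open>auto simp: norm_mult intro!: mult_left_le_one_le\<close>)
          then show "integrable lborel (\<lambda>u. case (k, u) of (k, u) \<Rightarrow> cis (k * (x - u)) * e n k * g u)" by simp
        qed
      qed
      have "S n = (LINT k|lborel. LINT u|lborel. cis (k * (x - u)) * e n k * g u)"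
        unfolding S_def fourier_eq_cis
      proof (rule Bochner_Integration.integral_cong[OF refl])
        fix k
        have "cis (k * x) * (LINT u|lborel. cis (- (k * u)) * g u) * e n k =
            (LINT u|lborel. cis (k * x) * e n k * (cis (- (k * u)) * g u))"
          by simp
        also have "\<dots> = (LINT u|lborel. cis (k * (x - u)) * e n k * g u)"
        proof -
          have "cis (k * (x - u)) = cis (k * x) * cis (- (k * u))" for u
            by (simp add: cis_mult right_diff_distrib)
          then show ?thesis by (simp only: mult_ac)
        qed
        finally show "cis (k * x) * (LINT u|lborel. cis (- (k * u)) * g u) * e n k =
            (LINT u|lborel. cis (k * (x - u)) * e n k * g u)" .
      qed
      also have "\<dots> = (LINT u|lborel. LINT k|lborel. cis (k * (x - u)) * e n k * g u)"
        by (rule lborel_pair.Fubini_integral[OF pint, symmetric])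
      also have "\<dots> = (LINT u|lborel. of_real (N * (sqrt (2 * pi) * exp (- (N * (x - u))\<^sup>2 / 2))) * g u)"
        by (simp add: hat)
      also have "\<dots> = (1 / N) *\<^sub>R (LINT s|lborel. of_real (N * (sqrt (2 * pi) * exp (- s\<^sup>2 / 2))) * g (x - s / N))"
        using \<open>N > 0\<close> by (subst lborel_integral_real_affine[of "- (1 / N)" _ x]) auto
      also have "\<dots> = (1 / N) *\<^sub>R (LINT s|lborel. (N * sqrt (2 * pi)) * (g (x - s / N) * of_real (exp (- s\<^sup>2 / 2))))"
        by (simp add: mult_ac)
      also have "\<dots> = sqrt (2 * pi) * (LINT s|lborel. g (x - s / N) * of_real (exp (- s\<^sup>2 / 2)))"
        using \<open>N > 0\<close> by (simp add: scaleR_conv_of_real)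
      finally show ?thesis by (simp add: N_def)
    qed
    have gauss: "integrable lborel (\<lambda>s::real. exp (- s\<^sup>2 / 2))"
      using integrable_norm[OF gaussian_fourier(1)[of 0]] by simp
    have "(\<lambda>n. LINT s|lborel. g (x - s / real (Suc n)) * of_real (exp (- s\<^sup>2 / 2))) \<longlonglongrightarrow>
        (LINT s|lborel. g x * of_real (exp (- s\<^sup>2 / 2)))"
    proof (rule integral_dominated_convergence[OF _ _ integrable_mult_right[OF gauss, of C]])
      show "AE s in lborel. (\<lambda>n. g (x - s / real (Suc n)) * of_real (exp (- s\<^sup>2 / 2))) \<longlonglongrightarrow> g x * of_real (exp (- s\<^sup>2 / 2))"
      proof (rule AE_I2)
        fix s :: real
        have "(\<lambda>n. x - s / real (Suc n)) \<longlonglongrightarrow> x - 0" by (intro tendsto_diff tendsto_const inv0)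
        then have "(\<lambda>n. g (x - s / real (Suc n))) \<longlonglongrightarrow> g x"
          using cont by (intro isCont_tendsto_compose[of x g]) (auto simp: continuous_on_eq_continuous_at)
        then show "(\<lambda>n. g (x - s / real (Suc n)) * of_real (exp (- s\<^sup>2 / 2))) \<longlonglongrightarrow> g x * of_real (exp (- s\<^sup>2 / 2))"
          by (intro tendsto_mult tendsto_const)
      qed
      show "AE s in lborel. norm (g (x - s / real (Suc n)) * of_real (exp (- s\<^sup>2 / 2))) \<le> C * exp (- s\<^sup>2 / 2)" for n
        using bnd by (auto simp: norm_mult)
    qed auto
    moreover have "(LINT s|lborel. g x * of_real (exp (- s\<^sup>2 / 2))) = g x * sqrt (2 * pi)"
      using gaussian_fourier(2)[of 0] by simp
    ultimately have L: "(\<lambda>n. LINT s|lborel. g (x - s / real (Suc n)) * of_real (exp (- s\<^sup>2 / 2)))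
        \<longlonglongrightarrow> g x * sqrt (2 * pi)" by (simp only:)
    have "S \<longlonglongrightarrow> sqrt (2 * pi) * (g x * sqrt (2 * pi))"
      unfolding S by (rule tendsto_mult[OF tendsto_const L])
    also have "sqrt (2 * pi) * (g x * sqrt (2 * pi)) = 2 * pi * g x"
      by (simp add: mult_ac flip: of_real_mult)
    finally show ?thesis .
  qed
  ultimately show ?thesis by (rule LIMSEQ_unique)
qed

definition plane_fourier :: "(real \<times> real \<Rightarrow> real) \<Rightarrow> real \<Rightarrow> real \<Rightarrow> complex" where
  "plane_fourier F k l = (LINT z|lborel. cis (- (k * fst z + l * snd z)) * F z)"

lemma measurable_plane_fourier:
  assumes "test_function F"
  shows "(\<lambda>(k, l). plane_fourier F k l) \<in> borel_measurable (lborel \<Otimes>\<^sub>M lborel)"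
  unfolding plane_fourier_def split_beta'
proof (rule lborel.borel_measurable_lebesgue_integral)
  show "(\<lambda>(x, z). cis (- (fst x * fst z + snd x * snd z)) * complex_of_real (F z))
      \<in> borel_measurable ((lborel \<Otimes>\<^sub>M lborel) \<Otimes>\<^sub>M lborel)"
    unfolding lborel_prod measurable_lborel2 split_beta'
    by (intro borel_measurable_continuous_onI continuous_intros continuous_on_compose2[OF test_function_continuous[OF assms]]) auto
qed

lemma plane_fourier_integrable:
  assumes "test_function F"
  shows "integrable lborel (\<lambda>z. cis (- (k * fst z + l * snd z)) * F z)"
proof (rule Bochner_Integration.integrable_bound[OF test_function_integrable[OF assms]])
  show "(\<lambda>z. cis (- (k * fst z + l * snd z)) * complex_of_real (F z)) \<in> borel_measurable lborel"
    unfolding measurable_lborel2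
    by (intro borel_measurable_continuous_onI continuous_intros continuous_on_compose2[OF test_function_continuous[OF assms]]) auto
qed (auto simp: norm_mult)

lemma norm_plane_fourier_le:
  "norm (plane_fourier F k l) \<le> (LINT z|lborel. \<bar>F z\<bar>)"
  unfolding plane_fourier_def by (rule order_trans[OF integral_norm_bound]) (simp add: norm_mult)

lemma has_vector_derivative_cis_linear:
  "((\<lambda>s. cis (a + s * b)) has_vector_derivative (\<i> * b * cis (a + s * b))) (at s)"
proof -
  have "((\<lambda>s. exp (\<i> * (a + of_real s * b))) has_vector_derivative
      (\<i> * b * exp (\<i> * (a + of_real s * b)))) (at s)"
    by (auto intro!: derivative_eq_intros has_vector_derivative_real_field simp: field_simps)
  then show ?thesis by (simp add: cis_conv_exp)
qed

lemma test_function_has_vector_derivative: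
  assumes "test_function F"
  shows "((\<lambda>s. F (z + s *\<^sub>R v)) has_vector_derivative dir_deriv v F (z + s *\<^sub>R v)) (at s)"
proof -
  have "((\<lambda>s. z + s *\<^sub>R v) has_derivative (\<lambda>h. h *\<^sub>R v)) (at s)"
    by (auto intro!: derivative_eq_intros)
  from has_derivative_compose[OF this test_function_has_derivative[OF assms]]
  have D: "((\<lambda>s. F (z + s *\<^sub>R v)) has_derivative (\<lambda>h. dir_deriv (h *\<^sub>R v) F (z + s *\<^sub>R v))) (at s)" .
  have "linear (\<lambda>w. dir_deriv w F (z + s *\<^sub>R v))"
    using test_function_has_derivative[OF assms] by (rule has_derivative_linear)
  from linear_cmul[OF this]
  have "dir_deriv (h *\<^sub>R v) F (z + s *\<^sub>R v) = h *\<^sub>R dir_deriv v F (z + s *\<^sub>R v)" for h .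
  then show ?thesis using D by (simp add: has_vector_derivative_def)
qed

lemma plane_fourier_dir_deriv:
  assumes "test_function F"
  shows "plane_fourier (dir_deriv v F) k l = \<i> * of_real (k * fst v + l * snd v) * plane_fourier F k l"
proof -
  have F': "test_function (dir_deriv v F)" by (rule test_function_dir_deriv[OF assms])
  define c where "c = k * fst v + l * snd v"
  define e where "e z = cis (- (k * fst z + l * snd z))" for z :: "real \<times> real"
  define K where "K z = e z * F z" for z
  define K' where "K' z = e z * dir_deriv v F z - \<i> * of_real c * (e z * F z)" for z
  obtain R a where R: "0 < R" "0 < a" "\<And>x t. F (x, t) \<noteq> 0 \<Longrightarrow> norm x \<le> R \<and> a \<le> t \<and> t \<le> R" "\<And>z. \<bar>F z\<bar> \<le> R"
    using test_function_bounds[OF assms] by metis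
  obtain R' a' where R': "0 < R'" "0 < a'" "\<And>x t. dir_deriv v F (x, t) \<noteq> 0 \<Longrightarrow> norm x \<le> R' \<and> a' \<le> t \<and> t \<le> R'"
     "\<And>z. \<bar>dir_deriv v F z\<bar> \<le> R'"
    using test_function_bounds[OF F'] by metis
  have "(LINT z|lborel. K' z) = 0"
  proof (rule integral_directional_derivative_eq_0[of K v K' "R' + \<bar>c\<bar> * R" "R + R + (R' + R')"])
    fix z :: "real \<times> real"
    have "((\<lambda>s. e (z + s *\<^sub>R v)) has_vector_derivative \<i> * of_real (- c) * e z) (at 0)"
      using has_vector_derivative_cis_linear[of "- (k * fst z + l * snd z)" "- c" 0]
      by (simp add: e_def c_def algebra_simps)
    moreover have "((\<lambda>s. F (z + s *\<^sub>R v)) has_vector_derivative dir_deriv v F z) (at 0)"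
      using test_function_has_vector_derivative[OF assms, of z v 0] by simp
    then have "((\<lambda>s. complex_of_real (F (z + s *\<^sub>R v))) has_vector_derivative of_real (dir_deriv v F z)) (at 0)"
      by (intro has_vector_derivative_of_real) (simp add: has_real_derivative_iff_has_vector_derivative)
    ultimately have "((\<lambda>s. e (z + s *\<^sub>R v) * F (z + s *\<^sub>R v)) has_vector_derivative
        (e (z + 0 *\<^sub>R v) * dir_deriv v F z + \<i> * of_real (- c) * e z * F (z + 0 *\<^sub>R v))) (at 0)"
      by (rule has_vector_derivative_mult)
    then show "((\<lambda>s. K (z + s *\<^sub>R v)) has_vector_derivative K' z) (at 0)"
      by (simp add: K_def K'_def algebra_simps)
    have "norm (K' z) \<le> norm (e z * dir_deriv v F z) + norm (\<i> * of_real c * (e z * F z))"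
      unfolding K'_def by (rule norm_triangle_ineq4)
    also have "\<dots> = \<bar>dir_deriv v F z\<bar> + \<bar>c\<bar> * \<bar>F z\<bar>" by (simp add: e_def norm_mult)
    also have "\<dots> \<le> R' + \<bar>c\<bar> * R" using R(4) R'(4) by (intro add_mono mult_left_mono) auto
    finally show "norm (K' z) \<le> R' + \<bar>c\<bar> * R" .
    assume z: "R + R + (R' + R') < norm z"
    obtain x t where xt: "z = (x, t)" by (cases z)
    have "F z = 0" "dir_deriv v F z = 0"
      using R(1,2) R(3)[of x t] R'(1,2) R'(3)[of x t] norm_Pair_le[of x t] z unfolding xt by force+
    then show "K' z = 0" by (simp add: K'_def)
  next
    show "integrable lborel K"
      unfolding K_def e_def by (rule plane_fourier_integrable[OF assms])
  qed
  also have "(LINT z|lborel. K' z) = plane_fourier (dir_deriv v F) k l - \<i> * of_real c * plane_fourier F k l"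
    unfolding K'_def plane_fourier_def e_def
    using plane_fourier_integrable[OF F', of k l] plane_fourier_integrable[OF assms, of k l]
    by (subst Bochner_Integration.integral_diff) auto
  finally show ?thesis by (simp add: c_def)
qed

text \<open>
  \<open>(1 + k\<^sup>2) (1 + l\<^sup>2)\<close> times the transform of \<open>F\<close> is the transform of \<open>(1 - \<partial>\<^sub>x\<^sup>2) (1 - \<partial>\<^sub>t\<^sup>2) F\<close>, hence bounded.
  A bound of product form is what is needed to integrate over \<open>k\<close> and \<open>l\<close> separately and along lines.
\<close>

lemma plane_fourier_decay:
  assumes "test_function F"
  obtains C where "0 \<le> C" "\<And>k l. norm (plane_fourier F k l) \<le> C / ((1 + k\<^sup>2) * (1 + l\<^sup>2))"
proof -
  define Fx where "Fx = dir_deriv (1, 0) (dir_deriv (1, 0) F)"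
  define Ft where "Ft = dir_deriv (0, 1) (dir_deriv (0, 1) F)"
  define Fxt where "Fxt = dir_deriv (1, 0) (dir_deriv (1, 0) Ft)"
  define C where "C = (LINT z|lborel. \<bar>F z\<bar>) + (LINT z|lborel. \<bar>Fx z\<bar>) + (LINT z|lborel. \<bar>Ft z\<bar>) + (LINT z|lborel. \<bar>Fxt z\<bar>)"
  show thesis
  proof (rule that[of C])
    show "0 \<le> C" by (simp add: C_def)
    fix k l
    have ii: "\<i> * a * (\<i> * a * P) = - (a * a) * P" for a P :: complex
    proof -
      have "\<i> * a * (\<i> * a * P) = (\<i> * \<i>) * (a * a * P)" by (simp only: mult_ac)
      then show ?thesis by simp
    qed
    have x: "plane_fourier (dir_deriv (1, 0) (dir_deriv (1, 0) H)) k l = - of_real (k\<^sup>2) * plane_fourier H k l"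
      if "test_function H" for H
      using that by (simp add: plane_fourier_dir_deriv test_function_dir_deriv power2_eq_square ii)
    have t: "plane_fourier Ft k l = - of_real (l\<^sup>2) * plane_fourier F k l"
      unfolding Ft_def using assms by (simp add: plane_fourier_dir_deriv test_function_dir_deriv power2_eq_square ii)
    have "test_function Ft" unfolding Ft_def by (intro test_function_dir_deriv assms)
    then have "of_real ((1 + k\<^sup>2) * (1 + l\<^sup>2)) * plane_fourier F k l =
        plane_fourier F k l - plane_fourier Fx k l - plane_fourier Ft k l + plane_fourier Fxt k l"
      unfolding Fx_def Fxt_def by (simp add: x[OF assms] x t algebra_simps)
    then have "((1 + k\<^sup>2) * (1 + l\<^sup>2)) * norm (plane_fourier F k l) =
        norm (plane_fourier F k l - plane_fourier Fx k l - plane_fourier Ft k l + plane_fourier Fxt k l)"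
      by (metis (no_types, lifting) abs_of_nonneg norm_mult norm_of_real add_nonneg_nonneg mult_nonneg_nonneg zero_le_one zero_le_power2)
    also have "\<dots> \<le> norm (plane_fourier F k l) + norm (plane_fourier Fx k l) + norm (plane_fourier Ft k l) + norm (plane_fourier Fxt k l)"
      by (intro order_trans[OF norm_triangle_ineq] add_mono order_trans[OF norm_triangle_ineq4] order_refl)
    also have "\<dots> \<le> C"
      unfolding C_def by (intro add_mono norm_plane_fourier_le)
    finally show "norm (plane_fourier F k l) \<le> C / ((1 + k\<^sup>2) * (1 + l\<^sup>2))"
      by (simp add: field_simps add_pos_nonneg)
  qed
qed

definition slice_fourier :: "(real \<times> real \<Rightarrow> real) \<Rightarrow> real \<Rightarrow> real \<Rightarrow> complex" where
  "slice_fourier F k t = (LINT x|lborel. cis (- (k * x)) * F (x, t))"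

text \<open>
  The plane transform is an iterated transform, so inversion in the plane consists of two inversions on the
  line: in \<open>l\<close> it leads back to the transform in the horizontal variable alone, and in \<open>k\<close> to \<open>F\<close>.
\<close>

lemma
  assumes F: "test_function F"
  shows plane_fourier_inversion_snd:
      "(LINT l|lborel. cis (l * y) * plane_fourier F k l) = 2 * pi * slice_fourier F k y" (is ?A)
    and slice_fourier_inversion:
      "(LINT k|lborel. cis (k * x) * slice_fourier F k y) = 2 * pi * F (x, y)" (is ?B)
proof -
  have [measurable]: "F \<in> borel_measurable (borel \<Otimes>\<^sub>M borel)" by (rule test_function_borel_pair[OF F])
  obtain R a where R: "0 < R" "0 < a" "\<And>x t. F (x, t) \<noteq> 0 \<Longrightarrow> norm x \<le> R \<and> a \<le> t \<and> t \<le> R" "\<And>z. \<bar>F z\<bar> \<le> R"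
    using test_function_bounds[OF F] by metis
  obtain C where C: "0 \<le> C" "\<And>k l. norm (plane_fourier F k l) \<le> C / ((1 + k\<^sup>2) * (1 + l\<^sup>2))"
    using plane_fourier_decay[OF F] by metis
  have vanish: "F (x, t) = 0" if "R < norm x \<or> R < norm t" for x t
    using R(2) R(3)[of x t] that by force
  define w where "w x = (if norm x \<le> R then R else 0)" for x :: real
  have w: "integrable lborel w"
    unfolding w_def by (rule ball_majorant_integrable)
  have Fw: "\<bar>F (x, t)\<bar> \<le> w x" for x t
    using vanish[of x t] R(1) R(4)[of "(x, t)"] by (cases "norm x \<le> R") (auto simp: w_def)
  have w0: "0 \<le> w x" for x using R(1) by (simp add: w_def)
  have slice_meas[measurable]: "(\<lambda>(k, t). slice_fourier F k t) \<in> borel_measurable (lborel \<Otimes>\<^sub>M lborel)"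
    unfolding slice_fourier_def split_beta'
  proof (rule lborel.borel_measurable_lebesgue_integral)
    show "(\<lambda>(z, x). cis (- (fst z * x)) * complex_of_real (F (x, snd z)))
        \<in> borel_measurable ((lborel \<Otimes>\<^sub>M lborel) \<Otimes>\<^sub>M lborel)"
      unfolding lborel_prod measurable_lborel2 split_beta'
      by (intro borel_measurable_continuous_onI continuous_intros continuous_on_compose2[OF test_function_continuous[OF F]]) auto
  qed
  have slice_bnd: "norm (slice_fourier F k t) \<le> (LINT x|lborel. w x)" for k t
    unfolding slice_fourier_def
    by (rule order_trans[OF integral_norm_bound]) (intro integral_mono' w, auto simp: norm_mult Fw w0)
  have slice_0: "slice_fourier F k t = 0" if "R < norm t" for k t
    unfolding slice_fourier_def using vanish that by simp
  have hat: "plane_fourier F k = fourier (slice_fourier F k)" for k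
  proof
    fix l
    have "plane_fourier F k l = (LINT z|(lborel \<Otimes>\<^sub>M lborel). cis (- (k * fst z + l * snd z)) * F z)"
      unfolding plane_fourier_def lborel_prod ..
    also have "\<dots> = (LINT t|lborel. LINT x|lborel. cis (- (k * x + l * t)) * F (x, t))"
      using lborel_pair.integral_snd[of "\<lambda>x t. cis (- (k * x + l * t)) * F (x, t)"] plane_fourier_integrable[OF F, of k l]
      by (simp add: lborel_prod split_beta')
    also have "\<dots> = (LINT t|lborel. cis (- (l * t)) * slice_fourier F k t)"
    proof (rule Bochner_Integration.integral_cong[OF refl])
      fix t
      have "cis (- (k * x + l * t)) = cis (- (l * t)) * cis (- (k * x))" for x
        by (simp add: cis_mult add.commute)
      then show "(LINT x|lborel. cis (- (k * x + l * t)) * F (x, t)) = cis (- (l * t)) * slice_fourier F k t"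
        unfolding slice_fourier_def by (simp add: mult.assoc)
    qed
    finally show "plane_fourier F k l = fourier (slice_fourier F k) l"
      by (simp add: fourier_eq_cis)
  qed
  have A: "(LINT l|lborel. cis (l * y) * plane_fourier F k l) = 2 * pi * slice_fourier F k y" for k y
    unfolding hat
  proof (rule fourier_inversion)
    show "continuous_on UNIV (slice_fourier F k)"
    proof (subst continuous_on_eq_continuous_at[OF open_UNIV], rule ballI)
      fix t
      show "isCont (slice_fourier F k) t"
        unfolding slice_fourier_def
      proof (rule isCont_integral_dominated[OF _ _ w])
        have "continuous_on UNIV (\<lambda>s. F (x, s))" for x
          by (rule continuous_on_compose2[OF test_function_continuous[OF F]]) (auto intro!: continuous_intros)
        then show "isCont (\<lambda>s. cis (- (k * x)) * F (x, s)) t" for x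
          by (intro continuous_intros) (simp add: continuous_on_eq_continuous_at)
      qed (auto simp: norm_mult Fw)
    qed
    show "integrable lborel (slice_fourier F k)"
      by (rule integrable_bounded_support[OF _ slice_bnd slice_0]) measurable
    show "norm (slice_fourier F k u) \<le> (LINT x|lborel. w x)" for u by (rule slice_bnd)
    show "integrable lborel (fourier (slice_fourier F k))"
    proof (rule Bochner_Integration.integrable_bound[OF integrable_mult_right[OF integrable_inverse_1_plus_square_UNIV, of C]])
      have "norm (plane_fourier F k l) \<le> C * (1 / (1 + l\<^sup>2))" for l
      proof -
        have "C / ((1 + k\<^sup>2) * (1 + l\<^sup>2)) \<le> C / (1 * (1 + l\<^sup>2))"
          using C(1) by (intro divide_left_mono mult_right_mono mult_pos_pos add_pos_nonneg) auto
        then show ?thesis using C(2)[of k l] by simp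
      qed
      then show "AE l in lborel. norm (fourier (slice_fourier F k) l) \<le> norm (C * (1 / (1 + l\<^sup>2)))"
        unfolding hat[symmetric] real_norm_def by (intro AE_I2 order_trans[OF _ abs_ge_self])
      show "fourier (slice_fourier F k) \<in> borel_measurable lborel"
        unfolding hat[symmetric] using measurable_Pair2[OF measurable_plane_fourier[OF F], of k] by simp
    qed
  qed
  show ?A by (rule A)
  \<comment> \<open>The decay in k that the second inversion needs is inherited from the plane transform through the first one.\<close>
  have slice_decay: "norm (slice_fourier F k y) \<le> C / 2 * (1 / (1 + k\<^sup>2))" for k
  proof -
    have "2 * pi * norm (slice_fourier F k y) = norm (LINT l|lborel. cis (l * y) * plane_fourier F k l)"
      unfolding A by (simp add: norm_mult)
    also have "\<dots> \<le> (LINT l|lborel. norm (cis (l * y) * plane_fourier F k l))" by (rule integral_norm_bound)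
    also have "\<dots> \<le> (LINT l|lborel. C / (1 + k\<^sup>2) * (1 / (1 + l\<^sup>2)))"
      by (intro integral_mono' integrable_mult_right integrable_inverse_1_plus_square_UNIV)
         (use C in \<open>auto simp: norm_mult\<close>)
    also have "\<dots> = C / (1 + k\<^sup>2) * pi"
      by (simp only: integral_mult_right_zero integral_inverse_1_plus_square_UNIV)
    also have "C / d * pi = (2 * pi) * (C / 2 * (1 / d))" for d by simp
    finally show ?thesis by (rule mult_left_le_imp_le) simp
  qed
  have four: "fourier (\<lambda>x. complex_of_real (F (x, y))) = (\<lambda>k. slice_fourier F k y)"
    by (simp add: fourier_eq_cis slice_fourier_def fun_eq_iff)
  have "(LINT k|lborel. cis (k * x) * fourier (\<lambda>x. complex_of_real (F (x, y))) k) = 2 * pi * complex_of_real (F (x, y))"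
  proof (rule fourier_inversion)
    show "continuous_on UNIV (\<lambda>x. complex_of_real (F (x, y)))"
      by (intro continuous_intros continuous_on_compose2[OF test_function_continuous[OF F]]) auto
    show "integrable lborel (\<lambda>x. complex_of_real (F (x, y)))"
      by (rule integrable_bounded_support[of _ R R]) (use R(4) vanish in auto)
    show "norm (complex_of_real (F (x, y))) \<le> R" for x using R(4) by simp
    show "integrable lborel (fourier (\<lambda>x. complex_of_real (F (x, y))))"
      unfolding four
      by (rule Bochner_Integration.integrable_bound[OF integrable_mult_right[OF integrable_inverse_1_plus_square_UNIV, of "C / 2"]])
         (use slice_decay C(1) in \<open>auto simp: abs_mult add_nonneg_nonneg\<close>)
  qed
  then show ?B unfolding four by simp
qed

section \<open>Inversion in dimension two\<close>

lemma plane_fourier_measurable_compose: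
  assumes "test_function F" and [measurable]: "g \<in> borel_measurable M" "h \<in> borel_measurable M"
  shows "(\<lambda>x. plane_fourier F (g x) (h x)) \<in> borel_measurable M"
  using measurable_plane_fourier[OF assms(1)] by (rule measurable_Pair_compose_split) measurable

text \<open>
  The projection-slice theorem: shifting \<open>u\<close> by \<open>\<tau> t\<close> inside the Fourier integral produces the phase
  \<open>k \<tau> t\<close>, which belongs to the frequency \<open>- k \<tau>\<close> dual to the height.
\<close>

lemma
  assumes F: "test_function F"
  shows line_integral_integrable: "integrable lborel (\<lambda>u. LINT t|lborel. F (u + \<tau> * t, t))"
    and fourier_line_integral: "fourier (\<lambda>u. of_real (LINT t|lborel. F (u + \<tau> * t, t))) k = plane_fourier F k (- (k * \<tau>))"
proof -
  obtain R a where R: "0 < R" "0 < a" "\<And>x t. F (x, t) \<noteq> 0 \<Longrightarrow> norm x \<le> R \<and> a \<le> t \<and> t \<le> R" "\<And>z. \<bar>F z\<bar> \<le> R"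
    using test_function_bounds[OF F] by metis
  have int: "integrable (lborel \<Otimes>\<^sub>M lborel) (\<lambda>z. cis (- (c * fst z)) * F (fst z + \<tau> * snd z, snd z))" for c
    unfolding lborel_prod
  proof (rule integrable_bounded_support[of _ R "R + \<bar>\<tau>\<bar> * R + R"])
    show "(\<lambda>z. cis (- (c * fst z)) * complex_of_real (F (fst z + \<tau> * snd z, snd z))) \<in> borel_measurable borel"
      by (intro borel_measurable_continuous_onI continuous_intros
          continuous_on_compose2[OF test_function_continuous[OF F]]) auto
    show "norm (cis (- (c * fst z)) * complex_of_real (F (fst z + \<tau> * snd z, snd z))) \<le> R" for z
      using R(4) by (simp add: norm_mult)
    fix z :: "real \<times> real" assume z: "R + \<bar>\<tau>\<bar> * R + R < norm z"
    have "F (fst z + \<tau> * snd z, snd z) = 0"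
    proof (rule ccontr)
      assume "F (fst z + \<tau> * snd z, snd z) \<noteq> 0"
      then have *: "\<bar>fst z + \<tau> * snd z\<bar> \<le> R" "a \<le> snd z" "snd z \<le> R" using R(3) by force+
      have "\<bar>\<tau> * snd z\<bar> \<le> \<bar>\<tau>\<bar> * R"
        unfolding abs_mult using * R(2) by (intro mult_left_mono) auto
      then have "\<bar>fst z\<bar> \<le> R + \<bar>\<tau>\<bar> * R" using *(1) by linarith
      moreover have "norm z \<le> \<bar>fst z\<bar> + \<bar>snd z\<bar>" using norm_Pair_le[of "fst z" "snd z"] by simp
      ultimately show False using z * R(2) by linarith
    qed
    then show "cis (- (c * fst z)) * complex_of_real (F (fst z + \<tau> * snd z, snd z)) = 0" by simp
  qed
  have "integrable (lborel \<Otimes>\<^sub>M lborel) (\<lambda>(u, t). F (u + \<tau> * t, t))"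
    using integrable_Re[OF int[of 0]] by (simp add: split_beta')
  from lborel_pair.integrable_fst'[OF this]
  show "integrable lborel (\<lambda>u. LINT t|lborel. F (u + \<tau> * t, t))" by simp
  have "fourier (\<lambda>u. of_real (LINT t|lborel. F (u + \<tau> * t, t))) k =
      (LINT u|lborel. LINT t|lborel. cis (- (k * u)) * F (u + \<tau> * t, t))"
    by (simp add: fourier_eq_cis)
  also have "\<dots> = (LINT t|lborel. LINT u|lborel. cis (- (k * u)) * F (u + \<tau> * t, t))"
    using int[of k] by (intro lborel_pair.Fubini_integral[symmetric]) (simp add: split_beta')
  also have "\<dots> = (LINT t|lborel. LINT u|lborel. cis (- (k * u + - (k * \<tau>) * t)) * F (u, t))"
  proof (rule Bochner_Integration.integral_cong[OF refl])
    fix t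
    have [measurable]: "F \<in> borel_measurable (borel \<Otimes>\<^sub>M borel)" by (rule test_function_borel_pair[OF F])
    have "(LINT u|lborel. cis (- (k * (u + \<tau> * t) + - (k * \<tau>) * t)) * complex_of_real (F (u + \<tau> * t, t))) =
        (LINT u|lborel. cis (- (k * u + - (k * \<tau>) * t)) * complex_of_real (F (u, t)))"
      by (rule integral_lborel_translate[of "\<lambda>u. cis (- (k * u + - (k * \<tau>) * t)) * complex_of_real (F (u, t))"]) measurable
    then show "(LINT u|lborel. cis (- (k * u)) * F (u + \<tau> * t, t)) =
        (LINT u|lborel. cis (- (k * u + - (k * \<tau>) * t)) * F (u, t))"
      by (simp add: algebra_simps)
  qed
  also have "\<dots> = plane_fourier F k (- (k * \<tau>))"
    using lborel_pair.integral_snd[of "\<lambda>u t. cis (- (k * u + - (k * \<tau>) * t)) * complex_of_real (F (u, t))"]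
      plane_fourier_integrable[OF F, of k "- (k * \<tau>)"]
    unfolding plane_fourier_def by (simp add: lborel_prod split_beta')
  finally show "fourier (\<lambda>u. of_real (LINT t|lborel. F (u + \<tau> * t, t))) k = plane_fourier F k (- (k * \<tau>))" .
qed

text \<open>
  The half lines \<open>w > 0\<close> and \<open>w < 0\<close> are the two branches of the cone.  Each may be prolonged to a full line,
  since \<open>F\<close> vanishes at negative heights.
\<close>

lemma cone_integral_eq_line_integrals:
  assumes F: "test_function F"
  shows "cone_integral F u \<tau> =
    (LINT t|lborel. F (u + \<tau> * t, t)) + (LINT t|lborel. F (u + (- \<tau>) * t, t))"
proof -
  obtain R a where R: "0 < R" "0 < a" "\<And>x t. F (x, t) \<noteq> 0 \<Longrightarrow> norm x \<le> R \<and> a \<le> t \<and> t \<le> R" "\<And>z. \<bar>F z\<bar> \<le> R"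
    using test_function_bounds[OF F] by metis
  have int: "integrable lborel (\<lambda>t. F (u + \<sigma> * t, t))" for \<sigma>
  proof (rule integrable_bounded_support[of _ R R])
    show "(\<lambda>t. F (u + \<sigma> * t, t)) \<in> borel_measurable borel"
      by (intro borel_measurable_continuous_onI continuous_intros
          continuous_on_compose2[OF test_function_continuous[OF F]]) auto
    show "F (u + \<sigma> * t, t) = 0" if "R < norm t" for t
      using R(2) R(3)[of "u + \<sigma> * t" t] that by force
  qed (use R(4) in simp)
  have "F (u + \<tau> * w, \<bar>w\<bar>) = F (u + \<tau> * w, w) + F (u + \<tau> * w, - w)" for w
    using test_function_vanishes_nonpos[OF F, of "(u + \<tau> * w, w)"]
      test_function_vanishes_nonpos[OF F, of "(u + \<tau> * w, - w)"] by (cases "w \<le> 0") auto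
  moreover have "(LINT w|lborel. F (u + \<tau> * w, - w)) = (LINT t|lborel. F (u + (- \<tau>) * t, t))"
    using lborel_integral_real_affine[of "-1" "\<lambda>w. F (u + \<tau> * w, - w)" 0] by simp
  moreover have "integrable lborel (\<lambda>w. F (u + \<tau> * w, - w))"
    using lborel_integrable_real_affine[OF int[of "- \<tau>"], of "-1" 0] by simp
  ultimately show ?thesis using int[of \<tau>] by (simp add: cone_integral_def)
qed

text \<open>
  Up to the factor \<open>2 \<pi>\<close> this is \<open>\<partial>\<^sub>u H\<^sub>u\<close> of the line integral \<open>\<integral> F (u - \<tau> t, t) dt\<close>.
\<close>

definition filtered_line_integral :: "(real \<times> real \<Rightarrow> real) \<Rightarrow> real \<Rightarrow> real \<Rightarrow> complex" where
  "filtered_line_integral F u \<tau> = (LINT k|lborel. cis (k * u) * (of_real \<bar>k\<bar> * plane_fourier F k (k * \<tau>)))"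

text \<open>
  The first bound makes the Hilbert transform converge; the second one, where the factor \<open>|k|\<close> uses up
  \<open>1 + k\<^sup>2\<close>, allows differentiating it in \<open>u\<close> as long as the slope is not 0.
\<close>

lemma plane_fourier_line_decay:
  assumes "test_function F"
  obtains C where "0 \<le> C" "\<And>k \<tau>. norm (plane_fourier F k (k * \<tau>)) \<le> C * (1 / (1 + k\<^sup>2))"
    "\<And>k \<tau>. \<bar>k\<bar> * norm (plane_fourier F k (k * \<tau>)) \<le> C * (1 / (1 + (\<tau> * k)\<^sup>2))"
proof -
  obtain C where C: "0 \<le> C" "\<And>k l. norm (plane_fourier F k l) \<le> C / ((1 + k\<^sup>2) * (1 + l\<^sup>2))"
    using plane_fourier_decay[OF assms] by metis
  show thesis
  proof (rule that[OF C(1)])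
    fix k \<tau> :: real
    define A B where "A = 1 + k\<^sup>2" and "B = 1 + (\<tau> * k)\<^sup>2"
    have AB: "1 \<le> A" "1 \<le> B" by (auto simp: A_def B_def)
    have bd: "norm (plane_fourier F k (k * \<tau>)) \<le> C / (A * B)"
      using C(2)[of k "k * \<tau>"] by (simp add: A_def B_def mult.commute)
    have "C / (A * B) \<le> C / (A * 1)" using AB C(1) by (intro divide_left_mono mult_left_mono) auto
    with bd show "norm (plane_fourier F k (k * \<tau>)) \<le> C * (1 / (1 + k\<^sup>2))" by (simp add: A_def)
    have "\<bar>k\<bar> \<le> A"
    proof -
      have "0 \<le> (\<bar>k\<bar> - 1)\<^sup>2" by simp
      then have "2 * \<bar>k\<bar> \<le> 1 + k\<^sup>2" by (simp add: power2_diff)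
      then show ?thesis using AB(1) unfolding A_def by linarith
    qed
    then have "\<bar>k\<bar> * norm (plane_fourier F k (k * \<tau>)) \<le> A * (C / (A * B))"
      using bd AB by (intro mult_mono) auto
    also have "\<dots> = C * (1 / B)" using AB by simp
    finally show "\<bar>k\<bar> * norm (plane_fourier F k (k * \<tau>)) \<le> C * (1 / (1 + (\<tau> * k)\<^sup>2))" by (simp add: B_def)
  qed
qed

text \<open>
  The derivative and the Hilbert transform together have the symbol \<open>\<i> k (- \<i> sgn k) = |k|\<close>, and the two branches
  of the cone contribute the slopes \<open>\<tau>\<close> and \<open>- \<tau>\<close>.
\<close>

lemma d_hilbert_radon_eq:
  fixes p :: real
  assumes f: "test_function f" and \<theta>: "0 < \<theta>" "\<theta> < pi / 2"
  defines "F \<equiv> power_weight p f" and "\<tau> \<equiv> tan \<theta>"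
  shows "d_hilbert_radon p f u \<theta> =
    of_real (cos \<theta> powr (p - 1) / (2 * pi)) * (filtered_line_integral F u \<tau> + filtered_line_integral F u (- \<tau>))"
proof -
  have F: "test_function F" unfolding F_def by (rule test_function_weighted[OF f])
  note [measurable (raw)] = plane_fourier_measurable_compose[OF F]
  have "\<tau> > 0" unfolding \<tau>_def using \<theta> by (rule tan_gt_zero)
  define c where "c = cos \<theta> powr (p - 1)"
  define X where "X \<sigma> u = (LINT t|lborel. F (u + \<sigma> * t, t))" for \<sigma> u
  define P where "P k = plane_fourier F k (k * \<tau>) + plane_fourier F k (k * (- \<tau>))" for k
  have [measurable]: "P \<in> borel_measurable borel" unfolding P_def by measurable
  have radon: "conical_radon p f v \<theta> = c * (X \<tau> v + X (- \<tau>) v)" for v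
    unfolding conical_radon_eq_cone_integral[OF f \<theta>] X_def cone_integral_eq_line_integrals[OF F, symmetric]
    by (simp add: F_def[symmetric] c_def \<tau>_def mult.commute)
  have X: "integrable lborel (\<lambda>v. cis (- (k * v)) * complex_of_real (X \<sigma> v))" for k \<sigma>
  proof (rule Bochner_Integration.integrable_bound[OF line_integral_integrable[OF F, of \<sigma>]])
    show "(\<lambda>v. cis (- (k * v)) * complex_of_real (X \<sigma> v)) \<in> borel_measurable lborel"
      using borel_measurable_integrable[OF line_integral_integrable[OF F, of \<sigma>]]
      unfolding X_def by measurable
  qed (auto simp: norm_mult X_def)
  have hat: "fourier (\<lambda>v. of_real (conical_radon p f v \<theta>)) k = of_real c * P k" for k
  proof -
    have "fourier (\<lambda>v. of_real (conical_radon p f v \<theta>)) k =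
        (LINT v|lborel. of_real c * (cis (- (k * v)) * of_real (X \<tau> v) + cis (- (k * v)) * of_real (X (- \<tau>) v)))"
      by (simp add: fourier_eq_cis radon algebra_simps)
    also have "\<dots> = of_real c * (fourier (\<lambda>v. of_real (X \<tau> v)) k + fourier (\<lambda>v. of_real (X (- \<tau>) v)) k)"
      unfolding fourier_eq_cis integral_mult_right_zero
      by (subst Bochner_Integration.integral_add) (use X in auto)
    also have "\<dots> = of_real c * P k"
      unfolding X_def fourier_line_integral[OF F] P_def by (simp add: add.commute)
    finally show ?thesis .
  qed
  obtain C where C: "0 \<le> C" "\<And>k \<tau>. norm (plane_fourier F k (k * \<tau>)) \<le> C * (1 / (1 + k\<^sup>2))"
    "\<And>k \<tau>. \<bar>k\<bar> * norm (plane_fourier F k (k * \<tau>)) \<le> C * (1 / (1 + (\<tau> * k)\<^sup>2))"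
    using plane_fourier_line_decay[OF F] by metis
  have decay: "integrable lborel (\<lambda>k. 1 / (1 + (\<tau> * k)\<^sup>2))"
    using lborel_integrable_real_affine[OF integrable_inverse_1_plus_square_UNIV, of \<tau> 0] \<open>\<tau> > 0\<close> by simp
  have P1: "norm (P k) \<le> 2 * C * (1 / (1 + k\<^sup>2))" for k
    using norm_triangle_ineq[of "plane_fourier F k (k * \<tau>)" "plane_fourier F k (k * (- \<tau>))"]
      C(2)[of k \<tau>] C(2)[of k "- \<tau>"] unfolding P_def by linarith
  have P2: "\<bar>k\<bar> * norm (P k) \<le> 2 * C * (1 / (1 + (\<tau> * k)\<^sup>2))" for k
  proof -
    have "\<bar>k\<bar> * norm (P k) \<le> \<bar>k\<bar> * (norm (plane_fourier F k (k * \<tau>)) + norm (plane_fourier F k (k * (- \<tau>))))"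
      unfolding P_def by (intro mult_left_mono norm_triangle_ineq) simp
    also have "\<dots> \<le> 2 * C * (1 / (1 + (\<tau> * k)\<^sup>2))"
      using C(3)[of k \<tau>] C(3)[of k "- \<tau>"] by (simp add: distrib_left)
    finally show ?thesis .
  qed
  define g where "g s k = cis (k * s) * (- \<i> * of_real (sgn k) * (of_real c * P k))" for s k
  define g' where "g' s k = cis (k * s) * (of_real \<bar>k\<bar> * (of_real c * P k))" for s k
  have "((\<lambda>s. LINT k|lborel. g s k) has_vector_derivative (LINT k|lborel. g' u k)) (at u)"
  proof (rule has_vector_derivative_integral_dominated[where \<delta> = 1])
    show "integrable lborel (\<lambda>k. \<bar>c\<bar> * (2 * C) * (1 / (1 + (\<tau> * k)\<^sup>2)))"
      by (intro integrable_mult_right decay)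
    fix s k
    show "integrable lborel (g s)"
    proof (rule Bochner_Integration.integrable_bound)
      show "integrable lborel (\<lambda>k. \<bar>c\<bar> * (2 * C) * (1 / (1 + k\<^sup>2)))"
        by (intro integrable_mult_right integrable_inverse_1_plus_square_UNIV)
      show "g s \<in> borel_measurable lborel" unfolding g_def by measurable
      have "norm (g s k) \<le> norm (\<bar>c\<bar> * (2 * C) * (1 / (1 + k\<^sup>2)))" for k
      proof -
        have "norm (g s k) \<le> \<bar>c\<bar> * norm (P k)" by (simp add: g_def norm_mult abs_sgn_eq)
        also have "\<dots> \<le> \<bar>c\<bar> * (2 * C * (1 / (1 + k\<^sup>2)))" by (intro mult_left_mono P1) simp
        also have "\<dots> = norm (\<bar>c\<bar> * (2 * C) * (1 / (1 + k\<^sup>2)))" using C(1) by (simp add: abs_mult)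
        finally show ?thesis .
      qed
      then show "AE k in lborel. norm (g s k) \<le> norm (\<bar>c\<bar> * (2 * C) * (1 / (1 + k\<^sup>2)))" by simp
    qed
    have "((\<lambda>s. cis (0 + s * k) * (- \<i> * of_real (sgn k) * (of_real c * P k))) has_vector_derivative
        (\<i> * k * cis (0 + s * k)) * (- \<i> * of_real (sgn k) * (of_real c * P k))) (at s)"
      by (intro has_vector_derivative_mult_left has_vector_derivative_cis_linear)
    moreover have "(\<i> * k * cis (0 + s * k)) * (- \<i> * of_real (sgn k) * (of_real c * P k)) = g' s k"
    proof -
      have "(\<i> * k * cis (0 + s * k)) * (- \<i> * of_real (sgn k) * (of_real c * P k)) =
          - (\<i> * \<i>) * (cis (k * s) * (of_real (k * sgn k) * (of_real c * P k)))"
        by (simp only: mult_ac add_0 of_real_mult mult_minus_left mult_minus_right)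
      also have "k * sgn k = \<bar>k\<bar>" by (simp add: sgn_if)
      finally show ?thesis by (simp add: g'_def)
    qed
    ultimately show "((\<lambda>s. g s k) has_vector_derivative g' s k) (at s)"
      by (simp add: g_def mult.commute)
    have "norm (g' s k) = \<bar>c\<bar> * (\<bar>k\<bar> * norm (P k))" by (simp add: g'_def norm_mult)
    also have "\<dots> \<le> \<bar>c\<bar> * (2 * C * (1 / (1 + (\<tau> * k)\<^sup>2)))" by (intro mult_left_mono P2) simp
    finally show "norm (g' s k) \<le> \<bar>c\<bar> * (2 * C) * (1 / (1 + (\<tau> * k)\<^sup>2))" by simp
  qed simp
  from has_vector_derivative_mult_right[OF this, of "1 / (2 * of_real pi)"]
  have "((\<lambda>s. 1 / (2 * of_real pi) * (LINT k|lborel. g s k)) has_vector_derivative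
      1 / (2 * of_real pi) * (LINT k|lborel. g' u k)) (at u)" .
  moreover have "hilbert (\<lambda>v. of_real (conical_radon p f v \<theta>)) = (\<lambda>s. 1 / (2 * of_real pi) * (LINT k|lborel. g s k))"
    by (simp add: fun_eq_iff hilbert_def hat g_def cis_conv_exp)
  ultimately have "d_hilbert_radon p f u \<theta> = 1 / (2 * of_real pi) * (LINT k|lborel. g' u k)"
    unfolding d_hilbert_radon_def by (simp add: vector_derivative_at)
  also have "(LINT k|lborel. g' u k) = of_real c * (filtered_line_integral F u \<tau> + filtered_line_integral F u (- \<tau>))"
  proof -
    have hf: "integrable lborel (\<lambda>k. cis (k * u) * (of_real \<bar>k\<bar> * plane_fourier F k (k * \<sigma>)))" if "\<bar>\<sigma>\<bar> = \<tau>" for \<sigma>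
    proof (rule Bochner_Integration.integrable_bound[OF integrable_mult_right[OF decay, of C]])
      show "(\<lambda>k. cis (k * u) * (of_real \<bar>k\<bar> * plane_fourier F k (k * \<sigma>))) \<in> borel_measurable lborel"
        by measurable
      have "\<sigma>\<^sup>2 = \<tau>\<^sup>2" using that by (metis power2_abs)
      then have "norm (cis (k * u) * (of_real \<bar>k\<bar> * plane_fourier F k (k * \<sigma>))) \<le> norm (C * (1 / (1 + (\<tau> * k)\<^sup>2)))" for k
        using C(3)[of k \<sigma>] C(1) by (simp add: norm_mult power_mult_distrib abs_mult)
      then show "AE k in lborel. norm (cis (k * u) * (of_real \<bar>k\<bar> * plane_fourier F k (k * \<sigma>))) \<le> norm (C * (1 / (1 + (\<tau> * k)\<^sup>2)))"
        by simp
    qed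
    have "(LINT k|lborel. g' u k) = (LINT k|lborel. of_real c * (cis (k * u) * (of_real \<bar>k\<bar> * plane_fourier F k (k * \<tau>)) +
        cis (k * u) * (of_real \<bar>k\<bar> * plane_fourier F k (k * (- \<tau>)))))"
      by (simp add: g'_def P_def algebra_simps)
    also have "\<dots> = of_real c * (filtered_line_integral F u \<tau> + filtered_line_integral F u (- \<tau>))"
      unfolding integral_mult_right_zero filtered_line_integral_def
      by (subst Bochner_Integration.integral_add) (use hf[of \<tau>] hf[of "- \<tau>"] \<open>\<tau> > 0\<close> in auto)
    finally show ?thesis .
  qed
  finally show ?thesis by (simp add: c_def)
qed

text \<open>
  For fixed \<open>k \<noteq> 0\<close> the substitution \<open>l = k \<tau>\<close> absorbs the factor \<open>|k|\<close>, and the integral over \<open>\<tau>\<close> and \<open>k\<close> becomes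
  the inversion integral of \<open>F\<close> in the plane.  Both signs of \<open>y\<close> occur below.
\<close>

lemma filtered_line_integral_ray_integral:
  assumes F: "test_function F"
  shows "has_bochner_integral lborel (\<lambda>\<tau>. filtered_line_integral F (x + y * \<tau>) \<tau>) (of_real (4 * pi\<^sup>2 * F (x, y)))"
proof -
  note [measurable (raw)] = plane_fourier_measurable_compose[OF F]
  define G where "G k \<tau> = cis (k * (x + y * \<tau>)) * (of_real \<bar>k\<bar> * plane_fourier F k (k * \<tau>))" for k \<tau>
  obtain C where C: "0 \<le> C" "\<And>k l. norm (plane_fourier F k l) \<le> C / ((1 + k\<^sup>2) * (1 + l\<^sup>2))"
    using plane_fourier_decay[OF F] by metis
  have pf_int: "integrable lborel (\<lambda>l. cis (l * y) * plane_fourier F k l)" for k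
  proof (rule Bochner_Integration.integrable_bound[OF integrable_mult_right[OF integrable_inverse_1_plus_square_UNIV, of "C / (1 + k\<^sup>2)"]])
    show "(\<lambda>l. cis (l * y) * plane_fourier F k l) \<in> borel_measurable lborel" by measurable
  qed (use C in \<open>auto simp: norm_mult abs_mult add_nonneg_nonneg\<close>)
  have meas: "(\<lambda>(k, \<tau>). G k \<tau>) \<in> borel_measurable (lborel \<Otimes>\<^sub>M lborel)"
    unfolding G_def split_beta' by measurable
  have G_eq: "G k \<tau> = of_real \<bar>k\<bar> * (cis (k * x) * (cis ((0 + k * \<tau>) * y) * plane_fourier F k (0 + k * \<tau>)))" for k \<tau>
  proof -
    have "cis (k * (x + y * \<tau>)) = cis (k * x) * cis (k * \<tau> * y)" by (simp add: cis_mult algebra_simps)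
    then show ?thesis by (simp add: G_def mult_ac)
  qed
  have G_int: "integrable lborel (G k)" if "k \<noteq> 0" for k
    unfolding G_eq[abs_def]
    by (intro integrable_mult_right lborel_integrable_real_affine[OF pf_int] that)
  have inner: "(LINT \<tau>|lborel. G k \<tau>) = cis (k * x) * (2 * pi * slice_fourier F k y)" if "k \<noteq> 0" for k
  proof -
    have "(LINT \<tau>|lborel. G k \<tau>) = cis (k * x) * (\<bar>k\<bar> *\<^sub>R (LINT \<tau>|lborel. cis ((0 + k * \<tau>) * y) * plane_fourier F k (0 + k * \<tau>)))"
      unfolding G_eq by (simp add: scaleR_conv_of_real mult_ac)
    also have "\<bar>k\<bar> *\<^sub>R (LINT \<tau>|lborel. cis ((0 + k * \<tau>) * y) * plane_fourier F k (0 + k * \<tau>)) =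
        (LINT l|lborel. cis (l * y) * plane_fourier F k l)"
      by (rule lborel_integral_real_affine[OF that, symmetric])
    finally show ?thesis unfolding plane_fourier_inversion_snd[OF F] .
  qed
  have norm_inner: "(LINT \<tau>|lborel. norm (G k \<tau>)) \<le> C * pi * (1 / (1 + k\<^sup>2))" if "k \<noteq> 0" for k
  proof -
    have "(LINT \<tau>|lborel. norm (G k \<tau>)) = \<bar>k\<bar> *\<^sub>R (LINT \<tau>|lborel. norm (plane_fourier F k (0 + k * \<tau>)))"
      unfolding G_eq by (simp add: norm_mult)
    also have "\<dots> = (LINT l|lborel. norm (plane_fourier F k l))"
      by (rule lborel_integral_real_affine[OF that, symmetric])
    also have "\<dots> \<le> (LINT l|lborel. C / (1 + k\<^sup>2) * (1 / (1 + l\<^sup>2)))"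
      by (intro integral_mono' integrable_mult_right integrable_inverse_1_plus_square_UNIV) (use C in auto)
    also have "\<dots> = C / (1 + k\<^sup>2) * pi"
      by (simp only: integral_mult_right_zero integral_inverse_1_plus_square_UNIV)
    finally show ?thesis by simp
  qed
  have nonzero: "AE k in lborel. k \<noteq> (0::real)" using AE_lborel_singleton[of "0::real"] by simp
  have pint: "integrable (lborel \<Otimes>\<^sub>M lborel) (\<lambda>(k, \<tau>). G k \<tau>)"
  proof (rule lborel_pair.Fubini_integrable[OF meas])
    show "integrable lborel (\<lambda>k. LINT \<tau>|lborel. norm (case (k, \<tau>) of (k, \<tau>) \<Rightarrow> G k \<tau>))"
    proof (rule Bochner_Integration.integrable_bound[OF integrable_mult_right[OF integrable_inverse_1_plus_square_UNIV, of "C * pi"]])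
      show "(\<lambda>k. LINT \<tau>|lborel. norm (case (k, \<tau>) of (k, \<tau>) \<Rightarrow> G k \<tau>)) \<in> borel_measurable lborel"
        using meas by measurable
      show "AE k in lborel. norm (LINT \<tau>|lborel. norm (case (k, \<tau>) of (k, \<tau>) \<Rightarrow> G k \<tau>)) \<le> norm (C * pi * (1 / (1 + k\<^sup>2)))"
        using nonzero by eventually_elim (use norm_inner C(1) in \<open>simp add: abs_mult\<close>)
    qed
    show "AE k in lborel. integrable lborel (\<lambda>\<tau>. case (k, \<tau>) of (k, \<tau>) \<Rightarrow> G k \<tau>)"
      using nonzero by eventually_elim (use G_int in simp)
  qed
  have "integrable lborel (\<lambda>\<tau>. LINT k|lborel. G k \<tau>)"
    using lborel_pair.integrable_snd[OF pint] .
  have "(LINT \<tau>|lborel. LINT k|lborel. G k \<tau>) = (LINT k|lborel. LINT \<tau>|lborel. G k \<tau>)"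
    by (rule lborel_pair.Fubini_integral[OF pint])
  also have "\<dots> = (LINT k|lborel. 2 * pi * (cis (k * x) * slice_fourier F k y))"
  proof (rule integral_cong_AE)
    show "AE k in lborel. (LINT \<tau>|lborel. G k \<tau>) = 2 * pi * (cis (k * x) * slice_fourier F k y)"
      using nonzero by eventually_elim (use inner in simp)
    show "(\<lambda>k. LINT \<tau>|lborel. G k \<tau>) \<in> borel_measurable lborel" using meas by measurable
    have "slice_fourier F k y = (LINT l|lborel. cis (l * y) * plane_fourier F k l) / (2 * pi)" for k
      unfolding plane_fourier_inversion_snd[OF F] by simp
    then have "(\<lambda>k. slice_fourier F k y) = (\<lambda>k. (LINT l|lborel. cis (l * y) * plane_fourier F k l) / (2 * pi))"
      by (rule ext)
    also have "\<dots> \<in> borel_measurable lborel" by measurable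
    finally have [measurable]: "(\<lambda>k. slice_fourier F k y) \<in> borel_measurable lborel" .
    show "(\<lambda>k. 2 * pi * (cis (k * x) * slice_fourier F k y)) \<in> borel_measurable lborel"
      by measurable
  qed
  also have "\<dots> = 2 * pi * (2 * pi * F (x, y))"
    unfolding integral_mult_right_zero slice_fourier_inversion[OF F] by simp
  also have "\<dots> = of_real (4 * pi\<^sup>2 * F (x, y))" by (simp add: power2_eq_square)
  finally show ?thesis
    using \<open>integrable lborel (\<lambda>\<tau>. LINT k|lborel. G k \<tau>)\<close>
    by (simp add: has_bochner_integral_iff filtered_line_integral_def G_def)
qed

lemma has_bochner_integral_fold:
  fixes H :: "real \<Rightarrow> 'b::{banach, second_countable_topology}"
  assumes "has_bochner_integral lborel H V"
  shows "has_bochner_integral lborel (\<lambda>t. indicator {0<..} t *\<^sub>R (H t + H (- t))) V"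
proof -
  have int: "integrable lborel H" and V: "(LINT t|lborel. H t) = V"
    using assms by (auto simp: has_bochner_integral_iff)
  have pos: "integrable lborel (\<lambda>t. indicator {0<..} t *\<^sub>R H t)" and neg: "integrable lborel (\<lambda>t. indicator {..<0} t *\<^sub>R H t)"
    using int by (auto intro: integrable_mult_indicator)
  have ind: "indicator {..<0} (- t) = (indicator {0<..} t :: real)" for t :: real
    by (auto simp: indicator_def)
  have neg': "integrable lborel (\<lambda>t. indicator {0<..} t *\<^sub>R H (- t))"
    using lborel_integrable_real_affine[OF neg, of "-1" 0] by (simp add: ind)
  have "(LINT t|lborel. indicator {0<..} t *\<^sub>R H (- t)) = (LINT t|lborel. indicator {..<0} t *\<^sub>R H t)"
    using lborel_integral_real_affine[of "-1" "\<lambda>t. indicator {..<0} t *\<^sub>R H t" 0] by (simp add: ind)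
  then have "(LINT t|lborel. indicator {0<..} t *\<^sub>R (H t + H (- t))) =
      (LINT t|lborel. indicator {0<..} t *\<^sub>R H t + indicator {..<0} t *\<^sub>R H t)"
    using pos neg neg' by (simp add: scaleR_add_right)
  also have "\<dots> = (LINT t|lborel. H t)"
    by (rule integral_discrete_difference[where X = "{0}"]) (auto simp: indicator_def)
  finally show ?thesis
    using pos neg' V by (simp add: has_bochner_integral_iff scaleR_add_right)
qed

text \<open>
  On the line \<open>u = x + y \<tau>\<close> the two slopes give the ray integrals to the points \<open>(x, y)\<close> and \<open>(x, - y)\<close>, and the second
  one contributes 0.  The integral over \<open>u\<close> is the integral over all real \<open>\<tau>\<close>; folding it at \<open>\<tau> = 0\<close> gives the two terms
  at \<open>x \<plusminus> y tan \<theta>\<close> of the integral over \<open>\<theta>\<close>.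
\<close>

theorem inversion_dim2:
  fixes p :: real and f :: "real \<times> real \<Rightarrow> real"
  assumes f: "test_function f" and y: "0 < y"
  shows "has_bochner_integral lborel (\<lambda>\<theta>. indicator {0<..<pi / 2} \<theta> *\<^sub>R
      ((d_hilbert_radon p f (x + y * tan \<theta>) \<theta> + d_hilbert_radon p f (x - y * tan \<theta>) \<theta>)
        / complex_of_real (cos \<theta> powr (1 + p)))) (of_real (2 * pi * (y powr (- p) * f (x, y))))" (is ?A)
    and "has_bochner_integral lborel (\<lambda>u. complex_of_real ((\<bar>u - x\<bar>\<^sup>2 + y\<^sup>2) powr ((p - 1) / 2))
        * d_hilbert_radon p f u (arctan (\<bar>u - x\<bar> / y))) (of_real (2 * pi * f (x, y)))" (is ?B)
proof -
  define F where "F = power_weight p f"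
  have F: "test_function F" unfolding F_def by (rule test_function_weighted[OF f])
  note [measurable (raw)] = plane_fourier_measurable_compose[OF F]
  define a where "a y \<tau> = filtered_line_integral F (x + y * \<tau>) \<tau>" for y \<tau>
  have a: "has_bochner_integral lborel (a y) (of_real (4 * pi\<^sup>2 * F (x, y)))" for y
    unfolding a_def by (rule filtered_line_integral_ray_integral[OF F])
  define H where "H \<tau> = a y \<tau> + a (- y) (- \<tau>)" for \<tau>
  have F0: "F (x, - y) = 0" using test_function_vanishes_nonpos[OF F, of "(x, - y)"] y by simp
  have neg: "has_bochner_integral lborel (\<lambda>\<tau>. a (- y) (- \<tau>)) 0"
    using a[of "- y"] lborel_has_bochner_integral_real_affine_iff[of "-1" "a (- y)" 0 0] by (simp add: F0)
  have H: "has_bochner_integral lborel H (of_real (4 * pi\<^sup>2 * F (x, y)))"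
    using has_bochner_integral_add[OF a[of y] neg] by (simp add: H_def[abs_def])
  have [measurable]: "H \<in> borel_measurable borel"
    using has_bochner_integral_iff[THEN iffD1, OF H] borel_measurable_integrable by auto
  have radon: "d_hilbert_radon p f u (arctan \<tau>) =
      of_real (cos (arctan \<tau>) powr (p - 1) / (2 * pi)) * (filtered_line_integral F u \<tau> + filtered_line_integral F u (- \<tau>))"
    if "0 < \<tau>" for u \<tau>
    using d_hilbert_radon_eq[OF f, of "arctan \<tau>" p u] that arctan_ubound[of \<tau>] by (simp add: tan_arctan F_def)
  show ?A
  proof -
    have "has_bochner_integral lborel (\<lambda>\<theta>. indicator {0<..<pi / 2} \<theta> *\<^sub>R ((1 / (cos \<theta>)\<^sup>2) *\<^sub>R (H (tan \<theta>) + H (- tan \<theta>))))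
        (of_real (4 * pi\<^sup>2 * F (x, y)))"
      by (rule has_bochner_integral_tan_substitution[OF has_bochner_integral_fold[OF H]]) measurable
    from has_bochner_integral_mult_right[OF this, of "1 / (2 * of_real pi)"]
    have "has_bochner_integral lborel (\<lambda>\<theta>. 1 / (2 * of_real pi) *
        (indicator {0<..<pi / 2} \<theta> *\<^sub>R ((1 / (cos \<theta>)\<^sup>2) *\<^sub>R (H (tan \<theta>) + H (- tan \<theta>)))))
        (1 / (2 * of_real pi) * of_real (4 * pi\<^sup>2 * F (x, y)))" by simp
    also have "(\<lambda>\<theta>. 1 / (2 * of_real pi) *
        (indicator {0<..<pi / 2} \<theta> *\<^sub>R ((1 / (cos \<theta>)\<^sup>2) *\<^sub>R (H (tan \<theta>) + H (- tan \<theta>))))) =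
      (\<lambda>\<theta>. indicator {0<..<pi / 2} \<theta> *\<^sub>R
      ((d_hilbert_radon p f (x + y * tan \<theta>) \<theta> + d_hilbert_radon p f (x - y * tan \<theta>) \<theta>)
        / complex_of_real (cos \<theta> powr (1 + p))))"
    proof
      fix \<theta>
      show "1 / (2 * of_real pi) * (indicator {0<..<pi / 2} \<theta> *\<^sub>R ((1 / (cos \<theta>)\<^sup>2) *\<^sub>R (H (tan \<theta>) + H (- tan \<theta>)))) =
        indicator {0<..<pi / 2} \<theta> *\<^sub>R
        ((d_hilbert_radon p f (x + y * tan \<theta>) \<theta> + d_hilbert_radon p f (x - y * tan \<theta>) \<theta>)
          / complex_of_real (cos \<theta> powr (1 + p)))"
      proof (cases "\<theta> \<in> {0<..<pi / 2}")
        case True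
        then have c: "0 < cos \<theta>" using cos_gt_zero[of \<theta>] by auto
        have "cos \<theta> powr (p - 1) / cos \<theta> powr (1 + p) = cos \<theta> powr (- 2)"
          by (simp flip: powr_diff)
        also have "\<dots> = 1 / (cos \<theta>)\<^sup>2" using c by (simp add: powr_minus_divide)
        finally have pw: "cos \<theta> powr (p - 1) = (1 / (cos \<theta>)\<^sup>2) * cos \<theta> powr (1 + p)"
          using c by (simp add: divide_eq_eq)
        have "d_hilbert_radon p f (x + y * tan \<theta>) \<theta> + d_hilbert_radon p f (x - y * tan \<theta>) \<theta> =
            of_real (cos \<theta> powr (p - 1) / (2 * pi)) * (H (tan \<theta>) + H (- tan \<theta>))"
          using True by (simp add: d_hilbert_radon_eq[OF f] F_def[symmetric] H_def a_def algebra_simps)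
        then show ?thesis using True c unfolding pw
          by (simp add: scaleR_conv_of_real)
      qed simp
    qed
    finally show ?A by (simp add: F_def power_weight_def power2_eq_square mult_ac)
  qed
  show ?B
  proof -
    let ?I = "\<lambda>u. complex_of_real ((\<bar>u - x\<bar>\<^sup>2 + y\<^sup>2) powr ((p - 1) / 2)) * d_hilbert_radon p f u (arctan (\<bar>u - x\<bar> / y))"
    have "has_bochner_integral lborel (\<lambda>\<tau>. of_real (y powr (p - 1) / (2 * pi)) * H \<tau>)
        (of_real (y powr (p - 1) / (2 * pi)) * of_real (4 * pi\<^sup>2 * F (x, y)))"
      by (intro has_bochner_integral_mult_right) (use H in simp)
    also have "of_real (y powr (p - 1) / (2 * pi)) * of_real (4 * pi\<^sup>2 * F (x, y)) =
        complex_of_real (2 * pi * f (x, y)) /\<^sub>R \<bar>y\<bar>"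
    proof -
      have yy: "y powr (p - 1) * y powr (- p) = inverse y"
        using y by (simp add: powr_diff powr_minus field_simps)
      have "y powr (p - 1) / (2 * pi) * (4 * pi\<^sup>2 * F (x, y)) = (y powr (p - 1) * y powr (- p)) * (2 * pi * f (x, y))"
        by (simp add: F_def power_weight_def power2_eq_square)
      also have "\<dots> = inverse y * (2 * pi * f (x, y))" using yy by simp
      finally have eq: "y powr (p - 1) / (2 * pi) * (4 * pi\<^sup>2 * F (x, y)) = inverse y * (2 * pi * f (x, y))" .
      have "complex_of_real (2 * pi * f (x, y)) /\<^sub>R \<bar>y\<bar> = of_real (inverse y * (2 * pi * f (x, y)))"
        using y by (simp add: scaleR_conv_of_real)
      then show ?thesis by (simp only: eq flip: of_real_mult)
    qed
    finally have "has_bochner_integral lborel (\<lambda>\<tau>. of_real (y powr (p - 1) / (2 * pi)) * H \<tau>)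
        (complex_of_real (2 * pi * f (x, y)) /\<^sub>R \<bar>y\<bar>)" .
    also have "?this \<longleftrightarrow> has_bochner_integral lborel (\<lambda>\<tau>. ?I (x + y * \<tau>)) (complex_of_real (2 * pi * f (x, y)) /\<^sub>R \<bar>y\<bar>)"
    proof (rule has_bochner_integral_discrete_difference[where X = "{0}"])
      fix \<tau> :: real assume "\<tau> \<notin> {0}"
      then have "0 < \<bar>\<tau>\<bar>" by simp
      have eqt: "\<bar>x + y * \<tau> - x\<bar> / y = \<bar>\<tau>\<bar>" "\<bar>x + y * \<tau> - x\<bar> = y * \<bar>\<tau>\<bar>" using y by (auto simp: abs_mult)
      have "filtered_line_integral F u \<bar>\<tau>\<bar> + filtered_line_integral F u (- \<bar>\<tau>\<bar>) = filtered_line_integral F u \<tau> + filtered_line_integral F u (- \<tau>)" for u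
        by (cases "\<tau> \<ge> 0") auto
      then have Heq: "filtered_line_integral F (x + y * \<tau>) \<bar>\<tau>\<bar> + filtered_line_integral F (x + y * \<tau>) (- \<bar>\<tau>\<bar>) = H \<tau>"
        by (simp add: H_def a_def)
      have "?I (x + y * \<tau>) = of_real (((y * \<bar>\<tau>\<bar>)\<^sup>2 + y\<^sup>2) powr ((p - 1) / 2) * cos (arctan \<bar>\<tau>\<bar>) powr (p - 1)) / (2 * of_real pi) * H \<tau>"
        unfolding eqt(1) unfolding eqt(2) radon[OF \<open>0 < \<bar>\<tau>\<bar>\<close>] Heq by simp
      also have "\<dots> = of_real (y powr (p - 1) / (2 * pi)) * H \<tau>"
        by (subst powr_cos_arctan[OF y]) auto
      finally show "of_real (y powr (p - 1) / (2 * pi)) * H \<tau> = ?I (x + y * \<tau>)" ..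
    qed auto
    finally show ?B
      using lborel_has_bochner_integral_real_affine_iff[of y ?I _ x] y by simp
  qed
qed

section \<open>The horizontal Laplacian of a cone integral\<close>

definition horizontal_laplacian :: "('a::euclidean_space \<times> real \<Rightarrow> real) \<Rightarrow> 'a \<times> real \<Rightarrow> real" where
  "horizontal_laplacian F z = (\<Sum>b\<in>Basis. dir_deriv (b, 0) (dir_deriv (b, 0) F) z)"

lemma test_function_zero: "test_function (\<lambda>z :: 'a::euclidean_space \<times> real. 0)"
proof -
  have "times_differentiable k (\<lambda>z :: 'a \<times> real. 0)" for k
    by (induction k) auto
  then show ?thesis by (simp add: test_function_def)
qed

lemma test_function_sum:
  "finite A \<Longrightarrow> (\<And>i. i \<in> A \<Longrightarrow> test_function (G i)) \<Longrightarrow> test_function (\<lambda>z. \<Sum>i\<in>A. G i z)"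
  by (induction A rule: finite_induct) (auto intro: test_function_zero test_function_add)

lemma test_function_horizontal_laplacian:
  "test_function F \<Longrightarrow> test_function (horizontal_laplacian F)"
  unfolding horizontal_laplacian_def[abs_def]
  by (intro test_function_sum finite_Basis test_function_dir_deriv)

lemma cone_integral_integrable:
  "test_function F \<Longrightarrow> integrable lborel (\<lambda>w. F (u + \<tau> *\<^sub>R w, norm w))"
  using test_function_cone_integrable[of F 1 u \<tau>] by simp

lemma cone_integral_measurable:
  fixes F :: "'a::euclidean_space \<times> real \<Rightarrow> real"
  assumes F: "test_function F"
  shows "(\<lambda>(u, \<tau>). cone_integral F u \<tau>) \<in> borel_measurable (borel \<Otimes>\<^sub>M borel)"
proof -
  have "(\<lambda>z. LINT w|lborel. F (fst z + snd z *\<^sub>R w, norm w)) \<in> borel_measurable (lborel :: ('a \<times> real) measure)"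
  proof (rule lborel.borel_measurable_lebesgue_integral)
    show "(\<lambda>(z, w). F (fst z + snd z *\<^sub>R w, norm w)) \<in> borel_measurable ((lborel :: ('a \<times> real) measure) \<Otimes>\<^sub>M lborel)"
      unfolding lborel_prod measurable_lborel2 split_beta'
      by (intro borel_measurable_continuous_onI continuous_intros
          continuous_on_compose2[OF test_function_continuous[OF F]]) auto
  qed
  then show ?thesis by (simp add: cone_integral_def split_beta' borel_prod)
qed

lemma cone_integral_has_vector_derivative:
  fixes F :: "'a::euclidean_space \<times> real \<Rightarrow> real"
  assumes F: "test_function F"
  shows "((\<lambda>s. cone_integral F (u + s *\<^sub>R b) \<tau>) has_vector_derivative
      cone_integral (dir_deriv (b, 0) F) (u + s0 *\<^sub>R b) \<tau>) (at s0)"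
proof -
  have F': "test_function (dir_deriv (b, 0) F)" by (rule test_function_dir_deriv[OF F])
  obtain R a where R: "0 < R" "0 < a" "\<And>x t. dir_deriv (b, 0) F (x, t) \<noteq> 0 \<Longrightarrow> norm x \<le> R \<and> a \<le> t \<and> t \<le> R"
      "\<And>z. \<bar>dir_deriv (b, 0) F z\<bar> \<le> R"
    using test_function_bounds[OF F'] by metis
  define w where "w x = (if norm x \<le> R then R else 0)" for x :: 'a
  have "norm (dir_deriv (b, 0) F (u + s *\<^sub>R b + \<tau> *\<^sub>R z, norm z)) \<le> w z" for s z
    using R(4) R(3)[of "u + s *\<^sub>R b + \<tau> *\<^sub>R z" "norm z"] by (auto simp: w_def)
  note le = this
  show ?thesis
    unfolding cone_integral_def
  proof (rule has_vector_derivative_integral_dominated[where \<delta> = 1 and w = w])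
  show "integrable lborel w"
    unfolding w_def by (rule ball_majorant_integrable)
  show "integrable lborel (\<lambda>z. F (u + s *\<^sub>R b + \<tau> *\<^sub>R z, norm z))" for s
    by (rule cone_integral_integrable[OF F])
  show "((\<lambda>s. F (u + s *\<^sub>R b + \<tau> *\<^sub>R z, norm z)) has_vector_derivative
      dir_deriv (b, 0) F (u + s *\<^sub>R b + \<tau> *\<^sub>R z, norm z)) (at s)" for s z
    using test_function_has_vector_derivative[OF F, of "(u + \<tau> *\<^sub>R z, norm z)" "(b, 0)" s]
    by (simp add: algebra_simps)
  qed (use le in simp_all)
qed

lemma laplacian_radon_eq:
  fixes f :: "'a::euclidean_space \<times> real \<Rightarrow> real"
  assumes f: "test_function f" and \<theta>: "0 < \<theta>" "\<theta> < pi / 2"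
  shows "laplacian_radon p f u \<theta> = cos \<theta> powr (p - 1) * tan \<theta> ^ (DIM('a) - 1) *
    cone_integral (horizontal_laplacian (power_weight p f)) u (tan \<theta>)"
proof -
  define F where "F = power_weight p f"
  have F: "test_function F" unfolding F_def by (rule test_function_weighted[OF f])
  define c where "c = cos \<theta> powr (p - 1) * tan \<theta> ^ (DIM('a) - 1)"
  define \<tau> where "\<tau> = tan \<theta>"
  have radon: "conical_radon p f v \<theta> = c * cone_integral F v \<tau>" for v
    using conical_radon_eq_cone_integral[OF f \<theta>] by (simp add: c_def F_def \<tau>_def)
  have D: "deriv (\<lambda>t. c * cone_integral G (u + t *\<^sub>R b) \<tau>) = (\<lambda>t. c * cone_integral (dir_deriv (b, 0) G) (u + t *\<^sub>R b) \<tau>)"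
    if "test_function G" for G and b :: 'a
  proof
    fix t
    have "((\<lambda>t. cone_integral G (u + t *\<^sub>R b) \<tau>) has_real_derivative cone_integral (dir_deriv (b, 0) G) (u + t *\<^sub>R b) \<tau>) (at t)"
      using cone_integral_has_vector_derivative[OF that, of u b \<tau> t] by (simp add: has_real_derivative_iff_has_vector_derivative)
    then show "deriv (\<lambda>t. c * cone_integral G (u + t *\<^sub>R b) \<tau>) t = c * cone_integral (dir_deriv (b, 0) G) (u + t *\<^sub>R b) \<tau>"
      by (intro DERIV_imp_deriv DERIV_cmult)
  qed
  have "laplacian_radon p f u \<theta> = (\<Sum>b\<in>Basis. c * cone_integral (dir_deriv (b, 0) (dir_deriv (b, 0) F)) u \<tau>)"
    by (simp add: laplacian_radon_def laplacian_def numeral_2_eq_2 radon D F test_function_dir_deriv)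
  also have "\<dots> = c * cone_integral (horizontal_laplacian F) u \<tau>"
    unfolding cone_integral_def horizontal_laplacian_def sum_distrib_left[symmetric]
    by (subst Bochner_Integration.integral_sum)
       (auto intro!: cone_integral_integrable test_function_dir_deriv F)
  finally show ?thesis by (simp add: c_def F_def \<tau>_def)
qed

lemma norm_cone_integral_le:
  fixes F :: "'a::euclidean_space \<times> real \<Rightarrow> real"
  assumes F: "test_function F"
  obtains C where "0 \<le> C" "\<And>u \<tau>. \<bar>cone_integral F u \<tau>\<bar> \<le> C"
proof -
  obtain R a where R: "0 < R" "0 < a" "\<And>x t. F (x, t) \<noteq> 0 \<Longrightarrow> norm x \<le> R \<and> a \<le> t \<and> t \<le> R" "\<And>z. \<bar>F z\<bar> \<le> R"
    using test_function_bounds[OF F] by metis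
  define w where "w x = (if norm x \<le> R then R else 0)" for x :: 'a
  have w: "integrable lborel w"
    unfolding w_def by (rule ball_majorant_integrable)
  have le: "\<bar>F (u + \<tau> *\<^sub>R z, norm z)\<bar> \<le> w z" for u \<tau> z
    using R(4) R(3)[of "u + \<tau> *\<^sub>R z" "norm z"] by (auto simp: w_def)
  have w0: "0 \<le> w z" for z using R(1) by (simp add: w_def)
  show thesis
  proof (rule that)
    show "0 \<le> (LINT z|lborel. w z)" using w0 by (rule Bochner_Integration.integral_nonneg)
    fix u \<tau>
    have "\<bar>cone_integral F u \<tau>\<bar> \<le> (LINT z|lborel. norm (F (u + \<tau> *\<^sub>R z, norm z)))"
      unfolding cone_integral_def using integral_norm_bound[of lborel "\<lambda>w. F (u + \<tau> *\<^sub>R w, norm w)"] by simp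
    also have "\<dots> \<le> (LINT z|lborel. w z)" using le w0 by (intro integral_mono' w) auto
    finally show "\<bar>cone_integral F u \<tau>\<bar> \<le> (LINT z|lborel. w z)" .
  qed
qed

text \<open>
  In the variable \<open>v = u + \<tau> w\<close> the cone is the graph of \<open>\<rho> v = |v - u| / \<tau>\<close>.  The derivative of
  \<open>G (v, \<rho> v)\<close> along \<open>b\<close> integrates to 0, so the integral of \<open>\<partial>\<^sub>b G\<close> over the cone is minus that of
  \<open>\<partial>\<^sub>t G\<close> times the derivative of \<open>\<rho>\<close>, which is at most \<open>|b| / \<tau>\<close>.  Since \<open>v\<close> stays in a fixed ball, this and the
  Jacobian of the substitution give the power of \<open>\<tau>\<close>.
\<close>

lemma cone_integral_dir_deriv_decay:
  fixes G :: "'a::euclidean_space \<times> real \<Rightarrow> real"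
  assumes G: "test_function G"
  obtains C where "0 \<le> C" "\<And>u \<tau>. 0 < \<tau> \<Longrightarrow> \<bar>cone_integral (dir_deriv (b, 0) G) u \<tau>\<bar> \<le> C / \<tau> ^ (DIM('a) + 1)"
proof -
  let ?Gb = "dir_deriv (b, 0) G" and ?Gt = "dir_deriv (0, 1) G"
  have Gb: "test_function ?Gb" and Gt: "test_function ?Gt" by (rule test_function_dir_deriv[OF G])+
  obtain R a where R: "0 < R" "0 < a" "\<And>x t. ?Gb (x, t) \<noteq> 0 \<Longrightarrow> norm x \<le> R \<and> a \<le> t \<and> t \<le> R" "\<And>z. \<bar>?Gb z\<bar> \<le> R"
    using test_function_bounds[OF Gb] by metis
  obtain R' a' where R': "0 < R'" "0 < a'" "\<And>x t. ?Gt (x, t) \<noteq> 0 \<Longrightarrow> norm x \<le> R' \<and> a' \<le> t \<and> t \<le> R'" "\<And>z. \<bar>?Gt z\<bar> \<le> R'"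
    using test_function_bounds[OF Gt] by metis
  obtain Q q where Q: "0 < Q" "0 < q" "\<And>x t. G (x, t) \<noteq> 0 \<Longrightarrow> norm x \<le> Q \<and> q \<le> t \<and> t \<le> Q" "\<And>z. \<bar>G z\<bar> \<le> Q"
    using test_function_bounds[OF G] by metis
  define w where "w x = (if norm x \<le> R' then R' * norm b else 0)" for x :: 'a
  have w: "integrable lborel w"
    unfolding w_def by (rule ball_majorant_integrable)
  have w0: "0 \<le> w z" for z using R'(1) by (simp add: w_def)
  show thesis
  proof (rule that)
    show "0 \<le> (LINT z|lborel. w z)" using w0 by (rule Bochner_Integration.integral_nonneg)
    fix u :: 'a and \<tau> :: real assume \<tau>: "0 < \<tau>"
    define \<rho> where "\<rho> v = norm (v - u) / \<tau>" for v
    define T where "T v = ?Gt (v, \<rho> v) * (((v - u) \<bullet> b) / (norm (v - u) * \<tau>))" for v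
    define K' where "K' v = ?Gb (v, \<rho> v) + T v" for v
    have Tle: "\<bar>T v\<bar> \<le> w v / \<tau>" for v
    proof (cases "norm v \<le> R'")
      case False
      then have "?Gt (v, \<rho> v) = 0" using R'(3) by blast
      then show ?thesis using w0 \<tau> by (simp add: T_def)
    next
      case True
      have "\<bar>((v - u) \<bullet> b) / (norm (v - u) * \<tau>)\<bar> \<le> norm b / \<tau>"
      proof (cases "v = u")
        case False
        then have "\<bar>(v - u) \<bullet> b\<bar> / (norm (v - u) * \<tau>) \<le> (norm (v - u) * norm b) / (norm (v - u) * \<tau>)"
          using \<tau> by (intro divide_right_mono Cauchy_Schwarz_ineq2) simp
        then show ?thesis using False \<tau> by (simp add: abs_mult)
      qed (use \<tau> in simp)
      then have "\<bar>?Gt (v, \<rho> v)\<bar> * \<bar>((v - u) \<bullet> b) / (norm (v - u) * \<tau>)\<bar> \<le> R' * (norm b / \<tau>)"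
        using R'(1,4) by (intro mult_mono) auto
      then show ?thesis using True by (simp add: T_def w_def abs_mult)
    qed
    have Gb_borel: "(\<lambda>v. ?Gb (v, \<rho> v)) \<in> borel_measurable borel" and Gt_borel: "(\<lambda>v. ?Gt (v, \<rho> v)) \<in> borel_measurable borel"
      and G_borel: "(\<lambda>v. G (v, \<rho> v)) \<in> borel_measurable borel"
      unfolding \<rho>_def using \<tau>
      by (intro borel_measurable_continuous_onI continuous_intros
          continuous_on_compose2[OF test_function_continuous[OF Gb]]
          continuous_on_compose2[OF test_function_continuous[OF Gt]]
          continuous_on_compose2[OF test_function_continuous[OF G]]; auto)+
    have T_int: "integrable lborel T"
    proof (rule Bochner_Integration.integrable_bound[OF integrable_divide[OF w, of \<tau>]])
      show "T \<in> borel_measurable lborel" unfolding T_def[abs_def] using Gt_borel by measurable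
    qed (use Tle w0 \<tau> in auto)
    have Gb_int: "integrable lborel (\<lambda>v. ?Gb (v, \<rho> v))"
      by (rule integrable_bounded_support[OF Gb_borel, of R R]) (use R(4) in simp, meson R(3) not_le)
    have "(LINT v|lborel. K' v) = 0"
    proof (rule integral_directional_derivative_eq_0[of "\<lambda>v. G (v, \<rho> v)" b K' "R + R' * norm b / \<tau>" "R + R'"])
      fix v
      show "((\<lambda>s. G (v + s *\<^sub>R b, \<rho> (v + s *\<^sub>R b))) has_vector_derivative K' v) (at 0)"
      \<comment> \<open>The norm is not differentiable at the apex, but there the height is 0 and G vanishes nearby.\<close>
      proof (cases "v = u")
        case True
        have "((\<lambda>s. G (v + s *\<^sub>R b, \<rho> (v + s *\<^sub>R b))) has_vector_derivative 0) (at 0)"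
        proof (rule has_vector_derivative_transform_within_open[of "\<lambda>_. 0" _ _ "{s. \<rho> (v + s *\<^sub>R b) < q}"])
          show "open {s. \<rho> (v + s *\<^sub>R b) < q}"
            unfolding \<rho>_def using \<tau> by (intro open_Collect_less continuous_intros) auto
          show "0 \<in> {s. \<rho> (v + s *\<^sub>R b) < q}" using True Q(2) by (simp add: \<rho>_def)
          show "0 = G (v + s *\<^sub>R b, \<rho> (v + s *\<^sub>R b))" if "s \<in> {s. \<rho> (v + s *\<^sub>R b) < q}" for s
            using that Q(3)[of "v + s *\<^sub>R b" "\<rho> (v + s *\<^sub>R b)"] by force
        qed simp
        moreover have "?Gb (v, 0) = 0" "?Gt (v, 0) = 0"
          using test_function_vanishes_nonpos[OF Gb, of "(v, 0)"] test_function_vanishes_nonpos[OF Gt, of "(v, 0)"] by auto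
        ultimately show ?thesis using True by (simp add: K'_def T_def \<rho>_def)
      next
        case False
        have line: "((\<lambda>s. v + s *\<^sub>R b) has_derivative (\<lambda>h. h *\<^sub>R b)) (at 0)"
          by (auto intro!: derivative_eq_intros)
        have "((\<lambda>s. norm (v + s *\<^sub>R b - u)) has_derivative (\<lambda>h. (h *\<^sub>R b) \<bullet> sgn (v + 0 *\<^sub>R b - u))) (at 0)"
        proof (rule has_derivative_compose[where g = norm])
          show "((\<lambda>s. v + s *\<^sub>R b - u) has_derivative (\<lambda>h. h *\<^sub>R b)) (at 0)"
            by (auto intro!: derivative_eq_intros)
          show "(norm has_derivative (\<lambda>k. k \<bullet> sgn (v + 0 *\<^sub>R b - u))) (at (v + 0 *\<^sub>R b - u))"
            by (rule has_derivative_norm) (use False in simp)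
        qed
        then have "((\<lambda>s. \<rho> (v + s *\<^sub>R b)) has_derivative (\<lambda>h. (h *\<^sub>R b) \<bullet> sgn (v - u) / \<tau>)) (at 0)"
          unfolding \<rho>_def using \<tau> by (auto intro!: derivative_eq_intros)
        from has_derivative_Pair[OF line this]
        have "((\<lambda>s. (v + s *\<^sub>R b, \<rho> (v + s *\<^sub>R b))) has_derivative (\<lambda>h. (h *\<^sub>R b, (h *\<^sub>R b) \<bullet> sgn (v - u) / \<tau>))) (at 0)" .
        from has_derivative_compose[OF this test_function_has_derivative[OF G]]
        have 1: "((\<lambda>s. G (v + s *\<^sub>R b, \<rho> (v + s *\<^sub>R b))) has_derivative
            (\<lambda>h. dir_deriv (h *\<^sub>R b, (h *\<^sub>R b) \<bullet> sgn (v - u) / \<tau>) G (v, \<rho> v))) (at 0)" by simp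
        have lin: "linear (\<lambda>w. dir_deriv w G (v, \<rho> v))"
          using test_function_has_derivative[OF G] by (rule has_derivative_linear)
        have "dir_deriv (h *\<^sub>R b, (h *\<^sub>R b) \<bullet> sgn (v - u) / \<tau>) G (v, \<rho> v) = h *\<^sub>R K' v" for h
        proof -
          have "(h *\<^sub>R b, (h *\<^sub>R b) \<bullet> sgn (v - u) / \<tau>) = h *\<^sub>R (b, 0) + (h * (((v - u) \<bullet> b) / (norm (v - u) * \<tau>))) *\<^sub>R (0, 1)"
            by (simp add: sgn_div_norm inner_commute[of b] divide_inverse mult_ac)
          then show ?thesis
            by (simp only: linear_add[OF lin] linear_cmul[OF lin]) (simp add: K'_def T_def algebra_simps)
        qed
        with 1 show ?thesis by (simp add: has_vector_derivative_def)
      qed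
      have "w v \<le> R' * norm b" using R'(1) by (simp add: w_def)
      then have "w v / \<tau> \<le> R' * norm b / \<tau>" using \<tau> by (simp add: divide_right_mono)
      then have "\<bar>T v\<bar> \<le> R' * norm b / \<tau>" using Tle[of v] by linarith
      then show "norm (K' v) \<le> R + R' * norm b / \<tau>"
        using R(4)[of "(v, \<rho> v)"] unfolding K'_def real_norm_def by linarith
      assume "R + R' < norm v"
      then have "?Gb (v, \<rho> v) = 0" "?Gt (v, \<rho> v) = 0" using R(1,3) R'(1,3) by force+
      then show "K' v = 0" by (simp add: K'_def T_def)
    next
      show "integrable lborel (\<lambda>v. G (v, \<rho> v))"
        by (rule integrable_bounded_support[OF G_borel, of Q Q]) (use Q(4) in simp, meson Q(3) not_le)
    qed
    then have ibp: "(LINT v|lborel. ?Gb (v, \<rho> v)) = - (LINT v|lborel. T v)"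
      unfolding K'_def using Gb_int T_int by (simp add: Bochner_Integration.integral_add)
    have "cone_integral ?Gb u \<tau> = (LINT w|lborel. ?Gb (u + \<tau> *\<^sub>R w, \<rho> (u + \<tau> *\<^sub>R w)))"
      using \<tau> by (simp add: cone_integral_def \<rho>_def)
    also have "\<dots> = (1 / \<tau> ^ DIM('a)) * (LINT w|lborel. ?Gb (u + w, \<rho> (u + w)))"
    proof -
      have "(\<lambda>w. ?Gb (u + w, \<rho> (u + w))) \<in> borel_measurable borel"
        using measurable_compose[of "\<lambda>w. u + w" borel borel, OF _ Gb_borel] by simp
      from integral_lborel_scale[OF _ this, of \<tau>] \<tau> show ?thesis by simp
    qed
    also have "(LINT w|lborel. ?Gb (u + w, \<rho> (u + w))) = (LINT v|lborel. ?Gb (v, \<rho> v))"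
      using integral_lborel_translate[OF Gb_borel, of u] by (simp add: add.commute)
    finally have "\<bar>cone_integral ?Gb u \<tau>\<bar> = (1 / \<tau> ^ DIM('a)) * \<bar>LINT v|lborel. T v\<bar>"
      using \<tau> by (simp add: ibp abs_mult)
    also have "\<bar>LINT v|lborel. T v\<bar> \<le> (LINT v|lborel. w v / \<tau>)"
    proof -
      have "\<bar>LINT v|lborel. T v\<bar> \<le> (LINT v|lborel. norm (T v))"
        using integral_norm_bound[of lborel T] by simp
      also have "\<dots> \<le> (LINT v|lborel. w v / \<tau>)"
        using Tle w0 \<tau> by (intro integral_mono' integrable_divide w) auto
      finally show ?thesis .
    qed
    then have "(1 / \<tau> ^ DIM('a)) * \<bar>LINT v|lborel. T v\<bar> \<le> (1 / \<tau> ^ DIM('a)) * ((LINT v|lborel. w v) / \<tau>)"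
      using \<tau> by (intro mult_left_mono) auto
    finally show "\<bar>cone_integral ?Gb u \<tau>\<bar> \<le> (LINT z|lborel. w z) / \<tau> ^ (DIM('a) + 1)"
      by (simp add: mult.commute)
  qed
qed

text \<open>
  For \<open>\<tau> \<le> 1\<close> boundedness of the cone integral suffices; for larger slopes one derivative of each second
  derivative is traded for a factor \<open>1 / \<tau>\<close>.
\<close>

lemma cone_integral_laplacian_decay:
  fixes F :: "'a::euclidean_space \<times> real \<Rightarrow> real"
  assumes F: "test_function F"
  obtains C where "0 \<le> C"
    "\<And>u \<tau>. 0 < \<tau> \<Longrightarrow> \<bar>\<tau> ^ (DIM('a) - 1) * cone_integral (horizontal_laplacian F) u \<tau>\<bar> \<le> C * (1 / (1 + \<tau>\<^sup>2))"
proof -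
  let ?L = "horizontal_laplacian F"
  obtain C where C: "0 \<le> C" "\<And>u \<tau>. \<bar>cone_integral ?L u \<tau>\<bar> \<le> C"
    using norm_cone_integral_le[OF test_function_horizontal_laplacian[OF F]] by metis
  have "\<exists>D. \<forall>b\<in>Basis. 0 \<le> D b \<and> (\<forall>u \<tau>. 0 < \<tau> \<longrightarrow>
      \<bar>cone_integral (dir_deriv (b, 0) (dir_deriv (b, 0) F)) u \<tau>\<bar> \<le> D b / \<tau> ^ (DIM('a) + 1))"
  proof (rule bchoice, rule ballI)
    fix b :: 'a
    obtain D where "0 \<le> D" "\<And>u \<tau>. 0 < \<tau> \<Longrightarrow> \<bar>cone_integral (dir_deriv (b, 0) (dir_deriv (b, 0) F)) u \<tau>\<bar> \<le> D / \<tau> ^ (DIM('a) + 1)"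
      using cone_integral_dir_deriv_decay[OF test_function_dir_deriv[OF F], of b "(b, 0)"] by metis
    then show "\<exists>D. 0 \<le> D \<and> (\<forall>u \<tau>. 0 < \<tau> \<longrightarrow>
      \<bar>cone_integral (dir_deriv (b, 0) (dir_deriv (b, 0) F)) u \<tau>\<bar> \<le> D / \<tau> ^ (DIM('a) + 1))" by blast
  qed
  then obtain D where D: "\<And>b. b \<in> Basis \<Longrightarrow> 0 \<le> D b"
    "\<And>b u \<tau>. b \<in> Basis \<Longrightarrow> 0 < \<tau> \<Longrightarrow>
      \<bar>cone_integral (dir_deriv (b, 0) (dir_deriv (b, 0) F)) u \<tau>\<bar> \<le> D b / \<tau> ^ (DIM('a) + 1)"
    by blast
  define E where "E = (\<Sum>b\<in>Basis. D b)"
  have "0 \<le> E" unfolding E_def by (intro sum_nonneg D(1))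
  have large: "\<bar>cone_integral ?L u \<tau>\<bar> \<le> E / \<tau> ^ (DIM('a) + 1)" if "0 < \<tau>" for u \<tau>
  proof -
    have "cone_integral ?L u \<tau> = (\<Sum>b\<in>Basis. cone_integral (dir_deriv (b, 0) (dir_deriv (b, 0) F)) u \<tau>)"
      unfolding cone_integral_def horizontal_laplacian_def
      by (subst Bochner_Integration.integral_sum)
         (auto intro!: cone_integral_integrable test_function_dir_deriv F)
    also have "\<bar>\<dots>\<bar> \<le> (\<Sum>b\<in>Basis. D b / \<tau> ^ (DIM('a) + 1))"
      by (intro order_trans[OF sum_abs] sum_mono D(2) that)
    finally show ?thesis by (simp add: E_def sum_divide_distrib)
  qed
  show thesis
  proof (rule that[of "2 * (C + E)"])
    show "0 \<le> 2 * (C + E)" using C \<open>0 \<le> E\<close> by simp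
    fix u :: 'a and \<tau> :: real assume \<tau>: "0 < \<tau>"
    have pos: "0 < 1 + \<tau>\<^sup>2" by (simp add: add_pos_nonneg)
    define m where "m = DIM('a) - 1"
    have m: "DIM('a) + 1 = m + 2" using DIM_positive[where 'a='a] by (simp add: m_def)
    have "(1 + \<tau>\<^sup>2) * (\<tau> ^ m * \<bar>cone_integral ?L u \<tau>\<bar>) \<le> 2 * (C + E)"
    proof (cases "\<tau> \<le> 1")
      case True
      have "(1 + \<tau>\<^sup>2) * (\<tau> ^ m * \<bar>cone_integral ?L u \<tau>\<bar>) \<le> 2 * (1 * C)"
        using True \<tau> C by (intro mult_mono) (auto simp: power_le_one)
      then show ?thesis using \<open>0 \<le> E\<close> by simp
    next
      case False
      have "\<tau> ^ m * \<bar>cone_integral ?L u \<tau>\<bar> \<le> \<tau> ^ m * (E / \<tau> ^ (m + 2))"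
        using large[OF \<tau>, of u] \<tau> unfolding m by (intro mult_left_mono) auto
      also have "\<dots> = E / \<tau>\<^sup>2" using \<tau> by (simp add: power_add power2_eq_square)
      finally have "(1 + \<tau>\<^sup>2) * (\<tau> ^ m * \<bar>cone_integral ?L u \<tau>\<bar>) \<le> (1 + \<tau>\<^sup>2) * (E / \<tau>\<^sup>2)"
        using pos by (intro mult_left_mono) auto
      also have "\<dots> \<le> (2 * \<tau>\<^sup>2) * (E / \<tau>\<^sup>2)"
        using False \<open>0 \<le> E\<close> by (intro mult_right_mono) (auto simp: power2_eq_square intro: mult_mono[of 1 \<tau> 1 \<tau>, simplified])
      also have "\<dots> = 2 * E" using \<tau> by simp
      finally show ?thesis using C(1) by simp
    qed
    then show "\<bar>\<tau> ^ (DIM('a) - 1) * cone_integral ?L u \<tau>\<bar> \<le> 2 * (C + E) * (1 / (1 + \<tau>\<^sup>2))"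
      unfolding m_def[symmetric] using pos \<tau> by (simp add: abs_mult field_simps)
  qed
qed

section \<open>Complex multiplication on the plane\<close>

text \<open>
  Multiplication of complex numbers in the coordinates of the plane.  The map \<open>cmul a\<close> is a rotation followed by
  scaling with \<open>|a|\<close>, and exchanging the factors exchanges the roles of the map and its argument.
\<close>

definition cmul :: "real^2 \<Rightarrow> real^2 \<Rightarrow> real^2" where
  "cmul a z = vector [a $ 1 * z $ 1 - a $ 2 * z $ 2, a $ 1 * z $ 2 + a $ 2 * z $ 1]"

lemma cmul_nth[simp]: "cmul a z $ 1 = a $ 1 * z $ 1 - a $ 2 * z $ 2" "cmul a z $ 2 = a $ 1 * z $ 2 + a $ 2 * z $ 1"
  by (simp_all add: cmul_def)

lemma norm2_eq: "(norm (z :: real^2))\<^sup>2 = (z $ 1)\<^sup>2 + (z $ 2)\<^sup>2"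
  by (simp add: norm_vec_def L2_set_def UNIV_2 sum_nonneg)

lemma norm2_mult: "(z :: real^2) $ 1 * z $ 1 + z $ 2 * z $ 2 = (norm z)\<^sup>2"
  using norm2_eq[of z] by (simp add: power2_eq_square)

lemma cmul_commute: "cmul a z = cmul z a"
  by (simp add: vec_eq_iff forall_2 mult.commute)

lemma linear_cmul_right: "linear (cmul a)"
  by (rule linearI) (simp_all add: vec_eq_iff forall_2 algebra_simps)

lemma norm_cmul: "norm (cmul a z) = norm a * norm z"
proof -
  have "(norm (cmul a z))\<^sup>2 = (norm a * norm z)\<^sup>2"
    by (simp add: norm2_eq power_mult_distrib) (simp add: power2_eq_square algebra_simps)
  then show ?thesis by (simp add: power2_eq_iff_nonneg)
qed

lemma cmul_scaleR_left: "cmul (r *\<^sub>R a) z = r *\<^sub>R cmul a z"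
  by (simp add: vec_eq_iff forall_2 algebra_simps)

lemma cmul_axis: "cmul a (axis 1 1) = a"
  by (simp add: vec_eq_iff forall_2 axis_def)

lemma continuous_on_cmul: "continuous_on UNIV (\<lambda>p. cmul (fst p) (snd p))"
proof -
  have "cmul a z = (a $ 1 * z $ 1 - a $ 2 * z $ 2) *\<^sub>R axis 1 1 + (a $ 1 * z $ 2 + a $ 2 * z $ 1) *\<^sub>R axis 2 1" for a z
    by (simp add: vec_eq_iff forall_2 axis_def)
  then show ?thesis by (simp add: continuous_intros)
qed

lemmas continuous_on_cmul'[continuous_intros] = continuous_on_compose2[OF continuous_on_cmul continuous_on_Pair, simplified]

definition cmul_inverse :: "real^2 \<Rightarrow> real^2" where
  "cmul_inverse a = vector [a $ 1 / (norm a)\<^sup>2, - a $ 2 / (norm a)\<^sup>2]"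

lemma cmul_assoc: "cmul (cmul a b) z = cmul a (cmul b z)"
  by (simp add: vec_eq_iff forall_2 algebra_simps)

lemma cmul_inverse_right:
  assumes "a \<noteq> 0"
  shows "cmul a (cmul_inverse a) = axis 1 1"
proof -
  have "a $ 1 * a $ 1 / (norm a)\<^sup>2 + a $ 2 * a $ 2 / (norm a)\<^sup>2 = 1"
    using assms by (simp add: norm2_mult flip: add_divide_distrib)
  then show ?thesis
    by (simp add: vec_eq_iff forall_2 axis_def cmul_inverse_def)
qed

lemma cmul_inverse_cancel:
  assumes "a \<noteq> 0"
  shows "cmul a (cmul (cmul_inverse a) z) = z" "cmul (cmul_inverse a) (cmul a z) = z"
proof -
  have e: "cmul (axis 1 1) z = z" using cmul_axis[of z] cmul_commute by metis
  show "cmul a (cmul (cmul_inverse a) z) = z"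
    unfolding cmul_assoc[symmetric] cmul_inverse_right[OF assms] by (rule e)
  show "cmul (cmul_inverse a) (cmul a z) = z"
    unfolding cmul_assoc[symmetric] cmul_commute[of "cmul_inverse a" a] cmul_inverse_right[OF assms] by (rule e)
qed

text \<open>
  The determinant of the inverse map is \<open>1 / |a|\<^sup>2\<close>.
\<close>

lemma lborel_cmul:
  assumes "a \<noteq> 0"
  shows "(lborel :: (real^2) measure) = density (distr lborel borel (cmul a)) (\<lambda>_. ennreal ((norm a)\<^sup>2))"
proof (rule lborel_eqI)
  have [measurable]: "cmul a \<in> borel_measurable borel"
    by (intro borel_measurable_continuous_onI linear_continuous_on linear_conv_bounded_linear[THEN iffD1] linear_cmul_right)
  define b where "b = cmul_inverse a"
  fix l u :: "real^2" assume le: "\<And>c. c \<in> Basis \<Longrightarrow> l \<bullet> c \<le> u \<bullet> c"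
  have pre: "cmul a -` box l u = cmul b ` box l u"
  proof (intro equalityI subsetI)
    fix z assume "z \<in> cmul a -` box l u"
    then show "z \<in> cmul b ` box l u" using cmul_inverse_cancel(2)[OF assms, of z] unfolding b_def by (metis imageI vimageE)
  next
    fix z assume "z \<in> cmul b ` box l u"
    then show "z \<in> cmul a -` box l u" using cmul_inverse_cancel(1)[OF assms] unfolding b_def by auto
  qed
  have b_norm: "(norm b)\<^sup>2 = 1 / (norm a)\<^sup>2"
  proof -
    have "cmul a b = axis 1 1" using cmul_inverse_right[OF assms] b_def by simp
    then have "norm a * norm b = 1" using norm_cmul[of a b] by (simp add: norm_axis_1)
    then have "(norm a)\<^sup>2 * (norm b)\<^sup>2 = 1" by (metis power_mult_distrib power_one)
    then show ?thesis using assms by (simp add: field_simps)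
  qed
  have det: "\<bar>det (matrix (cmul b))\<bar> = (norm b)\<^sup>2"
  proof -
    have "det (matrix (cmul b)) = (norm b)\<^sup>2"
      by (simp add: det_2 matrix_def axis_def norm2_mult)
    then show ?thesis by simp
  qed
  have box: "box l u \<in> lmeasurable" by simp
  have lm: "cmul b ` box l u \<in> lmeasurable"
    by (rule measurable_linear_image[OF linear_cmul_right box])
  have "cmul a -` box l u \<in> sets borel" using measurable_sets[of "cmul a" borel borel "box l u"] by simp
  then have "emeasure lborel (cmul a -` box l u) = emeasure lebesgue (cmul b ` box l u)"
    unfolding pre[symmetric] by simp
  also have "\<dots> = ennreal (measure lebesgue (cmul b ` box l u))"
    by (rule emeasure_eq_measure2[OF lm])
  also have "measure lebesgue (cmul b ` box l u) = (1 / (norm a)\<^sup>2) * (\<Prod>b\<in>Basis. (u - l) \<bullet> b)"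
    unfolding measure_linear_image[OF linear_cmul_right box] det b_norm
    using le by (simp add: measure_lborel_box_eq)
  finally show "emeasure (density (distr lborel borel (cmul a)) (\<lambda>_. ennreal ((norm a)\<^sup>2))) (box l u) = (\<Prod>b\<in>Basis. (u - l) \<bullet> b)"
    using assms by (simp add: emeasure_density_const emeasure_distr flip: ennreal_mult')
qed simp

lemma cmul_borel[measurable]: "cmul a \<in> borel_measurable borel"
  by (intro borel_measurable_continuous_onI linear_continuous_on linear_conv_bounded_linear[THEN iffD1] linear_cmul_right)

lemma
  fixes h :: "real^2 \<Rightarrow> 'b::{banach, second_countable_topology}"
  assumes "a \<noteq> 0"
  shows integral_lborel_cmul: "h \<in> borel_measurable borel \<Longrightarrow>
      (LINT z|lborel. h (cmul a z)) = (1 / (norm a)\<^sup>2) *\<^sub>R (LINT z|lborel. h z)"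
    and integrable_lborel_cmul: "integrable lborel h \<Longrightarrow> integrable lborel (\<lambda>z. h (cmul a z))"
  using assms
  by (auto intro!: integral_lborel_jacobian integrable_lborel_jacobian lborel_cmul)

lemma polar_density_plane: "polar_density TYPE(real^2) r = (if 0 < r then r else 0)"
  by (simp add: polar_density_def)

lemma measure_sphere_plane: "measure (sphere_measure :: (real^2) measure) UNIV = 2 * pi"
  by (simp add: measure_def emeasure_sphere_measure unit_ball_vol_2)

lemma has_bochner_integral_radial_plane:
  fixes g :: "real \<Rightarrow> real"
  assumes [measurable]: "g \<in> borel_measurable borel" and "\<And>r. 0 \<le> g r"
    and V: "has_bochner_integral lborel (\<lambda>r. if 0 < r then r * g r else 0) V"
  shows "has_bochner_integral lborel (\<lambda>z :: real^2. g (norm z)) (2 * pi * V)"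
proof (rule has_bochner_integral_nn_integral)
  have nn: "(\<integral>\<^sup>+r. ennreal (if 0 < r then r * g r else 0) \<partial>lborel) = ennreal V"
    using V assms(2) by (auto simp: has_bochner_integral_iff intro!: nn_integral_eq_integral[THEN trans])
  have "0 \<le> V"
    using V assms(2) by (auto simp: has_bochner_integral_iff intro!: Bochner_Integration.integral_nonneg)
  then show "0 \<le> 2 * pi * V" by simp
  have "(\<integral>\<^sup>+z. ennreal (g (norm (z :: real^2))) \<partial>lborel) =
      (\<integral>\<^sup>+r. \<integral>\<^sup>+n. ennreal (polar_density TYPE(real^2) r) * ennreal (g (norm (r *\<^sub>R (n :: real^2)))) \<partial>sphere_measure \<partial>lborel)"
    by (rule nn_integral_polar) measurable
  also have "\<dots> = (\<integral>\<^sup>+r. \<integral>\<^sup>+n. ennreal (if 0 < r then r * g r else 0) \<partial>(sphere_measure :: (real^2) measure) \<partial>lborel)"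
  proof (rule nn_integral_cong, rule nn_integral_cong_AE)
    fix r :: real
    show "AE n in sphere_measure. ennreal (polar_density TYPE(real^2) r) * ennreal (g (norm (r *\<^sub>R (n :: real^2)))) =
        ennreal (if 0 < r then r * g r else 0)"
      using AE_sphere_measure_norm
      by eventually_elim (auto simp: polar_density_plane assms(2) simp flip: ennreal_mult)
  qed
  also have "\<dots> = (\<integral>\<^sup>+r. ennreal (if 0 < r then r * g r else 0) * ennreal (2 * pi) \<partial>lborel)"
    using measure_sphere_plane by (simp add: sphere.emeasure_eq_measure)
  also have "\<dots> = ennreal V * ennreal (2 * pi)"
    by (subst nn_integral_multc) (auto simp: nn)
  also have "\<dots> = ennreal (2 * pi * V)" using \<open>0 \<le> V\<close> by (simp add: mult.commute flip: ennreal_mult)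
  finally show "(\<integral>\<^sup>+z. ennreal (g (norm (z :: real^2))) \<partial>lborel) = ennreal (2 * pi * V)" .
qed (use assms in auto)

lemma inverse_norm_ball_integrable:
  "integrable lborel (\<lambda>z :: real^2. if norm z \<le> R then 1 / norm z else 0)"
proof -
  have "integrable lborel (\<lambda>r. if 0 < r then r * (if r \<le> R then 1 / \<bar>r\<bar> else 0) else 0)"
    by (rule integrable_bounded_support[of _ 1 "\<bar>R\<bar>"]) auto
  note int = this
  have "has_bochner_integral lborel (\<lambda>z :: real^2. if norm z \<le> R then 1 / \<bar>norm z\<bar> else 0)
      (2 * pi * (LINT r|lborel. (if 0 < r then r * (if r \<le> R then 1 / \<bar>r\<bar> else 0) else 0)))"
    by (rule has_bochner_integral_radial_plane[OF _ _ has_bochner_integral_integrable[OF int]]) auto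
  then show ?thesis by (simp only: abs_norm_cancel has_bochner_integral_iff)
qed

lemma plane_kernel_integral:
  assumes "0 < \<rho>"
  shows "has_bochner_integral lborel (\<lambda>d :: real^2. 2 / ((norm d)\<^sup>2 + \<rho>\<^sup>2)\<^sup>2) (2 * pi / \<rho>\<^sup>2)"
proof -
  have pos: "0 < r\<^sup>2 + \<rho>\<^sup>2" for r using assms by (simp add: add_nonneg_pos)
  have "has_bochner_integral lborel (\<lambda>r. if 0 < r then r * (2 / (r\<^sup>2 + \<rho>\<^sup>2)\<^sup>2) else 0) (1 / \<rho>\<^sup>2)"
  proof (rule has_bochner_integral_nn_integral)
    have "(\<integral>\<^sup>+r. ennreal (r * (2 / (r\<^sup>2 + \<rho>\<^sup>2)\<^sup>2)) * indicator {0..} r \<partial>lborel) = ennreal (0 - (- (1 / (0\<^sup>2 + \<rho>\<^sup>2))))"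
    proof (rule nn_integral_FTC_atLeast[where F = "\<lambda>r. - (1 / (r\<^sup>2 + \<rho>\<^sup>2))"])
      show "((\<lambda>r. - (1 / (r\<^sup>2 + \<rho>\<^sup>2))) has_real_derivative r * (2 / (r\<^sup>2 + \<rho>\<^sup>2)\<^sup>2)) (at r)" for r
        using pos[of r] by (auto intro!: derivative_eq_intros simp: power2_eq_square)
      have "((\<lambda>r. 1 / (r\<^sup>2 + \<rho>\<^sup>2)) \<longlongrightarrow> 0) at_top" by real_asymp
      from tendsto_minus[OF this] show "((\<lambda>r. - (1 / (r\<^sup>2 + \<rho>\<^sup>2))) \<longlongrightarrow> 0) at_top" by simp
    qed (auto simp: )
    also have "(\<integral>\<^sup>+r. ennreal (r * (2 / (r\<^sup>2 + \<rho>\<^sup>2)\<^sup>2)) * indicator {0..} r \<partial>lborel) =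
        (\<integral>\<^sup>+r. ennreal (if 0 < r then r * (2 / (r\<^sup>2 + \<rho>\<^sup>2)\<^sup>2) else 0) \<partial>lborel)"
      by (rule nn_integral_cong) (auto simp: indicator_def)
    finally show "(\<integral>\<^sup>+r. ennreal (if 0 < r then r * (2 / (r\<^sup>2 + \<rho>\<^sup>2)\<^sup>2) else 0) \<partial>lborel) = ennreal (1 / \<rho>\<^sup>2)" by simp
  qed auto
  note rad = this
  have "has_bochner_integral lborel (\<lambda>d :: real^2. 2 / ((norm d)\<^sup>2 + \<rho>\<^sup>2)\<^sup>2) (2 * pi * (1 / \<rho>\<^sup>2))"
    by (rule has_bochner_integral_radial_plane[OF _ _ rad]) auto
  then show ?thesis by simp
qed

section \<open>Integration by parts in the horizontal variable\<close>

text \<open>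
  The function \<open>v \<mapsto> (v \<cdot> \<nabla>) F (x + v, t)\<close>, the derivative of \<open>F\<close> along the rays from \<open>x\<close> times \<open>|v|\<close>.
\<close>

definition radial_deriv :: "('a::euclidean_space \<times> real \<Rightarrow> real) \<Rightarrow> 'a \<Rightarrow> 'a \<Rightarrow> real \<Rightarrow> real" where
  "radial_deriv F x v t = dir_deriv (v, 0) F (x + v, t)"

lemma radial_deriv_eq_sum:
  fixes F :: "'a::euclidean_space \<times> real \<Rightarrow> real"
  assumes F: "test_function F"
  shows "radial_deriv F x v t = (\<Sum>b\<in>Basis. (v \<bullet> b) * dir_deriv (b, 0) F (x + v, t))"
proof -
  have lin: "linear (\<lambda>w. dir_deriv w F (x + v, t))"
    using test_function_has_derivative[OF F] by (rule has_derivative_linear)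
  have "dir_deriv (v, 0) F (x + v, t) = dir_deriv (\<Sum>b\<in>Basis. (v \<bullet> b) *\<^sub>R (b, 0)) F (x + v, t)"
  proof -
    have "(\<Sum>b\<in>Basis. (v \<bullet> b) *\<^sub>R (b, 0::real)) = ((\<Sum>b\<in>Basis. (v \<bullet> b) *\<^sub>R b), 0)"
      by (simp add: prod_eq_iff fst_sum snd_sum)
    then show ?thesis by (simp add: euclidean_representation)
  qed
  also have "\<dots> = (\<Sum>b\<in>Basis. (v \<bullet> b) * dir_deriv (b, 0) F (x + v, t))"
    by (simp only: linear_sum[OF lin] linear_cmul[OF lin] real_scaleR_def)
  finally show ?thesis by (simp add: radial_deriv_def)
qed

lemma radial_deriv_continuous:
  fixes F :: "'a::euclidean_space \<times> real \<Rightarrow> real"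
  assumes F: "test_function F"
  shows "continuous_on UNIV (\<lambda>(v, t). radial_deriv F x v t)"
  unfolding radial_deriv_eq_sum[OF F] split_beta'
  by (intro continuous_intros continuous_on_compose2[OF test_function_continuous[OF test_function_dir_deriv[OF F]]]) auto

lemma radial_deriv_bound:
  fixes F :: "'a::euclidean_space \<times> real \<Rightarrow> real"
  assumes F: "test_function F"
  obtains M R where "0 \<le> M" "0 < R" "\<And>v t. \<bar>radial_deriv F x v t\<bar> \<le> (if norm v \<le> R then M * norm v else 0)"
proof -
  have "\<exists>R. \<forall>b\<in>Basis. 0 < R b \<and> (\<forall>z. \<bar>dir_deriv (b, 0) F z\<bar> \<le> R b) \<and> (\<forall>v t. dir_deriv (b, 0) F (v, t) \<noteq> 0 \<longrightarrow> norm v \<le> R b)"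
  proof (rule bchoice, rule ballI)
    fix b :: 'a
    obtain R a where "0 < R" "\<And>x t. dir_deriv (b, 0) F (x, t) \<noteq> 0 \<Longrightarrow> norm x \<le> R \<and> a \<le> t \<and> t \<le> R" "\<And>z. \<bar>dir_deriv (b, 0) F z\<bar> \<le> R"
      using test_function_bounds[OF test_function_dir_deriv[OF F, of "(b, 0)"]] by metis
    then show "\<exists>R. 0 < R \<and> (\<forall>z. \<bar>dir_deriv (b, 0) F z\<bar> \<le> R) \<and> (\<forall>v t. dir_deriv (b, 0) F (v, t) \<noteq> 0 \<longrightarrow> norm v \<le> R)"
      by blast
  qed
  then obtain R where R: "\<And>b. b \<in> Basis \<Longrightarrow> 0 < R b" "\<And>b z. b \<in> Basis \<Longrightarrow> \<bar>dir_deriv (b, 0) F z\<bar> \<le> R b"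
    "\<And>b v t. b \<in> Basis \<Longrightarrow> dir_deriv (b, 0) F (v, t) \<noteq> 0 \<Longrightarrow> norm v \<le> R b" by blast
  define S where "S = (\<Sum>b\<in>Basis. R b)"
  have RS: "R b \<le> S" if "b \<in> Basis" for b
    unfolding S_def using that R(1) by (intro member_le_sum) (auto simp: less_imp_le)
  have "0 \<le> S" unfolding S_def using R(1) by (intro sum_nonneg) (auto simp: less_imp_le)
  show thesis
  proof (rule that[of S "S + norm x + 1"])
    show "0 \<le> S" "0 < S + norm x + 1" using \<open>0 \<le> S\<close> by (auto intro: add_nonneg_pos)
    fix v t
    show "\<bar>radial_deriv F x v t\<bar> \<le> (if norm v \<le> S + norm x + 1 then S * norm v else 0)"
    proof (cases "norm v \<le> S + norm x + 1")
      case True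
      have "\<bar>radial_deriv F x v t\<bar> \<le> (\<Sum>b\<in>Basis. \<bar>(v \<bullet> b) * dir_deriv (b, 0) F (x + v, t)\<bar>)"
        unfolding radial_deriv_eq_sum[OF F] by (rule sum_abs)
      also have "\<dots> \<le> (\<Sum>b\<in>Basis. norm v * R b)"
        unfolding abs_mult by (intro sum_mono mult_mono R(2) Basis_le_norm) auto
      finally show ?thesis using True by (simp add: S_def sum_distrib_left mult.commute)
    next
      case False
      have "dir_deriv (b, 0) F (x + v, t) = 0" if "b \<in> Basis" for b
      proof (rule ccontr)
        assume "dir_deriv (b, 0) F (x + v, t) \<noteq> 0"
        then have "norm (x + v) \<le> S" using R(3) RS that by (meson order_trans)
        moreover have "norm v \<le> norm (x + v) + norm x" using norm_triangle_ineq4[of "x + v" x] by simp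
        ultimately show False using False by linarith
      qed
      then show ?thesis using False by (simp add: radial_deriv_eq_sum[OF F])
    qed
  qed
qed

text \<open>
  The gradient of \<open>1 / (\<alpha> + \<beta> |v|\<^sup>2)\<close> is \<open>- 2 \<beta> v / (\<alpha> + \<beta> |v|\<^sup>2)\<^sup>2\<close>, so only the derivative of \<open>F\<close> in the
  direction of \<open>v\<close> survives.
\<close>

lemma laplacian_integration_by_parts:
  fixes F :: "'a::euclidean_space \<times> real \<Rightarrow> real"
  assumes F: "test_function F" and \<alpha>: "0 < \<alpha>" and \<beta>: "0 \<le> \<beta>"
  shows "(LINT v|lborel. horizontal_laplacian F (x + v, t) / (\<alpha> + \<beta> * (norm v)\<^sup>2)) =
    (LINT v|lborel. 2 * \<beta> * radial_deriv F x v t / (\<alpha> + \<beta> * (norm v)\<^sup>2)\<^sup>2)"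
proof -
  define den where "den v = \<alpha> + \<beta> * (norm v)\<^sup>2" for v :: 'a
  have den: "\<alpha> \<le> den v" "0 < den v" for v using \<alpha> \<beta> by (auto simp: den_def add_pos_nonneg)
  define A where "A b v = dir_deriv (b, 0) (dir_deriv (b, 0) F) (x + v, t) / den v" for b v
  define B where "B b v = 2 * \<beta> * ((v \<bullet> b) * dir_deriv (b, 0) F (x + v, t)) / (den v)\<^sup>2" for b v
  have part: "integrable lborel (A b) \<and> integrable lborel (B b) \<and> (LINT v|lborel. A b v) = (LINT v|lborel. B b v)" for b :: 'a
  proof -
    have F1: "test_function (dir_deriv (b, 0) F)" by (rule test_function_dir_deriv[OF F])
    have F2: "test_function (dir_deriv (b, 0) (dir_deriv (b, 0) F))" by (rule test_function_dir_deriv[OF F1])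
    obtain R a where R: "0 < R" "\<And>x t. dir_deriv (b, 0) F (x, t) \<noteq> 0 \<Longrightarrow> norm x \<le> R \<and> a \<le> t \<and> t \<le> R" "\<And>z. \<bar>dir_deriv (b, 0) F z\<bar> \<le> R"
      using test_function_bounds[OF F1] by metis
    obtain Q q where Q: "0 < Q" "\<And>x t. dir_deriv (b, 0) (dir_deriv (b, 0) F) (x, t) \<noteq> 0 \<Longrightarrow> norm x \<le> Q \<and> q \<le> t \<and> t \<le> Q"
      "\<And>z. \<bar>dir_deriv (b, 0) (dir_deriv (b, 0) F) z\<bar> \<le> Q"
      using test_function_bounds[OF F2] by metis
    define S where "S = R + Q + norm x"
    have S0: "0 \<le> S" using R(1) Q(1) by (simp add: S_def)
    have vanish: "dir_deriv (b, 0) F (x + v, t) = 0" "dir_deriv (b, 0) (dir_deriv (b, 0) F) (x + v, t) = 0"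
      if "S < norm v" for v
    proof -
      have "norm v \<le> norm (x + v) + norm x" using norm_triangle_ineq4[of "x + v" x] by simp
      then have "R < norm (x + v)" "Q < norm (x + v)" using that R(1) Q(1) unfolding S_def by linarith+
      then show "dir_deriv (b, 0) F (x + v, t) = 0" "dir_deriv (b, 0) (dir_deriv (b, 0) F) (x + v, t) = 0"
        using R(2)[of "x + v" t] Q(2)[of "x + v" t] by force+
    qed
    have A_le: "norm (A b v) \<le> Q / \<alpha>" for v
      using frac_le[OF _ Q(3) \<alpha> den(1), of "(x + v, t)" v] Q(1) den(2)[of v] by (simp add: A_def)
    have B_le: "norm (B b v) \<le> 2 * \<beta> * (S * norm b * R) / \<alpha>\<^sup>2" for v
    proof (cases "S < norm v")
      case True
      then show ?thesis using vanish \<alpha> \<beta> S0 R(1) by (simp add: B_def)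
    next
      case False
      have "\<bar>v \<bullet> b\<bar> \<le> S * norm b"
        by (rule order_trans[OF Cauchy_Schwarz_ineq2]) (use False in \<open>simp add: mult_right_mono\<close>)
      then have "\<bar>v \<bullet> b\<bar> * \<bar>dir_deriv (b, 0) F (x + v, t)\<bar> \<le> S * norm b * R"
        using R(3) S0 by (intro mult_mono) auto
      then have "2 * \<beta> * (\<bar>v \<bullet> b\<bar> * \<bar>dir_deriv (b, 0) F (x + v, t)\<bar>) / (den v)\<^sup>2 \<le> 2 * \<beta> * (S * norm b * R) / \<alpha>\<^sup>2"
        using \<alpha> \<beta> den[of v] S0 R(1) by (intro frac_le mult_left_mono power_mono) auto
      then show ?thesis using \<beta> by (simp add: B_def abs_mult)
    qed
    have den_nz: "\<alpha> + \<beta> * (norm v)\<^sup>2 \<noteq> 0" for v :: 'a using den(2)[of v] by (simp add: den_def)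
    have A_borel: "A b \<in> borel_measurable borel" and B_borel: "B b \<in> borel_measurable borel"
      unfolding A_def[abs_def] B_def[abs_def] den_def
      by (intro borel_measurable_continuous_onI continuous_intros
          continuous_on_compose2[OF test_function_continuous[OF F1]]
          continuous_on_compose2[OF test_function_continuous[OF F2]]; use den_nz in auto)+
    have A_int: "integrable lborel (A b)"
      by (rule integrable_bounded_support[OF A_borel A_le, of S]) (simp add: A_def vanish)
    have B_int: "integrable lborel (B b)"
      by (rule integrable_bounded_support[OF B_borel B_le, of S]) (simp add: B_def vanish)
    have "(LINT v|lborel. A b v - B b v) = 0"
    proof (rule integral_directional_derivative_eq_0[of "\<lambda>v. dir_deriv (b, 0) F (x + v, t) / den v" b _ "Q / \<alpha> + 2 * \<beta> * (S * norm b * R) / \<alpha>\<^sup>2" S])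
      fix v
      have d1: "((\<lambda>s. dir_deriv (b, 0) F (x + (v + s *\<^sub>R b), t)) has_real_derivative dir_deriv (b, 0) (dir_deriv (b, 0) F) (x + v, t)) (at 0)"
        using test_function_has_vector_derivative[OF F1, of "(x + v, t)" "(b, 0)" 0]
        by (simp add: has_real_derivative_iff_has_vector_derivative add.assoc)
      have d2: "((\<lambda>s. den (v + s *\<^sub>R b)) has_real_derivative 2 * \<beta> * (v \<bullet> b)) (at 0)"
      proof -
        have "den (v + s *\<^sub>R b) = \<alpha> + \<beta> * ((norm v)\<^sup>2 + 2 * s * (v \<bullet> b) + s\<^sup>2 * (norm b)\<^sup>2)" for s
          unfolding den_def power2_norm_eq_inner
          by (simp add: inner_add_left inner_add_right inner_commute power2_eq_square algebra_simps)
        then show ?thesis by (auto intro!: derivative_eq_intros)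
      qed
      have "((\<lambda>s. dir_deriv (b, 0) F (x + (v + s *\<^sub>R b), t) / den (v + s *\<^sub>R b)) has_real_derivative A b v - B b v) (at 0)"
        by (rule DERIV_cong[OF DERIV_divide[OF d1 d2]])
           (use den(2)[of v] in \<open>simp_all add: A_def B_def field_simps power2_eq_square\<close>)
      then show "((\<lambda>s. dir_deriv (b, 0) F (x + (v + s *\<^sub>R b), t) / den (v + s *\<^sub>R b)) has_vector_derivative A b v - B b v) (at 0)"
        by (simp add: has_real_derivative_iff_has_vector_derivative)
      show "norm (A b v - B b v) \<le> Q / \<alpha> + 2 * \<beta> * (S * norm b * R) / \<alpha>\<^sup>2"
        by (rule order_trans[OF norm_triangle_ineq4 add_mono[OF A_le B_le]])
      show "A b v - B b v = 0" if "S < norm v" using vanish[OF that] by (simp add: A_def B_def)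
    next
      show "integrable lborel (\<lambda>v. dir_deriv (b, 0) F (x + v, t) / den v)"
      proof (rule integrable_bounded_support[of _ "R / \<alpha>" S])
        show "(\<lambda>v. dir_deriv (b, 0) F (x + v, t) / den v) \<in> borel_measurable borel"
          unfolding den_def
          by (intro borel_measurable_continuous_onI continuous_intros
            continuous_on_compose2[OF test_function_continuous[OF F1]]; use den_nz in auto)
        show "norm (dir_deriv (b, 0) F (x + v, t) / den v) \<le> R / \<alpha>" for v
          using frac_le[OF _ R(3) \<alpha> den(1), of "(x + v, t)" v] R(1) den(2)[of v] by simp
      qed (simp add: vanish)
    qed
    then show ?thesis using A_int B_int by simp
  qed
  have "(LINT v|lborel. horizontal_laplacian F (x + v, t) / den v) = (\<Sum>b\<in>Basis. LINT v|lborel. A b v)"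
    using part by (subst Bochner_Integration.integral_sum[symmetric]) (auto simp: horizontal_laplacian_def A_def sum_divide_distrib)
  also have "\<dots> = (\<Sum>b\<in>Basis. LINT v|lborel. B b v)" using part by simp
  also have "\<dots> = (LINT v|lborel. 2 * \<beta> * radial_deriv F x v t / (den v)\<^sup>2)"
    using part by (subst Bochner_Integration.integral_sum[symmetric])
      (auto simp: radial_deriv_eq_sum[OF F] B_def sum_divide_distrib sum_distrib_left)
  finally show ?thesis by (simp add: den_def)
qed

text \<open>
  In polar coordinates \<open>v = r n\<close> the integrand times the density \<open>r\<close> is the derivative of \<open>F (x + r n, y)\<close> in \<open>r\<close>.
  Every ray contributes \<open>- F (x, y)\<close>, and the circle has length \<open>2 \<pi>\<close>.
\<close>

lemma radial_deriv_integral: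
  fixes F :: "(real^2) \<times> real \<Rightarrow> real"
  assumes F: "test_function F"
  shows "(LINT v|lborel. radial_deriv F x v y / (norm v)\<^sup>2) = - (2 * pi * F (x, y))"
proof -
  obtain M R where M: "0 \<le> M" "0 < R" "\<And>v t. \<bar>radial_deriv F x v t\<bar> \<le> (if norm v \<le> R then M * norm v else 0)"
    using radial_deriv_bound[OF F] by metis
  obtain Q q where Q: "0 < Q" "\<And>x t. F (x, t) \<noteq> 0 \<Longrightarrow> norm x \<le> Q \<and> q \<le> t \<and> t \<le> Q"
    using test_function_bounds[OF F] by metis
  define k where "k v = radial_deriv F x v y / (norm v)\<^sup>2" for v
  have rd_borel[measurable]: "(\<lambda>v. radial_deriv F x v y) \<in> borel_measurable borel"
    by (rule borel_measurable_continuous_onI)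
       (rule continuous_on_compose2[OF radial_deriv_continuous[OF F], of UNIV "\<lambda>v. (v, y)" x, simplified], auto intro: continuous_intros)
  have k_borel[measurable]: "k \<in> borel_measurable borel" unfolding k_def[abs_def] by measurable
  have k_int: "integrable lborel k"
  proof (rule Bochner_Integration.integrable_bound[OF integrable_mult_right[OF inverse_norm_ball_integrable[of R], of M]])
    have "norm (k v) \<le> norm (M * (if norm v \<le> R then 1 / norm v else 0))" for v
    proof (cases "v = 0")
      case False
      then have "\<bar>radial_deriv F x v y\<bar> / (norm v)\<^sup>2 \<le> (if norm v \<le> R then M * norm v else 0) / (norm v)\<^sup>2"
        by (intro divide_right_mono M(3)) simp
      then show ?thesis using M(1) False by (simp add: k_def power2_eq_square split: if_splits)
    qed (simp add: k_def)
    then show "AE v in lborel. norm (k v) \<le> norm (M * (if norm v \<le> R then 1 / norm v else 0))" by simp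
  qed simp
  have pint: "integrable (lborel \<Otimes>\<^sub>M sphere_measure) (\<lambda>(r, n). polar_density TYPE(real^2) r * k (r *\<^sub>R n))"
    using k_int integrable_polar_iff[OF k_borel] by (simp add: split_beta')
  have "(LINT v|lborel. k v) = (LINT r|lborel. LINT n|sphere_measure. polar_density TYPE(real^2) r * k (r *\<^sub>R n))"
    using integral_polar[OF k_borel k_int] by simp
  also have "\<dots> = (LINT n|sphere_measure. LINT r|lborel. polar_density TYPE(real^2) r * k (r *\<^sub>R n))"
    by (rule lborel_sphere.Fubini_integral[OF pint, symmetric])
  also have "\<dots> = (LINT n|(sphere_measure :: (real^2) measure). - F (x, y))"
  proof (rule integral_cong_AE)
    show "AE n in sphere_measure. (LINT r|lborel. polar_density TYPE(real^2) r * k (r *\<^sub>R n)) = - F (x, y)"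
      using AE_sphere_measure_norm
    proof eventually_elim
      case (elim n)
      define T where "T = Q + norm x + 1"
      have "T \<ge> 0" using Q(1) by (simp add: T_def)
      have out: "F (x + r *\<^sub>R n, y) = 0" if "Q + norm x < r" for r
      proof (rule ccontr)
        assume "F (x + r *\<^sub>R n, y) \<noteq> 0"
        then have "norm (x + r *\<^sub>R n) \<le> Q" using Q(2) by blast
        moreover have "norm (r *\<^sub>R n) \<le> norm (x + r *\<^sub>R n) + norm x" using norm_triangle_ineq4[of "x + r *\<^sub>R n" x] by simp
        ultimately show False using that elim by simp
      qed
      have D: "((\<lambda>r. F (x + r *\<^sub>R n, y)) has_vector_derivative dir_deriv (n, 0) F (x + r *\<^sub>R n, y)) (at r)" for r
        using test_function_has_vector_derivative[OF F, of "(x, y)" "(n, 0)" r] by simp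
      have out': "dir_deriv (n, 0) F (x + r *\<^sub>R n, y) = 0" if "T < r" for r
      proof -
        have "((\<lambda>r. F (x + r *\<^sub>R n, y)) has_vector_derivative 0) (at r)"
          by (rule has_vector_derivative_transform_within_open[of "\<lambda>_. 0" _ _ "{Q + norm x<..}"])
             (use that out in \<open>auto simp: T_def\<close>)
        from vector_derivative_unique_at[OF D this] show ?thesis .
      qed
      have k_eq: "polar_density TYPE(real^2) r * k (r *\<^sub>R n) = dir_deriv (n, 0) F (x + r *\<^sub>R n, y)" if "0 < r" for r
      proof -
        have lin: "linear (\<lambda>w. dir_deriv w F (x + r *\<^sub>R n, y))"
          using test_function_has_derivative[OF F] by (rule has_derivative_linear)
        have "radial_deriv F x (r *\<^sub>R n) y = r * dir_deriv (n, 0) F (x + r *\<^sub>R n, y)"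
          using linear_cmul[OF lin, of r "(n, 0)"] by (simp add: radial_deriv_def)
        then show ?thesis using that elim by (simp add: k_def polar_density_plane power2_eq_square)
      qed
      have "(LINT r|lborel. polar_density TYPE(real^2) r * k (r *\<^sub>R n)) =
          (LINT r|lborel. indicator {0..T} r *\<^sub>R dir_deriv (n, 0) F (x + r *\<^sub>R n, y))"
      proof (rule integral_discrete_difference[where X = "{0}"])
        fix r :: real assume "r \<notin> {0}"
        then consider "r < 0" | "0 < r" by fastforce
        then show "polar_density TYPE(real^2) r * k (r *\<^sub>R n) = indicator {0..T} r *\<^sub>R dir_deriv (n, 0) F (x + r *\<^sub>R n, y)"
        proof cases
          case 2
          show ?thesis unfolding k_eq[OF 2] using out'[of r] 2 by (cases "T < r") (auto simp: indicator_def)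
        qed (simp add: polar_density_plane)
      qed auto
      also have "\<dots> = F (x + T *\<^sub>R n, y) - F (x + 0 *\<^sub>R n, y)"
      proof (rule integral_FTC_atLeastAtMost[OF \<open>T \<ge> 0\<close>])
        show "((\<lambda>r. F (x + r *\<^sub>R n, y)) has_vector_derivative dir_deriv (n, 0) F (x + r *\<^sub>R n, y)) (at r within {0..T})" for r
          by (rule has_vector_derivative_at_within[OF D])
        show "continuous_on {0..T} (\<lambda>r. dir_deriv (n, 0) F (x + r *\<^sub>R n, y))"
          by (intro continuous_on_compose2[OF test_function_continuous[OF test_function_dir_deriv[OF F]]] continuous_intros) auto
      qed
      also have "F (x + T *\<^sub>R n, y) = 0" by (rule out) (simp add: T_def)
      finally show ?case by simp
    qed
    show "(\<lambda>n. LINT r|lborel. polar_density TYPE(real^2) r * k (r *\<^sub>R n)) \<in> borel_measurable sphere_measure"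
      by measurable
  qed simp
  also have "\<dots> = - (2 * pi * F (x, y))" using measure_sphere_plane by simp
  finally show ?thesis by (simp add: k_def)
qed

section \<open>Inversion in dimension three\<close>

abbreviation e1 :: "real^2" where
  "e1 \<equiv> axis 1 1"

text \<open>
  The function \<open>h\<close> whose integral recovers \<open>F (x, y)\<close>.  The direction of \<open>u\<close> is the point of the circle and its length
  the slope in the formula over \<open>\<theta>\<close>, and \<open>x + y u\<close> is the integration variable of the formula over the plane.
\<close>

definition cone_laplacian :: "((real^2) \<times> real \<Rightarrow> real) \<Rightarrow> real^2 \<Rightarrow> real \<Rightarrow> real^2 \<Rightarrow> real" where
  "cone_laplacian F x y u = cone_integral (horizontal_laplacian F) (x + y *\<^sub>R u) (norm u)"

lemma cone_laplacian_measurable: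
  assumes F: "test_function F"
  shows "cone_laplacian F x y \<in> borel_measurable borel"
proof -
  have "(\<lambda>u. cone_integral (horizontal_laplacian F) (x + y *\<^sub>R u) (norm u)) \<in> borel_measurable borel"
    using cone_integral_measurable[OF test_function_horizontal_laplacian[OF F]]
    by (rule measurable_Pair_compose_split) measurable
  then show ?thesis by (simp add: cone_laplacian_def[abs_def])
qed

lemma cone_laplacian_polar_integrable:
  assumes F: "test_function F"
  shows "integrable (lborel \<Otimes>\<^sub>M sphere_measure) (\<lambda>(r, n). polar_density TYPE(real^2) r *\<^sub>R cone_laplacian F x y (r *\<^sub>R n))"
proof -
  note [measurable] = cone_laplacian_measurable[OF F]
  obtain C where C: "0 \<le> C" "\<And>u \<tau>. 0 < \<tau> \<Longrightarrow> \<bar>\<tau> ^ (DIM(real^2) - 1) * cone_integral (horizontal_laplacian F) u \<tau>\<bar> \<le> C * (1 / (1 + \<tau>\<^sup>2))"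
    using cone_integral_laplacian_decay[OF F] by metis
  have bnd: "AE n in sphere_measure. norm (polar_density TYPE(real^2) r *\<^sub>R cone_laplacian F x y (r *\<^sub>R n)) \<le> C * (1 / (1 + r\<^sup>2))" for r
    using AE_sphere_measure_norm
  proof eventually_elim
    case (elim n)
    show ?case
    proof (cases "0 < r")
      case True
      then show ?thesis using C(2)[OF True, of "x + y *\<^sub>R (r *\<^sub>R n)"] elim
        by (simp add: polar_density_plane cone_laplacian_def)
    qed (use C(1) in \<open>simp add: polar_density_plane\<close>)
  qed
  have m: "(\<lambda>(r, n). polar_density TYPE(real^2) r *\<^sub>R cone_laplacian F x y (r *\<^sub>R n)) \<in> borel_measurable (lborel \<Otimes>\<^sub>M sphere_measure)"
    by measurable
  show ?thesis
  proof (rule lborel_sphere.Fubini_integrable[OF m])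
    show AE_int: "AE r in lborel. integrable sphere_measure (\<lambda>n. case (r, n) of (r, n) \<Rightarrow> polar_density TYPE(real^2) r *\<^sub>R cone_laplacian F x y (r *\<^sub>R n))"
    proof (rule AE_I2)
      fix r
      have "integrable sphere_measure (\<lambda>n. polar_density TYPE(real^2) r *\<^sub>R cone_laplacian F x y (r *\<^sub>R n))"
        by (rule sphere.integrable_const_bound[OF bnd]) measurable
      then show "integrable sphere_measure (\<lambda>n. case (r, n) of (r, n) \<Rightarrow> polar_density TYPE(real^2) r *\<^sub>R cone_laplacian F x y (r *\<^sub>R n))" by simp
    qed
    show "integrable lborel (\<lambda>r. LINT n|sphere_measure. norm (case (r, n) of (r, n) \<Rightarrow> polar_density TYPE(real^2) r *\<^sub>R cone_laplacian F x y (r *\<^sub>R n)))"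
    proof (rule Bochner_Integration.integrable_bound[OF integrable_mult_right[OF integrable_inverse_1_plus_square_UNIV, of "2 * pi * C"]])
      have "norm (LINT n|sphere_measure. norm (polar_density TYPE(real^2) r *\<^sub>R cone_laplacian F x y (r *\<^sub>R n))) \<le> norm (2 * pi * C * (1 / (1 + r\<^sup>2)))" for r
      proof -
        have "(LINT n|sphere_measure. norm (polar_density TYPE(real^2) r *\<^sub>R cone_laplacian F x y (r *\<^sub>R n))) \<le>
            (LINT n|(sphere_measure :: (real^2) measure). C * (1 / (1 + r\<^sup>2)))"
        proof (rule integral_mono_AE[OF _ _ bnd])
          show "integrable sphere_measure (\<lambda>n. norm (polar_density TYPE(real^2) r *\<^sub>R cone_laplacian F x y (r *\<^sub>R n)))"
            by (rule integrable_norm, rule sphere.integrable_const_bound[OF bnd]) measurable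
        qed simp
        also have "\<dots> = 2 * pi * C * (1 / (1 + r\<^sup>2))" using measure_sphere_plane by simp
        finally show ?thesis using C(1) by (simp add: Bochner_Integration.integral_nonneg)
      qed
      then show "AE r in lborel. norm (LINT n|sphere_measure. norm (case (r, n) of (r, n) \<Rightarrow> polar_density TYPE(real^2) r *\<^sub>R cone_laplacian F x y (r *\<^sub>R n))) \<le> norm (2 * pi * C * (1 / (1 + r\<^sup>2)))"
        by simp
    qed measurable
  qed
qed

lemma cone_laplacian_integrable:
  "test_function F \<Longrightarrow> integrable lborel (cone_laplacian F x y)"
  using cone_laplacian_polar_integrable integrable_polar_iff[OF cone_laplacian_measurable] by blast

text \<open>
  Shift \<open>w\<close> by \<open>y u / |u|\<close> and rotate it by the direction of \<open>u\<close>.  The apex \<open>x + y u\<close> moves to \<open>x\<close>, and the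
  height becomes the distance to the fixed point \<open>y e\<^sub>1\<close>.
\<close>

lemma cone_laplacian_eq_cmul:
  assumes F: "test_function F" and u: "u \<noteq> 0"
  shows "cone_laplacian F x y u = (LINT c|lborel. horizontal_laplacian F (x + cmul u c, norm (c - y *\<^sub>R e1)))"
proof -
  let ?L = "horizontal_laplacian F"
  have L: "test_function ?L" by (rule test_function_horizontal_laplacian[OF F])
  define v where "v = (1 / norm u) *\<^sub>R u"
  have v: "norm u *\<^sub>R v = u" "norm v = 1" using u by (simp_all add: v_def)
  define g where "g w = ?L (x + y *\<^sub>R u + norm u *\<^sub>R w, norm w)" for w
  define g' where "g' q = ?L (x + norm u *\<^sub>R q, norm (q - y *\<^sub>R v))" for q
  have g_borel: "g \<in> borel_measurable borel" and g'_borel: "g' \<in> borel_measurable borel"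
    unfolding g_def[abs_def] g'_def[abs_def]
    by (intro borel_measurable_continuous_onI continuous_intros continuous_on_compose2[OF test_function_continuous[OF L]]; simp)+
  have "cone_laplacian F x y u = (LINT q|lborel. g (q + (- (y *\<^sub>R v))))"
    using integral_lborel_translate[OF g_borel, of "- (y *\<^sub>R v)"] by (simp add: cone_laplacian_def cone_integral_def g_def)
  also have "\<dots> = (LINT q|lborel. g' q)"
  proof (rule Bochner_Integration.integral_cong[OF refl])
    fix q
    have "x + y *\<^sub>R u + norm u *\<^sub>R (q + (- (y *\<^sub>R v))) = x + norm u *\<^sub>R q + y *\<^sub>R (u - norm u *\<^sub>R v)"
      by (simp add: algebra_simps)
    also have "\<dots> = x + norm u *\<^sub>R q" by (simp only: v(1) diff_self scaleR_zero_right add_0_right)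
    finally have "x + y *\<^sub>R u + norm u *\<^sub>R (q + (- (y *\<^sub>R v))) = x + norm u *\<^sub>R q" .
    then show "g (q + (- (y *\<^sub>R v))) = g' q" unfolding g_def g'_def by (simp only: diff_conv_add_uminus)
  qed
  also have "\<dots> = (LINT c|lborel. g' (cmul v c))"
  proof -
    have "v \<noteq> 0" using v(2) by auto
    from integral_lborel_cmul[OF this g'_borel] show ?thesis by (simp add: v(2))
  qed
  also have "\<dots> = (LINT c|lborel. ?L (x + cmul u c, norm (c - y *\<^sub>R e1)))"
  proof (rule Bochner_Integration.integral_cong[OF refl])
    fix c
    have "norm u *\<^sub>R cmul v c = cmul u c" by (simp only: cmul_scaleR_left[symmetric] v(1))
    moreover have "cmul v c - y *\<^sub>R v = cmul v (c - y *\<^sub>R e1)"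
      using linear_diff[OF linear_cmul_right[of v]] linear_cmul[OF linear_cmul_right[of v]] by (simp add: cmul_axis)
    ultimately show "g' (cmul v c) = ?L (x + cmul u c, norm (c - y *\<^sub>R e1))"
      by (simp add: g'_def norm_cmul v(2))
  qed
  finally show ?thesis .
qed

text \<open>
  After the exchange of the integrals, \<open>v = u c\<close> is for fixed \<open>c\<close> a change of variables in \<open>u\<close> with Jacobian
  \<open>|c|\<^sup>2\<close>.  The exchange is allowed since \<open>|c|\<^sup>2 + \<epsilon>\<^sup>2 |v|\<^sup>2 \<ge> 2 \<epsilon> |c| |v|\<close>, and \<open>1 / |c|\<close> and \<open>1 / |v|\<close> are integrable over
  bounded parts of the plane.
\<close>

lemma regularised_cone_laplacian_integral:
  assumes F: "test_function F" and \<epsilon>: "0 < \<epsilon>"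
  shows "(LINT u|lborel. cone_laplacian F x y u / (1 + \<epsilon>\<^sup>2 * (norm u)\<^sup>2)) =
    (LINT c|lborel. LINT v|lborel. horizontal_laplacian F (x + v, norm (c - y *\<^sub>R e1)) / ((norm c)\<^sup>2 + \<epsilon>\<^sup>2 * (norm v)\<^sup>2))"
proof -
  let ?L = "horizontal_laplacian F"
  have L: "test_function ?L" by (rule test_function_horizontal_laplacian[OF F])
  define t where "t c = norm (c - y *\<^sub>R e1 :: real^2)" for c
  define \<Phi> where "\<Phi> c u = ?L (x + cmul u c, t c) / (1 + \<epsilon>\<^sup>2 * (norm u)\<^sup>2)" for c u
  define \<Psi> where "\<Psi> c v = ?L (x + v, t c) / ((norm c)\<^sup>2 + \<epsilon>\<^sup>2 * (norm v)\<^sup>2)" for c v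
  have den_pos: "0 < 1 + \<epsilon>\<^sup>2 * (norm u)\<^sup>2" for u :: "real^2" by (simp add: add_pos_nonneg)
  then have den_nz: "1 + \<epsilon>\<^sup>2 * (norm u)\<^sup>2 \<noteq> 0" for u :: "real^2" by (simp add: less_imp_neq[symmetric])
  have \<Phi>_meas: "(\<lambda>(c, u). \<Phi> c u) \<in> borel_measurable (lborel \<Otimes>\<^sub>M lborel)"
    unfolding lborel_prod measurable_lborel2 split_beta' \<Phi>_def t_def
    by (intro borel_measurable_continuous_onI continuous_intros continuous_on_compose2[OF test_function_continuous[OF L]])
       (use den_nz in auto)
  obtain R a where R: "0 < R" "\<And>x t. ?L (x, t) \<noteq> 0 \<Longrightarrow> norm x \<le> R \<and> a \<le> t \<and> t \<le> R" "\<And>z. \<bar>?L z\<bar> \<le> R"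
    using test_function_bounds[OF L] by metis
  have \<Psi>_int: "integrable lborel (\<Psi> c)" if "c \<noteq> 0" for c
  proof (rule integrable_bounded_support[of _ "R / (norm c)\<^sup>2" "R + norm x"])
    have pos: "0 < (norm c)\<^sup>2 + \<epsilon>\<^sup>2 * (norm v)\<^sup>2" for v :: "real^2" using that by (simp add: add_pos_nonneg)
    then have nz: "(norm c)\<^sup>2 + \<epsilon>\<^sup>2 * (norm v)\<^sup>2 \<noteq> 0" for v :: "real^2" by (simp add: less_imp_neq[symmetric])
    show "\<Psi> c \<in> borel_measurable borel"
      unfolding \<Psi>_def[abs_def] t_def
      by (intro borel_measurable_continuous_onI continuous_intros continuous_on_compose2[OF test_function_continuous[OF L]])
         (use nz in auto)
    show "norm (\<Psi> c v) \<le> R / (norm c)\<^sup>2" for v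
      using frac_le[OF _ R(3), of "(norm c)\<^sup>2" "(norm c)\<^sup>2 + \<epsilon>\<^sup>2 * (norm v)\<^sup>2" "(x + v, t c)"] R(1) that pos[of v]
      by (simp add: \<Psi>_def)
    show "\<Psi> c v = 0" if "R + norm x < norm v" for v
      using R(2)[of "x + v" "t c"] norm_triangle_ineq4[of "x + v" x] that by (force simp: \<Psi>_def)
  qed
  have \<Phi>_eq: "\<Phi> c u = (norm c)\<^sup>2 * \<Psi> c (cmul c u)" if "c \<noteq> 0" for c u
  proof -
    have "(norm c)\<^sup>2 + \<epsilon>\<^sup>2 * (norm (cmul c u))\<^sup>2 = (norm c)\<^sup>2 * (1 + \<epsilon>\<^sup>2 * (norm u)\<^sup>2)"
      by (simp add: norm_cmul power_mult_distrib algebra_simps)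
    then show ?thesis using that by (simp add: \<Phi>_def \<Psi>_def cmul_commute[of u c])
  qed
  have \<Phi>_int: "integrable lborel (\<Phi> c)" if "c \<noteq> 0" for c
    unfolding \<Phi>_eq[OF that, abs_def]
    by (intro integrable_mult_right integrable_lborel_cmul \<Psi>_int that)
  have \<Phi>_integral: "(LINT u|lborel. \<Phi> c u) = (LINT v|lborel. \<Psi> c v)" if "c \<noteq> 0" for c
    unfolding \<Phi>_eq[OF that] using \<Psi>_int[OF that] that
    by (simp add: integral_lborel_cmul borel_measurable_integrable)
  define q where "q S z = (if norm z \<le> S then 1 / norm z else 0)" for S and z :: "real^2"
  have q: "integrable lborel (q S)" for S
    unfolding q_def[abs_def] by (rule inverse_norm_ball_integrable)
  define R0 R1 where "R0 = R + norm x" and "R1 = R + \<bar>y\<bar>"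
  have \<Psi>_le: "norm (\<Psi> c v) \<le> R / (2 * \<epsilon>) * q R1 c * q R0 v" if "c \<noteq> 0" "v \<noteq> 0" for c v
  proof (cases "?L (x + v, t c) = 0")
    case True
    then show ?thesis using R(1) \<epsilon> by (simp add: \<Psi>_def q_def)
  next
    case False
    then have 1: "norm (x + v) \<le> R" "t c \<le> R" using R(2) by blast+
    have "norm v \<le> R0" using 1(1) norm_triangle_ineq4[of "x + v" x] by (simp add: R0_def)
    moreover have "norm c \<le> R1"
      using 1(2) norm_triangle_ineq[of "c - y *\<^sub>R e1" "y *\<^sub>R e1"] by (simp add: R1_def t_def)
    ultimately have qq: "q R1 c * q R0 v = 1 / (norm c * norm v)" by (simp add: q_def)
    have "0 \<le> (norm c - \<epsilon> * norm v)\<^sup>2" by simp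
    then have amgm: "2 * \<epsilon> * (norm c * norm v) \<le> (norm c)\<^sup>2 + \<epsilon>\<^sup>2 * (norm v)\<^sup>2"
      by (simp add: power2_diff power_mult_distrib mult_ac)
    have "\<bar>?L (x + v, t c)\<bar> / ((norm c)\<^sup>2 + \<epsilon>\<^sup>2 * (norm v)\<^sup>2) \<le> R / (2 * \<epsilon> * (norm c * norm v))"
      using R(1) \<epsilon> that by (intro frac_le R(3) amgm) auto
    also have "\<dots> = R / (2 * \<epsilon>) * q R1 c * q R0 v" by (simp add: qq mult.assoc)
    finally show ?thesis by (simp add: \<Psi>_def)
  qed
  have nonzero: "AE c in lborel. c \<noteq> (0::real^2)" using AE_lborel_singleton[of "0::real^2"] by simp
  have norm_le: "(LINT u|lborel. norm (\<Phi> c u)) \<le> R / (2 * \<epsilon>) * (LINT v|lborel. q R0 v) * q R1 c" if "c \<noteq> 0" for c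
  proof -
    have "(LINT u|lborel. norm (\<Phi> c u)) = (LINT v|lborel. norm (\<Psi> c v))"
      unfolding \<Phi>_eq[OF that] using integral_lborel_cmul[OF that, of "\<lambda>v. norm (\<Psi> c v)"] \<Psi>_int[OF that] that
      by (simp add: abs_mult borel_measurable_integrable)
    also have "\<dots> \<le> (LINT v|lborel. R / (2 * \<epsilon>) * q R1 c * q R0 v)"
    proof (rule integral_mono_AE)
      show "AE v in lborel. norm (\<Psi> c v) \<le> R / (2 * \<epsilon>) * q R1 c * q R0 v"
        using nonzero by eventually_elim (rule \<Psi>_le[OF that])
    qed (intro integrable_norm \<Psi>_int that integrable_mult_right q)+
    finally show ?thesis by (simp add: mult_ac)
  qed
  have pint: "integrable (lborel \<Otimes>\<^sub>M lborel) (\<lambda>(c, u). \<Phi> c u)"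
  proof (rule lborel_pair.Fubini_integrable[OF \<Phi>_meas])
    show "integrable lborel (\<lambda>c. LINT u|lborel. norm (case (c, u) of (c, u) \<Rightarrow> \<Phi> c u))"
    proof (rule Bochner_Integration.integrable_bound[OF integrable_mult_right[OF q[of R1], of "R / (2 * \<epsilon>) * (LINT v|lborel. q R0 v)"]])
      show "(\<lambda>c. LINT u|lborel. norm (case (c, u) of (c, u) \<Rightarrow> \<Phi> c u)) \<in> borel_measurable lborel"
        using \<Phi>_meas by measurable
      show "AE c in lborel. norm (LINT u|lborel. norm (case (c, u) of (c, u) \<Rightarrow> \<Phi> c u)) \<le>
          norm (R / (2 * \<epsilon>) * (LINT v|lborel. q R0 v) * q R1 c)"
        using nonzero
      proof eventually_elim
        case (elim c)
        have "0 \<le> (LINT u|lborel. norm (\<Phi> c u))" by (rule Bochner_Integration.integral_nonneg) simp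
        then show ?case using order_trans[OF norm_le[OF elim] abs_ge_self] by simp
      qed
    qed
    show "AE c in lborel. integrable lborel (\<lambda>u. case (c, u) of (c, u) \<Rightarrow> \<Phi> c u)"
      using nonzero by eventually_elim (use \<Phi>_int in simp)
  qed
  have "(LINT u|lborel. cone_laplacian F x y u / (1 + \<epsilon>\<^sup>2 * (norm u)\<^sup>2)) = (LINT u|lborel. LINT c|lborel. \<Phi> c u)"
  proof (rule integral_discrete_difference[where X = "{0}"])
    fix u :: "real^2" assume "u \<notin> {0}"
    then show "cone_laplacian F x y u / (1 + \<epsilon>\<^sup>2 * (norm u)\<^sup>2) = (LINT c|lborel. \<Phi> c u)"
      by (simp add: cone_laplacian_eq_cmul[OF F] \<Phi>_def t_def)
  qed auto
  also have "\<dots> = (LINT c|lborel. LINT u|lborel. \<Phi> c u)"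
    by (rule lborel_pair.Fubini_integral[OF pint])
  also have "\<dots> = (LINT c|lborel. LINT v|lborel. \<Psi> c v)"
  proof (rule integral_discrete_difference[where X = "{0}"])
    fix c :: "real^2" assume "c \<notin> {0}"
    then show "(LINT u|lborel. \<Phi> c u) = (LINT v|lborel. \<Psi> c v)" by (simp add: \<Phi>_integral)
  qed auto
  finally show ?thesis by (simp add: \<Psi>_def t_def)
qed

text \<open>
  Integration by parts in \<open>v\<close> produces a factor \<open>\<epsilon>\<^sup>2\<close>, and \<open>c = \<epsilon> d\<close> another one; together they cancel the
  \<open>\<epsilon>\<^sup>4\<close> of the denominator.  The remaining \<open>\<epsilon>\<close> is in the height only.
\<close>

lemma regularised_integral_rescaled:
  assumes F: "test_function F" and \<epsilon>: "0 < \<epsilon>"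
  shows "(LINT u|lborel. cone_laplacian F x y u / (1 + \<epsilon>\<^sup>2 * (norm u)\<^sup>2)) =
    (LINT d|lborel. LINT v|lborel. radial_deriv F x v (norm (\<epsilon> *\<^sub>R d - y *\<^sub>R e1)) * (2 / ((norm d)\<^sup>2 + (norm v)\<^sup>2)\<^sup>2))"
proof -
  define t where "t c = norm (c - y *\<^sub>R e1 :: real^2)" for c
  define N where "N c = (LINT v|lborel. 2 * \<epsilon>\<^sup>2 * radial_deriv F x v (t c) / ((norm c)\<^sup>2 + \<epsilon>\<^sup>2 * (norm v)\<^sup>2)\<^sup>2)" for c
  have "(\<lambda>p. radial_deriv F x (snd p) (t (fst p))) \<in> borel_measurable (borel :: ((real^2) \<times> (real^2)) measure)"
  proof (rule borel_measurable_continuous_onI)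
    have "continuous_on UNIV (\<lambda>p :: (real^2) \<times> (real^2). case (snd p, t (fst p)) of (v, t) \<Rightarrow> radial_deriv F x v t)"
      by (rule continuous_on_compose2[OF radial_deriv_continuous[OF F]]) (auto simp: t_def intro!: continuous_intros)
    then show "continuous_on UNIV (\<lambda>p :: (real^2) \<times> (real^2). radial_deriv F x (snd p) (t (fst p)))" by simp
  qed
  then have [measurable]: "(\<lambda>p. radial_deriv F x (snd p) (t (fst p))) \<in> borel_measurable ((borel :: (real^2) measure) \<Otimes>\<^sub>M (borel :: (real^2) measure))"
    by (simp add: borel_prod)
  have N_borel: "N \<in> borel_measurable borel"
  proof -
    have "(\<lambda>(c, v). 2 * \<epsilon>\<^sup>2 * radial_deriv F x v (t c) / ((norm c)\<^sup>2 + \<epsilon>\<^sup>2 * (norm v)\<^sup>2)\<^sup>2) \<in> borel_measurable (borel \<Otimes>\<^sub>M lborel)"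
      unfolding split_beta' by measurable
    from lborel.borel_measurable_lebesgue_integral[OF this] show ?thesis by (simp add: N_def[abs_def])
  qed
  have "(LINT c|lborel. LINT v|lborel. horizontal_laplacian F (x + v, norm (c - y *\<^sub>R e1)) / ((norm c)\<^sup>2 + \<epsilon>\<^sup>2 * (norm v)\<^sup>2)) =
      (LINT c|lborel. N c)"
  proof (rule integral_discrete_difference[where X = "{0}"])
    fix c :: "real^2" assume "c \<notin> {0}"
    then have c: "0 < (norm c)\<^sup>2" by simp
    show "(LINT v|lborel. horizontal_laplacian F (x + v, norm (c - y *\<^sub>R e1)) / ((norm c)\<^sup>2 + \<epsilon>\<^sup>2 * (norm v)\<^sup>2)) = N c"
      unfolding N_def t_def by (rule laplacian_integration_by_parts[OF F c]) simp
  qed auto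
  then have "(LINT u|lborel. cone_laplacian F x y u / (1 + \<epsilon>\<^sup>2 * (norm u)\<^sup>2)) = (LINT c|lborel. N c)"
    by (simp only: regularised_cone_laplacian_integral[OF F \<epsilon>])
  also have "\<dots> = \<epsilon>\<^sup>2 * (LINT d|lborel. N (\<epsilon> *\<^sub>R d))"
    using \<epsilon> by (simp add: integral_lborel_scale[OF _ N_borel])
  also have "\<dots> = (LINT d|lborel. \<epsilon>\<^sup>2 * N (\<epsilon> *\<^sub>R d))" by simp
  also have "\<dots> = (LINT d|lborel. LINT v|lborel. radial_deriv F x v (t (\<epsilon> *\<^sub>R d)) * (2 / ((norm d)\<^sup>2 + (norm v)\<^sup>2)\<^sup>2))"
  proof (rule Bochner_Integration.integral_cong[OF refl])
    fix d :: "real^2"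
    have "\<epsilon>\<^sup>2 * (2 * \<epsilon>\<^sup>2 * r / ((norm (\<epsilon> *\<^sub>R d))\<^sup>2 + \<epsilon>\<^sup>2 * (norm v)\<^sup>2)\<^sup>2) = r * (2 / ((norm d)\<^sup>2 + (norm v)\<^sup>2)\<^sup>2)" for r and v :: "real^2"
    proof -
      have "(norm (\<epsilon> *\<^sub>R d))\<^sup>2 + \<epsilon>\<^sup>2 * (norm v)\<^sup>2 = \<epsilon>\<^sup>2 * ((norm d)\<^sup>2 + (norm v)\<^sup>2)"
        by (simp add: power_mult_distrib distrib_left)
      then have sq: "((norm (\<epsilon> *\<^sub>R d))\<^sup>2 + \<epsilon>\<^sup>2 * (norm v)\<^sup>2)\<^sup>2 = \<epsilon>\<^sup>2 * \<epsilon>\<^sup>2 * ((norm d)\<^sup>2 + (norm v)\<^sup>2)\<^sup>2"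
        by (simp only: power_mult_distrib power2_eq_square[of "\<epsilon>\<^sup>2"])
      have cancel: "e * (2 * e * r / (e * e * D)) = r * (2 / D)" if "e \<noteq> 0" for e D :: real
        using that by simp
      show ?thesis unfolding sq by (rule cancel) (use \<epsilon> in simp)
    qed
    then show "\<epsilon>\<^sup>2 * N (\<epsilon> *\<^sub>R d) = (LINT v|lborel. radial_deriv F x v (t (\<epsilon> *\<^sub>R d)) * (2 / ((norm d)\<^sup>2 + (norm v)\<^sup>2)\<^sup>2))"
      unfolding N_def integral_mult_right_zero[symmetric] by simp
  qed
  finally show ?thesis by (simp add: t_def)
qed

text \<open>
  Let \<open>\<epsilon>\<close> tend to 0.  On the one hand \<open>h\<close> is integrable and dominates its regularisations.  On the other
  hand the rescaled integrand is dominated by a multiple of \<open>|v| / (|d|\<^sup>2 + |v|\<^sup>2)\<^sup>2\<close> with bounded \<open>v\<close>; its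
  integral over \<open>d\<close> is of order \<open>1 / |v|\<close>, which is integrable near 0 in the plane.
\<close>

theorem cone_laplacian_integral:
  assumes F: "test_function F" and y: "0 < y"
  shows "(LINT u|lborel. cone_laplacian F x y u) = - (4 * pi\<^sup>2 * F (x, y))"
proof -
  define \<epsilon> where "\<epsilon> n = 1 / real (Suc n)" for n
  have \<epsilon>: "0 < \<epsilon> n" "\<epsilon> \<longlonglongrightarrow> 0" for n
    unfolding \<epsilon>_def by (simp, rule LIMSEQ_Suc[OF lim_const_over_n])
  define I where "I n = (LINT u|lborel. cone_laplacian F x y u / (1 + (\<epsilon> n)\<^sup>2 * (norm u)\<^sup>2))" for n
  have h_borel[measurable]: "cone_laplacian F x y \<in> borel_measurable borel" by (rule cone_laplacian_measurable[OF F])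
  have "I \<longlonglongrightarrow> (LINT u|lborel. cone_laplacian F x y u)"
    unfolding I_def
  proof (rule integral_dominated_convergence[OF _ _ integrable_norm[OF cone_laplacian_integrable[OF F]]])
    show "AE u in lborel. (\<lambda>n. cone_laplacian F x y u / (1 + (\<epsilon> n)\<^sup>2 * (norm u)\<^sup>2)) \<longlonglongrightarrow> cone_laplacian F x y u"
    proof (rule AE_I2)
      fix u
      have "(\<lambda>n. cone_laplacian F x y u / (1 + (\<epsilon> n)\<^sup>2 * (norm u)\<^sup>2)) \<longlonglongrightarrow> cone_laplacian F x y u / (1 + 0\<^sup>2 * (norm u)\<^sup>2)"
        by (intro tendsto_intros \<epsilon>(2)) simp
      then show "(\<lambda>n. cone_laplacian F x y u / (1 + (\<epsilon> n)\<^sup>2 * (norm u)\<^sup>2)) \<longlonglongrightarrow> cone_laplacian F x y u" by simp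
    qed
    show "AE u in lborel. norm (cone_laplacian F x y u / (1 + (\<epsilon> n)\<^sup>2 * (norm u)\<^sup>2)) \<le> norm (cone_laplacian F x y u)" for n
    proof (rule AE_I2)
      fix u
      have "\<bar>cone_laplacian F x y u\<bar> / (1 + (\<epsilon> n)\<^sup>2 * (norm u)\<^sup>2) \<le> \<bar>cone_laplacian F x y u\<bar> / 1"
        by (intro divide_left_mono) (auto simp: add_pos_nonneg)
      moreover have "0 \<le> 1 + (\<epsilon> n)\<^sup>2 * (norm u)\<^sup>2" by simp
      ultimately show "norm (cone_laplacian F x y u / (1 + (\<epsilon> n)\<^sup>2 * (norm u)\<^sup>2)) \<le> norm (cone_laplacian F x y u)"
        by simp
    qed
  qed measurable
  moreover have "I \<longlonglongrightarrow> - (4 * pi\<^sup>2 * F (x, y))"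
  proof -
    obtain M R where M: "0 \<le> M" "0 < R" "\<And>v t. \<bar>radial_deriv F x v t\<bar> \<le> (if norm v \<le> R then M * norm v else 0)"
      using radial_deriv_bound[OF F, of x] by metis
    define t where "t c = norm (c - y *\<^sub>R e1 :: real^2)" for c
    define k where "k v d = 2 / ((norm d)\<^sup>2 + (norm v)\<^sup>2)\<^sup>2" for v d :: "real^2"
    have k0: "0 \<le> k v d" for v d by (simp add: k_def)
    define G where "G s v d = radial_deriv F x v (t (s *\<^sub>R d)) * k v d" for s v d
    define m where "m v = (if norm v \<le> R then M * norm v else 0)" for v :: "real^2"
    have [measurable]: "m \<in> borel_measurable borel" unfolding m_def by measurable
    have m0: "0 \<le> m v" for v using M(1) by (simp add: m_def)
    have nonzero: "AE v in lborel. v \<noteq> (0::real^2)" using AE_lborel_singleton[of "0::real^2"] by simp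
    have k_int: "has_bochner_integral lborel (k v) (2 * pi / (norm v)\<^sup>2)" if "v \<noteq> 0" for v
      using plane_kernel_integral[of "norm v"] that by (simp add: k_def[abs_def])
    have G_meas: "(\<lambda>(v, d). G s v d) \<in> borel_measurable (lborel \<Otimes>\<^sub>M lborel)" for s
    proof -
      have "(\<lambda>p. radial_deriv F x (fst p) (t (s *\<^sub>R snd p))) \<in> borel_measurable (borel :: ((real^2) \<times> (real^2)) measure)"
      proof (rule borel_measurable_continuous_onI)
        have "continuous_on UNIV (\<lambda>p :: (real^2) \<times> (real^2). case (fst p, t (s *\<^sub>R snd p)) of (v, t) \<Rightarrow> radial_deriv F x v t)"
          by (rule continuous_on_compose2[OF radial_deriv_continuous[OF F]]) (auto simp: t_def intro!: continuous_intros)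
        then show "continuous_on UNIV (\<lambda>p :: (real^2) \<times> (real^2). radial_deriv F x (fst p) (t (s *\<^sub>R snd p)))" by simp
      qed
      then have [measurable]: "(\<lambda>p. radial_deriv F x (fst p) (t (s *\<^sub>R snd p))) \<in> borel_measurable ((borel :: (real^2) measure) \<Otimes>\<^sub>M (borel :: (real^2) measure))"
        by (simp add: borel_prod)
      show ?thesis unfolding split_beta' G_def k_def by measurable
    qed
    have dom: "integrable (lborel \<Otimes>\<^sub>M lborel) (\<lambda>(v, d). m v * k v d)"
    proof (rule lborel_pair.Fubini_integrable)
      show "(\<lambda>(v, d). m v * k v d) \<in> borel_measurable (lborel \<Otimes>\<^sub>M lborel)"
        unfolding k_def by measurable
      show "integrable lborel (\<lambda>v. LINT d|lborel. norm (case (v, d) of (v, d) \<Rightarrow> m v * k v d))"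
      proof (subst integrable_discrete_difference[where X = "{0}" and g = "\<lambda>v. 2 * pi * M * (if norm v \<le> R then 1 / norm v else 0)"])
        fix v :: "real^2" assume "v \<notin> {0}"
        then have "(LINT d|lborel. k v d) = 2 * pi / (norm v)\<^sup>2" using k_int by (simp add: has_bochner_integral_iff)
        then show "(LINT d|lborel. norm (case (v, d) of (v, d) \<Rightarrow> m v * k v d)) = 2 * pi * M * (if norm v \<le> R then 1 / norm v else 0)"
          using m0[of v] k0 \<open>v \<notin> {0}\<close> by (simp add: abs_mult m_def power2_eq_square)
      qed (auto intro!: inverse_norm_ball_integrable)
      show "AE v in lborel. integrable lborel (\<lambda>d. case (v, d) of (v, d) \<Rightarrow> m v * k v d)"
        using nonzero by eventually_elim (use k_int in \<open>auto simp: has_bochner_integral_iff\<close>)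
    qed
    have G_le: "norm (G s v d) \<le> m v * k v d" for s v d
      unfolding G_def real_norm_def abs_mult using M(3)[of v] k0[of v d] by (intro mult_mono) (auto simp: m_def M(1))
    have G_int: "integrable (lborel \<Otimes>\<^sub>M lborel) (\<lambda>(v, d). G s v d)" for s
    proof (rule Bochner_Integration.integrable_bound[OF dom G_meas])
      show "AE z in lborel \<Otimes>\<^sub>M lborel. norm (case z of (v, d) \<Rightarrow> G s v d) \<le> norm (case z of (v, d) \<Rightarrow> m v * k v d)"
        using G_le m0 k0 by (auto simp: abs_mult)
    qed
    have I_eq: "I n = (LINT z|(lborel \<Otimes>\<^sub>M lborel). (case z of (v, d) \<Rightarrow> G (\<epsilon> n) v d))" for n
    proof -
      have "I n = (LINT d|lborel. LINT v|lborel. G (\<epsilon> n) v d)"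
        unfolding I_def regularised_integral_rescaled[OF F \<epsilon>(1)] G_def k_def t_def ..
      also have "\<dots> = (LINT z|(lborel \<Otimes>\<^sub>M lborel). (case z of (v, d) \<Rightarrow> G (\<epsilon> n) v d))"
        by (rule lborel_pair.integral_snd[OF G_int])
      finally show ?thesis .
    qed
    have "I \<longlonglongrightarrow> (LINT z|(lborel \<Otimes>\<^sub>M lborel). (case z of (v, d) \<Rightarrow> G 0 v d))"
      unfolding I_eq
    proof (rule integral_dominated_convergence[OF G_meas G_meas dom])
      show "AE z in lborel \<Otimes>\<^sub>M lborel. (\<lambda>n. case z of (v, d) \<Rightarrow> G (\<epsilon> n) v d) \<longlonglongrightarrow> (case z of (v, d) \<Rightarrow> G 0 v d)"
      proof (rule AE_I2)
        fix z :: "(real^2) \<times> (real^2)"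
        obtain v d where z: "z = (v, d)" by (cases z)
        have "continuous_on UNIV (\<lambda>s. case (v, t (s *\<^sub>R d)) of (v, t) \<Rightarrow> radial_deriv F x v t)"
          by (rule continuous_on_compose2[OF radial_deriv_continuous[OF F]]) (auto simp: t_def intro!: continuous_intros)
        then have "isCont (\<lambda>s. radial_deriv F x v (t (s *\<^sub>R d))) 0" by (simp add: continuous_on_eq_continuous_at)
        from isCont_tendsto_compose[OF this \<epsilon>(2)]
        have "(\<lambda>n. G (\<epsilon> n) v d) \<longlonglongrightarrow> G 0 v d" unfolding G_def by (intro tendsto_mult tendsto_const)
        then show "(\<lambda>n. case z of (v, d) \<Rightarrow> G (\<epsilon> n) v d) \<longlonglongrightarrow> (case z of (v, d) \<Rightarrow> G 0 v d)" by (simp add: z)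
      qed
      show "AE z in lborel \<Otimes>\<^sub>M lborel. norm (case z of (v, d) \<Rightarrow> G (\<epsilon> n) v d) \<le> (case z of (v, d) \<Rightarrow> m v * k v d)" for n
        using G_le by auto
    qed
    also have "(LINT z|(lborel \<Otimes>\<^sub>M lborel). (case z of (v, d) \<Rightarrow> G 0 v d)) = (LINT v|lborel. LINT d|lborel. G 0 v d)"
      by (rule lborel_pair.integral_fst[OF G_int, symmetric])
    also have "\<dots> = (LINT v|lborel. 2 * pi * (radial_deriv F x v y / (norm v)\<^sup>2))"
    proof (rule integral_discrete_difference[where X = "{0}"])
      fix v :: "real^2" assume "v \<notin> {0}"
      have "t (0 *\<^sub>R d) = y" for d using y by (simp add: t_def)
      then show "(LINT d|lborel. G 0 v d) = 2 * pi * (radial_deriv F x v y / (norm v)\<^sup>2)"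
        using k_int[of v] \<open>v \<notin> {0}\<close> by (simp add: G_def has_bochner_integral_iff)
    qed auto
    also have "\<dots> = - (4 * pi\<^sup>2 * F (x, y))"
      unfolding integral_mult_right_zero radial_deriv_integral[OF F] by (simp add: power2_eq_square)
    finally show ?thesis .
  qed
  ultimately show ?thesis by (rule LIMSEQ_unique)
qed

text \<open>
  Polar coordinates for \<open>h\<close> give the formula over \<open>\<theta>\<close> after \<open>r = tan \<theta>\<close>, and the affine substitution of \<open>x + y w\<close> for
  \<open>u\<close> gives the formula over the plane.
\<close>

theorem inversion_dim3:
  fixes p :: real and f :: "(real^2) \<times> real \<Rightarrow> real"
  assumes f: "test_function f" and y: "0 < y"
  shows "has_bochner_integral lborel (\<lambda>\<theta>. indicator {0<..<pi / 2} \<theta> *\<^sub>R (1 / cos \<theta> powr (1 + p)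
      * (LINT n|sphere_measure. laplacian_radon p f (x + (y * tan \<theta>) *\<^sub>R n) \<theta>))) (- (4 * pi\<^sup>2 * (y powr (- p) * f (x, y))))" (is ?A)
    and "has_bochner_integral lborel (\<lambda>u. (norm (u - x) ^ 2 + y\<^sup>2) powr ((p - 1) / 2) / norm (u - x)
      * laplacian_radon p f u (arctan (norm (u - x) / y))) (- (4 * pi\<^sup>2 * f (x, y)))" (is ?B)
proof -
  define F where "F = power_weight p f"
  have F: "test_function F" unfolding F_def by (rule test_function_weighted[OF f])
  define h where "h = cone_laplacian F x y"
  have h_borel[measurable]: "h \<in> borel_measurable borel" unfolding h_def by (rule cone_laplacian_measurable[OF F])
  have h_int: "integrable lborel h" unfolding h_def by (rule cone_laplacian_integrable[OF F])
  have h_val: "(LINT u|lborel. h u) = - (4 * pi\<^sup>2 * F (x, y))" unfolding h_def by (rule cone_laplacian_integral[OF F y])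
  define A where "A r = r * (LINT n|sphere_measure. h (r *\<^sub>R n))" for r
  have [measurable]: "A \<in> borel_measurable borel" unfolding A_def[abs_def] by measurable
  have A: "has_bochner_integral lborel (\<lambda>r. indicator {0<..} r *\<^sub>R A r) (- (4 * pi\<^sup>2 * F (x, y)))"
  proof -
    have "integrable (lborel \<Otimes>\<^sub>M sphere_measure) (\<lambda>(r, n). polar_density TYPE(real^2) r *\<^sub>R h (r *\<^sub>R n))"
      using h_int integrable_polar_iff[OF h_borel] by simp
    from lborel_sphere.integrable_fst[OF this]
    have "integrable lborel (\<lambda>r. polar_density TYPE(real^2) r *\<^sub>R (LINT n|sphere_measure. h (r *\<^sub>R n)))" by simp
    moreover have "(\<lambda>r. polar_density TYPE(real^2) r *\<^sub>R (LINT n|sphere_measure. h (r *\<^sub>R n))) = (\<lambda>r. indicator {0<..} r *\<^sub>R A r)"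
      by (auto simp: fun_eq_iff polar_density_plane A_def indicator_def)
    ultimately show ?thesis
      using integral_polar[OF h_borel h_int] h_val by (simp add: has_bochner_integral_iff)
  qed
  have radon: "laplacian_radon p f u \<theta> = cos \<theta> powr (p - 1) * tan \<theta> * cone_integral (horizontal_laplacian F) u (tan \<theta>)"
    if "0 < \<theta>" "\<theta> < pi / 2" for u \<theta>
    using laplacian_radon_eq[OF f that] by (simp add: F_def)
  show ?A
  proof -
    have "has_bochner_integral lborel (\<lambda>\<theta>. indicator {0<..<pi / 2} \<theta> *\<^sub>R ((1 / (cos \<theta>)\<^sup>2) *\<^sub>R A (tan \<theta>)))
        (- (4 * pi\<^sup>2 * F (x, y)))"
      by (rule has_bochner_integral_tan_substitution[OF A]) measurable
    also have "(\<lambda>\<theta>. indicator {0<..<pi / 2} \<theta> *\<^sub>R ((1 / (cos \<theta>)\<^sup>2) *\<^sub>R A (tan \<theta>))) =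
      (\<lambda>\<theta>. indicator {0<..<pi / 2} \<theta> *\<^sub>R (1 / cos \<theta> powr (1 + p)
      * (LINT n|sphere_measure. laplacian_radon p f (x + (y * tan \<theta>) *\<^sub>R n) \<theta>)))"
    proof
      fix \<theta>
      show "indicator {0<..<pi / 2} \<theta> *\<^sub>R ((1 / (cos \<theta>)\<^sup>2) *\<^sub>R A (tan \<theta>)) =
        indicator {0<..<pi / 2} \<theta> *\<^sub>R (1 / cos \<theta> powr (1 + p)
        * (LINT n|sphere_measure. laplacian_radon p f (x + (y * tan \<theta>) *\<^sub>R n) \<theta>))"
      proof (cases "\<theta> \<in> {0<..<pi / 2}")
        case True
        then have \<theta>: "0 < \<theta>" "\<theta> < pi / 2" by auto
        have c: "0 < cos \<theta>" and t: "0 < tan \<theta>" using \<theta> cos_gt_zero[of \<theta>] tan_gt_zero[of \<theta>] by auto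
        have "(LINT n|sphere_measure. laplacian_radon p f (x + (y * tan \<theta>) *\<^sub>R n) \<theta>) =
            (LINT n|sphere_measure. cos \<theta> powr (p - 1) * tan \<theta> * h (tan \<theta> *\<^sub>R n))"
        proof (rule integral_cong_AE)
          have eq: "laplacian_radon p f (x + (y * tan \<theta>) *\<^sub>R n) \<theta> = cos \<theta> powr (p - 1) * tan \<theta> *
              cone_integral (horizontal_laplacian F) (x + (y * tan \<theta>) *\<^sub>R n) (tan \<theta>)" for n
            by (rule radon[OF \<theta>])
          show "AE n in sphere_measure. laplacian_radon p f (x + (y * tan \<theta>) *\<^sub>R n) \<theta> = cos \<theta> powr (p - 1) * tan \<theta> * h (tan \<theta> *\<^sub>R n)"
            using AE_sphere_measure_norm
          proof eventually_elim
            case (elim n)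
            then show ?case unfolding eq using t by (simp add: h_def cone_laplacian_def)
          qed
          have "(\<lambda>n. cone_integral (horizontal_laplacian F) (x + (y * tan \<theta>) *\<^sub>R n) (tan \<theta>)) \<in> borel_measurable borel"
            using cone_integral_measurable[OF test_function_horizontal_laplacian[OF F]]
            by (rule measurable_Pair_compose_split) measurable
          then show "(\<lambda>n. laplacian_radon p f (x + (y * tan \<theta>) *\<^sub>R n) \<theta>) \<in> borel_measurable sphere_measure"
            unfolding eq by measurable
        qed measurable
        then have "(LINT n|sphere_measure. laplacian_radon p f (x + (y * tan \<theta>) *\<^sub>R n) \<theta>) = cos \<theta> powr (p - 1) * A (tan \<theta>)"
          by (simp add: A_def)
        moreover have "1 / cos \<theta> powr (1 + p) * cos \<theta> powr (p - 1) = 1 / (cos \<theta>)\<^sup>2"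
        proof -
          have "1 / cos \<theta> powr (1 + p) * cos \<theta> powr (p - 1) = cos \<theta> powr (- 2)"
            by (simp flip: powr_diff)
          also have "\<dots> = 1 / (cos \<theta>)\<^sup>2" using c by (simp add: powr_minus_divide)
          finally show ?thesis .
        qed
        ultimately show ?thesis by (simp flip: mult.assoc)
      qed simp
    qed
    finally show ?thesis by (simp add: F_def power_weight_def)
  qed
  show ?B
  proof -
    let ?J = "\<lambda>u. (norm (u - x) ^ 2 + y\<^sup>2) powr ((p - 1) / 2) / norm (u - x) * laplacian_radon p f u (arctan (norm (u - x) / y))"
    define J where "J v = ?J (v + x)" for v
    define V where "V = - (4 * pi\<^sup>2 * f (x, y))"
    have J_eq: "J (y *\<^sub>R w) = y powr (p - 2) * h w" if "w \<noteq> 0" for w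
    proof -
      have t: "0 < norm w" using that by simp
      have th: "0 < arctan (norm w)" "arctan (norm w) < pi / 2" using t arctan_ubound by auto
      have "J (y *\<^sub>R w) = ((y * norm w)\<^sup>2 + y\<^sup>2) powr ((p - 1) / 2) / (y * norm w) * laplacian_radon p f (x + y *\<^sub>R w) (arctan (norm w))"
        using y by (simp add: J_def add.commute)
      also have "\<dots> = (((y * norm w)\<^sup>2 + y\<^sup>2) powr ((p - 1) / 2) * cos (arctan (norm w)) powr (p - 1)) / y * h w"
        unfolding radon[OF th] using t by (simp add: tan_arctan h_def cone_laplacian_def)
      also have "\<dots> = y powr (p - 1) / y * h w"
        using powr_cos_arctan[OF y, of "norm w" p] by simp
      also have "y powr (p - 1) / y = y powr (p - 2)" using y powr_diff[of y "p - 1" 1] by simp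
      finally show ?thesis .
    qed
    have "has_bochner_integral lborel (\<lambda>w. y powr (p - 2) * h w) (y powr (p - 2) * - (4 * pi\<^sup>2 * F (x, y)))"
      using h_int h_val by (simp add: has_bochner_integral_iff)
    also have "?this \<longleftrightarrow> has_bochner_integral lborel (\<lambda>w. J (y *\<^sub>R w)) (y powr (p - 2) * - (4 * pi\<^sup>2 * F (x, y)))"
      by (rule has_bochner_integral_discrete_difference[where X = "{0}"]) (auto simp: J_eq)
    finally have J1: "has_bochner_integral lborel (\<lambda>w. J (y *\<^sub>R w)) (y powr (p - 2) * - (4 * pi\<^sup>2 * F (x, y)))" .
    have "integrable lborel (\<lambda>w. J (y *\<^sub>R ((1 / y) *\<^sub>R w)))"
      by (rule integrable_lborel_scale) (use y J1 in \<open>auto simp: has_bochner_integral_iff\<close>)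
    then have J_int: "integrable lborel J" using y by simp
    have J_borel: "J \<in> borel_measurable borel" using borel_measurable_integrable[OF J_int] by simp
    have "(LINT v|lborel. J v) = y\<^sup>2 * (LINT w|lborel. J (y *\<^sub>R w))"
      using integral_lborel_scale[OF _ J_borel, of y] y by simp
    also have "(LINT w|lborel. J (y *\<^sub>R w)) = y powr (p - 2) * - (4 * pi\<^sup>2 * F (x, y))"
      using J1 by (simp only: has_bochner_integral_iff)
    also have "y\<^sup>2 * (y powr (p - 2) * - (4 * pi\<^sup>2 * F (x, y))) = V"
    proof -
      have "y\<^sup>2 * y powr (p - 2) * y powr (- p) = 1"
        using y by (simp add: powr_diff powr_minus)
      then have "y\<^sup>2 * (y powr (p - 2) * - (4 * pi\<^sup>2 * (y powr (- p) * f (x, y)))) = 1 * - (4 * pi\<^sup>2 * f (x, y))"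
        by (metis (no_types, opaque_lifting) mult.assoc mult.left_commute mult_minus_right)
      then show ?thesis by (simp add: V_def F_def power_weight_def)
    qed
    finally have "(LINT v|lborel. J v) = V" .
    moreover have "integrable lborel (\<lambda>u. J (u + (- x)))" by (rule integrable_lborel_translate[OF J_int])
    moreover have "(LINT u|lborel. J (u + (- x))) = (LINT v|lborel. J v)" by (rule integral_lborel_translate[OF J_borel])
    moreover have "J (u + (- x)) = ?J u" for u by (simp add: J_def)
    ultimately show ?thesis by (simp add: has_bochner_integral_iff V_def)
  qed
qed

theorem corollary1p2:
  fixes p :: real
  shows
    "(\<forall>(f :: real \<times> real \<Rightarrow> real) (x :: real) (y :: real).
        test_function f \<and> 0 < y \<longrightarrow>
        (let I1 = (\<lambda>\<theta>. (d_hilbert_radon p f (x + y * tan \<theta>) \<theta> + d_hilbert_radon p f (x - y * tan \<theta>) \<theta>)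
                        / complex_of_real (cos \<theta> powr (1 + p)));
             I2 = (\<lambda>u :: real. complex_of_real ((\<bar>u - x\<bar>\<^sup>2 + y\<^sup>2) powr ((p - 1) / 2))
                        * d_hilbert_radon p f u (arctan (\<bar>u - x\<bar> / y)))
         in set_integrable lborel {0<..<pi / 2} I1 \<and>
            complex_of_real (f (x, y)) =
              complex_of_real (y powr p / (2 * pi)) * (LBINT \<theta>:{0<..<pi / 2}. I1 \<theta>) \<and>
            integrable lborel I2 \<and>
            complex_of_real (f (x, y)) = complex_of_real (1 / (2 * pi)) * (LBINT u. I2 u)))
     \<and>
     (\<forall>(f :: (real ^ 2) \<times> real \<Rightarrow> real) (x :: real ^ 2) (y :: real).
        test_function f \<and> 0 < y \<longrightarrow>
        (let J1 = (\<lambda>\<theta>. 1 / cos \<theta> powr (1 + p)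
                        * (LINT n|sphere_measure. laplacian_radon p f (x + (y * tan \<theta>) *\<^sub>R n) \<theta>));
             J2 = (\<lambda>u :: real ^ 2. (norm (u - x) ^ 2 + y\<^sup>2) powr ((p - 1) / 2) / norm (u - x)
                        * laplacian_radon p f u (arctan (norm (u - x) / y)))
         in set_integrable lborel {0<..<pi / 2} J1 \<and>
            f (x, y) = - (y powr p / (4 * pi\<^sup>2)) * (LBINT \<theta>:{0<..<pi / 2}. J1 \<theta>) \<and>
            integrable lborel J2 \<and>
            f (x, y) = - (1 / (4 * pi\<^sup>2)) * (LBINT u. J2 u)))"
proof ((rule conjI; intro allI impI; elim conjE), goal_cases)
  case (1 f x y)
  note A = inversion_dim2(1)[OF 1, of p x] and B = inversion_dim2(2)[OF 1, of x p]
  have "y powr p * y powr (- p) = 1" using \<open>0 < y\<close> by (simp add: powr_minus)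
  then have "y powr p / (2 * pi) * (2 * pi * (y powr (- p) * f (x, y))) = f (x, y)"
    by (simp flip: mult.assoc)
  moreover have "1 / (2 * pi) * (2 * pi * f (x, y)) = f (x, y)" by simp
  ultimately show ?case
    using A B unfolding Let_def set_integrable_def set_lebesgue_integral_def
    by (simp only: has_bochner_integral_iff of_real_mult[symmetric] simp_thms)
next
  case (2 f x y)
  note A = inversion_dim3(1)[OF 2, of p x] and B = inversion_dim3(2)[OF 2, of x p]
  have "y powr p * y powr (- p) = 1" using \<open>0 < y\<close> by (simp add: powr_minus)
  then have "- (y powr p / (4 * pi\<^sup>2)) * (- (4 * pi\<^sup>2 * (y powr (- p) * f (x, y)))) = f (x, y)"
    by (simp flip: mult.assoc)
  moreover have "- (1 / (4 * pi\<^sup>2)) * (- (4 * pi\<^sup>2 * f (x, y))) = f (x, y)" by simp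
  ultimately show ?case
    using A B unfolding Let_def set_integrable_def set_lebesgue_integral_def
    by (simp only: has_bochner_integral_iff simp_thms)
qed

end
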